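(* Let $K\subset\mathbb{R}^n$ be a closed convex set with diameter $d$, let $c>1$ be a constant, and for $\sigma>0$ define $$\overline{\varepsilon}(\sigma):=\sup\Big\{\varepsilon:\ \sup_{\mu\in K}\Big[w_\mu(\varepsilon)-\inf_{\nu\in B(\mu,\varepsilon)\cap K}w_\nu(\varepsilon/c)\Big]\ge\Big(4+\frac4c\Big)\frac{\varepsilon^2}{2\sigma}\Big\}.$$ Set $\sigma'=4c\sigma/(c-1)$. If $\overline{\varepsilon}(\sigma)\gtrsim\sigma$ for a sufficiently large constant, then $\overline{\varepsilon}(\sigma)/c\le\varepsilon_K(\sigma)\le\overline{\varepsilon}(\sigma')$; if $\overline{\varepsilon}(\sigma')\lesssim\sigma$, then $\varepsilon_K(\sigma)\asymp\sigma\wedge d$.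
   Context: Gaussian sequence model: $Y=\mu+\xi$, $\mu\in K$, $\xi\sim N(0,\sigma^2\mathbb{I}_n)$; LSE $\hat\mu=\operatorname{argmin}_{\nu\in K}\|Y-\nu\|_2^2$; $\varepsilon_K(\sigma)^2=\sup_{\mu\in K}\mathbb{E}_\mu\|\hat\mu-\mu\|_2^2$. Local Gaussian width $w_\mu(\varepsilon)=\mathbb{E}\sup_{t\in B(\mu,\varepsilon)\cap K}\langle x,t\rangle$, $x\sim N(0,\mathbb{I}_n)$, $B$ the closed Euclidean ball. $\lesssim,\asymp$ hide absolute constants. *)

theory Defs
  imports "HOL-Probability.Probability"
begin

text \<open>Vectors of R^n are represented as functions nat => real vanishing at indices >= n,
 so that the dimension n can be quantified inside the statement (needed for absolute,
 dimension-free constants).\<close>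

definition vecs :: "nat \<Rightarrow> (nat \<Rightarrow> real) set" where
  "vecs n = {x. \<forall>i\<ge>n. x i = 0}"

definition ip :: "nat \<Rightarrow> (nat \<Rightarrow> real) \<Rightarrow> (nat \<Rightarrow> real) \<Rightarrow> real" where
  "ip n x y = (\<Sum>i<n. x i * y i)"

definition dst :: "nat \<Rightarrow> (nat \<Rightarrow> real) \<Rightarrow> (nat \<Rightarrow> real) \<Rightarrow> real" where
  "dst n x y = sqrt (\<Sum>i<n. (x i - y i)\<^sup>2)"

definition cb :: "nat \<Rightarrow> (nat \<Rightarrow> real) \<Rightarrow> real \<Rightarrow> (nat \<Rightarrow> real) set" where
  "cb n \<mu> r = {t \<in> vecs n. dst n \<mu> t \<le> r}"

definition eclosed :: "nat \<Rightarrow> (nat \<Rightarrow> real) set \<Rightarrow> bool" where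
  "eclosed n K \<longleftrightarrow> (\<forall>x s. x \<in> vecs n \<and> (\<forall>k. s k \<in> K) \<and> (\<lambda>k. dst n (s k) x) \<longlonglongrightarrow> 0 \<longrightarrow> x \<in> K)"

definition econvex :: "(nat \<Rightarrow> real) set \<Rightarrow> bool" where
  "econvex K \<longleftrightarrow> (\<forall>x\<in>K. \<forall>y\<in>K. \<forall>t::real. 0 \<le> t \<and> t \<le> 1 \<longrightarrow> (\<lambda>i. t * x i + (1 - t) * y i) \<in> K)"

definition ebounded :: "nat \<Rightarrow> (nat \<Rightarrow> real) set \<Rightarrow> bool" where
  "ebounded n K \<longleftrightarrow> (\<exists>B. \<forall>x\<in>K. \<forall>y\<in>K. dst n x y \<le> B)"

definition ediam :: "nat \<Rightarrow> (nat \<Rightarrow> real) set \<Rightarrow> real" where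
  "ediam n K = (SUP p \<in> K \<times> K. dst n (fst p) (snd p))"

definition gauss :: "nat \<Rightarrow> (nat \<Rightarrow> real) measure" where
  "gauss n = PiM {..<n} (\<lambda>_. density lborel std_normal_density)"

definition lwidth :: "nat \<Rightarrow> (nat \<Rightarrow> real) set \<Rightarrow> (nat \<Rightarrow> real) \<Rightarrow> real \<Rightarrow> real" where
  "lwidth n K \<mu> \<epsilon> = (\<integral>z. (SUP t \<in> cb n \<mu> \<epsilon> \<inter> K. ip n z t) \<partial>gauss n)"

definition lse :: "nat \<Rightarrow> (nat \<Rightarrow> real) set \<Rightarrow> (nat \<Rightarrow> real) \<Rightarrow> (nat \<Rightarrow> real)" where
  "lse n K Y = (SOME \<nu>. \<nu> \<in> K \<and> (\<forall>\<eta>\<in>K. dst n Y \<nu> \<le> dst n Y \<eta>))"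

definition lse_risk :: "nat \<Rightarrow> (nat \<Rightarrow> real) set \<Rightarrow> real \<Rightarrow> real" where
  "lse_risk n K \<sigma> = sqrt (SUP \<mu> \<in> K.
     (\<integral>z. (dst n (lse n K (\<lambda>i. if i < n then \<mu> i + \<sigma> * z i else 0)) \<mu>)\<^sup>2 \<partial>gauss n))"

definition eps_bar :: "nat \<Rightarrow> (nat \<Rightarrow> real) set \<Rightarrow> real \<Rightarrow> real \<Rightarrow> real" where
  "eps_bar n K c \<sigma> = Sup {\<epsilon>. 0 \<le> \<epsilon> \<and>
     (SUP \<mu> \<in> K. lwidth n K \<mu> \<epsilon> - (INF \<nu> \<in> cb n \<mu> \<epsilon> \<inter> K. lwidth n K \<nu> (\<epsilon> / c)))
       \<ge> (4 + 4 / c) * \<epsilon>\<^sup>2 / (2 * \<sigma>)}"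

end

theory Submission
  imports Defs
begin

text \<open>Fix the truth \<open>\<mu>\<close>, write \<open>\<Delta>\<close> for the error of the estimator and \<open>w\<close> for the local width at \<open>\<mu>\<close>.
 The optimality condition of the projection says
 \<open>\<sigma> \<langle>z, v\<rangle> \<le> \<sigma> \<langle>z, \<Delta>\<rangle> + \<langle>\<Delta>, v\<rangle> - \<bar>\<Delta>\<bar>\<^sup>2\<close> for every \<open>v\<close> in \<open>K - \<mu>\<close>. Taking the supremum over
 \<open>\<bar>v\<bar> \<le> t\<close> and expectations bounds \<open>w t\<close> from above by \<open>E \<langle>z, \<Delta>\<rangle>\<close> and the risk. The main point is
 that \<open>E \<langle>z, \<Delta>\<rangle> \<le> w r + O(r)\<close> with \<open>r\<^sup>2 = E \<bar>\<Delta>\<bar>\<^sup>2\<close>, with no dependence on the dimension or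
 on the slope of \<open>w\<close>: the local supremum is concave in the radius and has variance \<open>O(t\<^sup>2)\<close> at radius
 \<open>t\<close>, so its excess over a supporting line of \<open>w\<close> at \<open>r\<close> is \<open>O(r)\<close> in mean, uniformly in the
 radius. Since the error is linear in \<open>r\<close> while the inequalities defining the critical radius
 have a quadratic margin, both bounds hold with their exact constants once the radius exceeds a
 multiple of \<open>\<sigma>\<close>.\<close>

section \<open>Euclidean geometry and projections\<close>

text \<open>The difficulty is that \<Delta> is a function of the noise, so E \<langle>z,
  \<Delta>\<rangle> lives at a random radius of which only the second moment is known. That moment
  also caps the mean radius by r, so the supporting line, whose slope is nonnegative, contributes
  nothing. The variance of a local supremum gets its dimension-free constant by joining two
  independent noise vectors through many small rotations; this uses only almost maximisers and no
  derivative of the supremum. The constants 4 + 4/c and \<sigma>' balance the cross term t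
  r/\<sigma>. For the lower bound on the risk the gap is recentred at the second centre \<nu>, which
  doubles the radius: with t = 2\<epsilon> and r = \<epsilon>/c the cross term is
  2\<epsilon>^2/(c\<sigma>), and the threshold exceeds it by 2\<epsilon>^2/\<sigma>. For the upper
  bound t = r/c, and \<sigma>' leaves the margin (1 - 1/c)^2 r^2/(2\<sigma>). In the regime where
  the critical radius is at most a multiple of \<sigma>, the lower bound of order min \<sigma> d
  does not come from widths but from comparing the laws of the data under two nearby means.\<close>

lemma dst_L2_set: "dst n x y = L2_set (\<lambda>i. x i - y i) {..<n}"
  by (simp add: dst_def L2_set_def)

lemma dst_nonneg [simp]: "0 \<le> dst n x y"
  by (simp add: dst_L2_set)

lemma dst_self [simp]: "dst n x x = 0"
  by (simp add: dst_def)

lemma dst_sym: "dst n x y = dst n y x"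
  by (simp add: dst_def power2_commute)

lemma dst_triangle: "dst n x z \<le> dst n x y + dst n y z"
  using L2_set_triangle_ineq[of "\<lambda>i. x i - y i" "\<lambda>i. y i - z i" "{..<n}"]
  by (simp add: dst_L2_set)

lemma dst_power2: "(dst n x y)\<^sup>2 = ip n (\<lambda>i. x i - y i) (\<lambda>i. x i - y i)"
  by (simp add: dst_def ip_def sum_nonneg power2_eq_square)

lemma abs_coord_le_dst: "i < n \<Longrightarrow> \<bar>x i - y i\<bar> \<le> dst n x y"
  using member_le_L2_set[of "{..<n}" i "\<lambda>i. \<bar>x i - y i\<bar>"]
  by (simp add: dst_L2_set L2_set_def)

lemma dst_le_sum: "dst n x y \<le> (\<Sum>i<n. \<bar>x i - y i\<bar>)"
  by (simp add: dst_L2_set L2_set_le_sum_abs)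

lemma ip_add_left: "ip n (\<lambda>i. x i + y i) z = ip n x z + ip n y z"
  by (simp add: ip_def algebra_simps sum.distrib)

lemma ip_diff_left: "ip n (\<lambda>i. x i - y i) z = ip n x z - ip n y z"
  by (simp add: ip_def algebra_simps sum_subtractf)

lemma ip_diff_right: "ip n z (\<lambda>i. x i - y i) = ip n z x - ip n z y"
  by (simp add: ip_def algebra_simps sum_subtractf)

lemma ip_scale_left: "ip n (\<lambda>i. c * x i) z = c * ip n x z"
  by (simp add: ip_def sum_distrib_left mult.assoc)

lemma ip_comm: "ip n x y = ip n y x"
  by (simp add: ip_def mult.commute)

lemma ip_Cauchy_Schwarz:
  "\<bar>ip n z (\<lambda>i. x i - y i)\<bar> \<le> dst n z (\<lambda>_. 0) * dst n x y"
proof -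
  have "\<bar>ip n z (\<lambda>i. x i - y i)\<bar> \<le> (\<Sum>i<n. \<bar>z i\<bar> * \<bar>x i - y i\<bar>)"
    unfolding ip_def by (rule order_trans[OF sum_abs]) (simp add: abs_mult)
  also have "\<dots> \<le> L2_set z {..<n} * L2_set (\<lambda>i. x i - y i) {..<n}"
    by (rule L2_set_mult_ineq)
  finally show ?thesis by (simp add: dst_L2_set)
qed

lemma ip_Cauchy_Schwarz_diff:
  "ip n (\<lambda>i. x i - y i) (\<lambda>i. u i - v i) \<le> dst n x y * dst n u v"
  using ip_Cauchy_Schwarz[of n "\<lambda>i. x i - y i" u v] by (simp add: dst_def)

definition convex_body :: "nat \<Rightarrow> (nat \<Rightarrow> real) set \<Rightarrow> bool" where
  "convex_body n A \<longleftrightarrow> A \<subseteq> vecs n \<and> A \<noteq> {} \<and> eclosed n A \<and> econvex A \<and> ebounded n A"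

lemma econvexD:
  assumes "econvex A" "x \<in> A" "y \<in> A" "0 \<le> t" "t \<le> 1"
  shows "(\<lambda>i. t * x i + (1 - t) * y i) \<in> A"
  using assms unfolding econvex_def by blast

text \<open>Apollonius' identity, with the midpoint written in the shape that
  \<open>econvexD\<close> produces for weight 1/2.\<close>

lemma parallelogram_midpoint:
  "(dst n x y)\<^sup>2 = 2 * (dst n Y x)\<^sup>2 + 2 * (dst n Y y)\<^sup>2
     - 4 * (dst n Y (\<lambda>i. 1/2 * x i + (1 - 1/2) * y i))\<^sup>2"
  unfolding dst_power2 ip_def
  by (simp add: sum_distrib_left flip: sum.distrib sum_subtractf)
     (auto intro!: sum.cong simp: field_simps power2_eq_square)

text \<open>A minimising sequence is Cauchy because midpoints stay in \<open>A\<close> and cannot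
  beat the infimum. Its limit is formed coordinatewise and padded with zeros, so that it lies in
  \<open>vecs n\<close> and sequential closedness applies.\<close>

lemma nearest_point_exists:
  assumes A: "A \<noteq> {}" "eclosed n A" "econvex A"
  shows "\<exists>p\<in>A. \<forall>\<eta>\<in>A. dst n Y p \<le> dst n Y \<eta>"
proof -
  define \<delta> where "\<delta> = (INF \<eta>\<in>A. dst n Y \<eta>)"
  have bdd: "bdd_below (dst n Y ` A)"
    by (rule bdd_belowI2[of _ 0]) simp
  have \<delta>_le: "\<delta> \<le> dst n Y \<eta>" if "\<eta> \<in> A" for \<eta>
    unfolding \<delta>_def by (rule cINF_lower[OF bdd that])
  have \<delta>0: "0 \<le> \<delta>" unfolding \<delta>_def by (rule cINF_greatest[OF A(1)]) simp
  have "\<exists>\<eta>\<in>A. dst n Y \<eta> < \<delta> + 1 / real (Suc k)" for k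
    using cINF_less_iff[OF A(1) bdd, of "\<delta> + 1 / real (Suc k)"] unfolding \<delta>_def by simp
  then obtain s where sA: "\<And>k. s k \<in> A" and s: "\<And>k. dst n Y (s k) < \<delta> + 1 / real (Suc k)"
    by metis
  have lim: "(\<lambda>k. dst n Y (s k)) \<longlonglongrightarrow> \<delta>"
  proof (rule tendsto_sandwich[of "\<lambda>_. \<delta>" _ _ "\<lambda>k. \<delta> + 1 / real (Suc k)"])
    show "(\<lambda>k. \<delta> + 1 / real (Suc k)) \<longlonglongrightarrow> \<delta>"
      using tendsto_add[OF tendsto_const[of \<delta>] LIMSEQ_inverse_real_of_nat]
      by (simp add: divide_inverse)
  qed (use \<delta>_le sA s in \<open>auto intro!: always_eventually less_imp_le\<close>)
  have close: "(dst n (s j) (s k))\<^sup>2 \<le> 2 * ((dst n Y (s j))\<^sup>2 - \<delta>\<^sup>2) + 2 * ((dst n Y (s k))\<^sup>2 - \<delta>\<^sup>2)" for j k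
  proof -
    define m where "m = (\<lambda>i. 1/2 * s j i + (1 - 1/2) * s k i)"
    have "m \<in> A"
      unfolding m_def by (rule econvexD[OF A(3) sA sA]) auto
    then have "\<delta>\<^sup>2 \<le> (dst n Y m)\<^sup>2"
      using \<delta>_le \<delta>0 by (intro power_mono) auto
    then show ?thesis using parallelogram_midpoint[of n "s j" "s k" Y, folded m_def] by (simp add: algebra_simps)
  qed
  have lim2: "(\<lambda>k. (dst n Y (s k))\<^sup>2 - \<delta>\<^sup>2) \<longlonglongrightarrow> 0"
    using tendsto_diff[OF tendsto_power[OF lim, of 2] tendsto_const[of "\<delta>\<^sup>2"]] by simp
  have Cau: "\<exists>N. \<forall>j\<ge>N. \<forall>k\<ge>N. dst n (s j) (s k) < e" if "0 < e" for e
  proof -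
    have "0 < e\<^sup>2 / 4" using that by simp
    from order_tendstoD(2)[OF lim2 this] obtain N where
      N: "\<And>k. k \<ge> N \<Longrightarrow> (dst n Y (s k))\<^sup>2 - \<delta>\<^sup>2 < e\<^sup>2 / 4"
      by (auto simp: eventually_sequentially)
    have "dst n (s j) (s k) < e" if "j \<ge> N" "k \<ge> N" for j k
    proof -
      have "(dst n (s j) (s k))\<^sup>2 < e\<^sup>2"
        using close[of j k] N[OF that(1)] N[OF that(2)] by (simp add: field_simps)
      then show ?thesis using \<open>0 < e\<close> by (simp add: power_less_imp_less_base)
    qed
    then show ?thesis by blast
  qed
  have conv: "convergent (\<lambda>k. s k i)" if "i < n" for i
  proof -
    have "Cauchy (\<lambda>k. s k i)"
      unfolding Cauchy_def
    proof (intro allI impI)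
      fix e :: real assume "0 < e"
      from Cau[OF this] obtain N where N: "\<And>j k. j \<ge> N \<Longrightarrow> k \<ge> N \<Longrightarrow> dst n (s j) (s k) < e"
        by blast
      show "\<exists>M. \<forall>m\<ge>M. \<forall>k\<ge>M. dist (s m i) (s k i) < e"
        using le_less_trans[OF abs_coord_le_dst[OF that] N] by (auto simp: dist_real_def)
    qed
    then show ?thesis by (simp add: Cauchy_convergent_iff)
  qed
  define x where "x i = (if i < n then lim (\<lambda>k. s k i) else 0)" for i
  have xl: "(\<lambda>k. s k i) \<longlonglongrightarrow> x i" if "i < n" for i
    using conv[OF that] that by (simp add: x_def convergent_LIMSEQ_iff)
  have sx: "(\<lambda>k. dst n (s k) x) \<longlonglongrightarrow> 0"
  proof -
    have "(\<lambda>k. sqrt (\<Sum>i<n. (s k i - x i)\<^sup>2)) \<longlonglongrightarrow> sqrt (\<Sum>i<n. (x i - x i)\<^sup>2)"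
      by (intro tendsto_intros xl) simp
    then show ?thesis by (simp add: dst_def)
  qed
  have "x \<in> vecs n" by (simp add: vecs_def x_def)
  then have xA: "x \<in> A" using A(2) sA sx unfolding eclosed_def by blast
  have "dst n Y x \<le> \<delta>"
  proof (rule LIMSEQ_le_const)
    show "(\<lambda>k. dst n Y (s k) + dst n (s k) x) \<longlonglongrightarrow> \<delta>"
      using tendsto_add[OF lim sx] by simp
  qed (auto intro: dst_triangle)
  then show ?thesis using xA \<delta>_le by (meson order_trans)
qed

lemma lse_nearest:
  assumes "A \<noteq> {}" "eclosed n A" "econvex A"
  shows "lse n A Y \<in> A" "\<And>\<eta>. \<eta> \<in> A \<Longrightarrow> dst n Y (lse n A Y) \<le> dst n Y \<eta>"
proof -
  have "\<exists>\<nu>. \<nu> \<in> A \<and> (\<forall>\<eta>\<in>A. dst n Y \<nu> \<le> dst n Y \<eta>)"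
    using nearest_point_exists[OF assms] by blast
  from someI_ex[OF this] show "lse n A Y \<in> A" "\<And>\<eta>. \<eta> \<in> A \<Longrightarrow> dst n Y (lse n A Y) \<le> dst n Y \<eta>"
    unfolding lse_def by auto
qed

lemma lse_variational:
  assumes A: "A \<noteq> {}" "eclosed n A" "econvex A" and v: "v \<in> A"
  shows "ip n (\<lambda>i. Y i - lse n A Y i) (\<lambda>i. v i - lse n A Y i) \<le> 0"
proof (rule ccontr)
  define p where "p = lse n A Y"
  have lp: "p \<in> A" "\<And>\<eta>. \<eta> \<in> A \<Longrightarrow> dst n Y p \<le> dst n Y \<eta>"
    unfolding p_def by (rule lse_nearest[OF A]; assumption?)+
  define q where "q = ip n (\<lambda>i. Y i - p i) (\<lambda>i. v i - p i)"
  define r where "r = ip n (\<lambda>i. v i - p i) (\<lambda>i. v i - p i)"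
  assume "\<not> ?thesis"
  then have q: "q > 0" by (simp add: q_def p_def)
  have r: "r \<ge> 0" by (simp add: r_def flip: dst_power2)
  \<comment> \<open>Moving from \<open>p\<close> towards \<open>v\<close> by a fraction
    \<open>t\<close> changes the squared distance by \<open>- 2 * t * q\<close> plus
    \<open>t * t * r\<close>. This weight keeps \<open>t * r\<close> at most \<open>q\<close>, so
    the gain wins; the \<open>+ 1\<close> keeps the denominator positive when
    \<open>r = 0\<close>.\<close>
  define t where "t = min 1 (q / (r + 1))"
  have t: "0 < t" "t \<le> 1" using q r by (auto simp: t_def)
  have tr: "t * r < 2 * q"
  proof -
    have "t * r \<le> q / (r + 1) * r" using r by (intro mult_right_mono) (auto simp: t_def)
    also have "\<dots> \<le> q" using q r by (simp add: field_simps)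
    finally show ?thesis using q by linarith
  qed
  have "(\<lambda>i. t * v i + (1 - t) * p i) \<in> A"
    using econvexD[OF A(3) v lp(1)] t by simp
  then have "(dst n Y p)\<^sup>2 \<le> (dst n Y (\<lambda>i. t * v i + (1 - t) * p i))\<^sup>2"
    using lp(2) by (intro power_mono) auto
  also have "\<dots> = (dst n Y p)\<^sup>2 - 2 * t * q + t\<^sup>2 * r"
    unfolding dst_power2 q_def r_def ip_def
    by (simp add: sum_distrib_left flip: sum.distrib sum_subtractf)
       (auto intro!: sum.cong simp: algebra_simps power2_eq_square)
  finally have "t * (2 * q) \<le> t * (t * r)" by (simp add: power2_eq_square algebra_simps)
  then show False using tr t by simp
qed

text \<open>Add the variational inequalities at the two projections. Besides geometry, this is where
  the measurability of everything built from the estimator comes from.\<close>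

lemma lse_nonexpansive:
  assumes A: "A \<noteq> {}" "eclosed n A" "econvex A"
  shows "dst n (lse n A x) (lse n A y) \<le> dst n x y"
proof -
  define p where "p = lse n A x" define q where "q = lse n A y"
  have "ip n (\<lambda>i. x i - p i) (\<lambda>i. q i - p i) \<le> 0" "ip n (\<lambda>i. y i - q i) (\<lambda>i. p i - q i) \<le> 0"
    using lse_variational[OF A] lse_nearest(1)[OF A] unfolding p_def q_def by blast+
  moreover have "(dst n p q)\<^sup>2 = ip n (\<lambda>i. x i - p i) (\<lambda>i. q i - p i)
      + ip n (\<lambda>i. y i - q i) (\<lambda>i. p i - q i) + ip n (\<lambda>i. x i - y i) (\<lambda>i. p i - q i)"
    unfolding dst_power2 ip_def
    by (simp flip: sum.distrib) (auto intro!: sum.cong simp: algebra_simps)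
  ultimately have "(dst n p q)\<^sup>2 \<le> dst n x y * dst n p q"
    using ip_Cauchy_Schwarz_diff[of n x y p q] by linarith
  then have "dst n p q * dst n p q \<le> dst n x y * dst n p q" by (simp add: power2_eq_square)
  then show ?thesis unfolding p_def[symmetric] q_def[symmetric]
    using dst_nonneg[of n p q] dst_nonneg[of n x y] by (metis mult_right_le_imp_le order_le_less)
qed

lemma dst_convex_comb:
  assumes "0 \<le> t" "t \<le> 1"
  shows "dst n \<mu> (\<lambda>i. t * x i + (1 - t) * y i) \<le> t * dst n \<mu> x + (1 - t) * dst n \<mu> y"
proof -
  have "dst n \<mu> (\<lambda>i. t * x i + (1 - t) * y i)
      = L2_set (\<lambda>i. t * (\<mu> i - x i) + (1 - t) * (\<mu> i - y i)) {..<n}"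
    by (simp add: dst_L2_set algebra_simps)
  also have "\<dots> \<le> L2_set (\<lambda>i. t * (\<mu> i - x i)) {..<n} + L2_set (\<lambda>i. (1 - t) * (\<mu> i - y i)) {..<n}"
    by (rule L2_set_triangle_ineq)
  also have "\<dots> = t * dst n \<mu> x + (1 - t) * dst n \<mu> y"
    using assms by (simp add: dst_L2_set L2_set_right_distrib)
  finally show ?thesis .
qed

lemma convex_body_cb:
  assumes K: "convex_body n K" and \<mu>: "\<mu> \<in> K" and "0 \<le> r"
  shows "convex_body n (cb n \<mu> r \<inter> K)"
proof -
  have 1: "eclosed n (cb n \<mu> r \<inter> K)"
    unfolding eclosed_def
  proof (intro allI impI IntI)
    fix x s assume *: "x \<in> vecs n \<and> (\<forall>k. s k \<in> cb n \<mu> r \<inter> K) \<and> (\<lambda>k. dst n (s k) x) \<longlonglongrightarrow> 0"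
    then show "x \<in> K" using K unfolding convex_body_def eclosed_def by blast
    have "(\<lambda>k. r + dst n (s k) x) \<longlonglongrightarrow> r + 0" using * by (intro tendsto_intros) auto
    moreover have "dst n \<mu> x \<le> r + dst n (s k) x" for k
      using dst_triangle[of n \<mu> x "s k"] * by (auto simp: cb_def intro: order_trans)
    ultimately have "dst n \<mu> x \<le> r" using LIMSEQ_le_const by fastforce
    then show "x \<in> cb n \<mu> r" using * by (simp add: cb_def)
  qed
  have 2: "econvex (cb n \<mu> r \<inter> K)"
    unfolding econvex_def
  proof (intro ballI allI impI IntI)
    fix x y and t :: real assume x: "x \<in> cb n \<mu> r \<inter> K" and y: "y \<in> cb n \<mu> r \<inter> K" and t: "0 \<le> t \<and> t \<le> 1"
    show "(\<lambda>i. t * x i + (1 - t) * y i) \<in> K"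
      using K x y t econvexD unfolding convex_body_def by auto
    have "dst n \<mu> (\<lambda>i. t * x i + (1 - t) * y i) \<le> t * dst n \<mu> x + (1 - t) * dst n \<mu> y"
      using t by (intro dst_convex_comb) auto
    also have "\<dots> \<le> t * r + (1 - t) * r"
      using t x y by (intro add_mono mult_left_mono) (auto simp: cb_def)
    finally show "(\<lambda>i. t * x i + (1 - t) * y i) \<in> cb n \<mu> r"
      using x y by (simp add: cb_def vecs_def algebra_simps)
  qed
  have "\<mu> \<in> cb n \<mu> r \<inter> K" using assms by (auto simp: cb_def convex_body_def)
  moreover have "ebounded n (cb n \<mu> r \<inter> K)"
    using K unfolding convex_body_def ebounded_def by (meson Int_iff)
  ultimately show ?thesis using 1 2 unfolding convex_body_def by (auto simp: cb_def)
qed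

section \<open>Concave random processes\<close>

text \<open>A deviation \<open>y\<close> that has to overcome a drop \<gamma> of the mean leaves an
  excess of order y^2/\<gamma>, so second moments suffice and large drops become summable.\<close>

lemma diff_le_square_over: "0 < \<gamma> \<Longrightarrow> y - \<gamma> \<le> y\<^sup>2 / (4 * \<gamma>)" for y \<gamma> :: real
proof -
  assume g: "0 < \<gamma>"
  have "4 * \<gamma> * (y - \<gamma>) \<le> y\<^sup>2" using zero_le_power2[of "y - 2 * \<gamma>"]
    by (simp add: power2_eq_square algebra_simps)
  then show ?thesis using g by (simp add: field_simps)
qed

lemma abs_le_square_over: "0 < b \<Longrightarrow> \<bar>y\<bar> \<le> (y\<^sup>2 / b + b) / 2" for y b :: real
proof -
  assume b: "0 < b"
  have "2 * b * \<bar>y\<bar> \<le> y\<^sup>2 + b\<^sup>2" using zero_le_power2[of "\<bar>y\<bar> - b"]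
    by (simp add: power2_eq_square algebra_simps)
  then show ?thesis using b by (simp add: field_simps power2_eq_square)
qed

text \<open>A concave process on an interval whose mean touches its maximum 0 at the left end is, in
 expectation, uniformly bounded by its standard deviation: on the stretch where the mean stays above
 \<open>-b\<close> concavity reduces the supremum to three points, and beyond it the dyadic points contribute
 \<open>b\<^sup>2 / \<gamma>\<close>, which is summable because \<open>\<gamma>\<close> is convex.\<close>

lemma (in prob_space) concave_process_bound:
  fixes \<phi> :: "'a \<Rightarrow> real \<Rightarrow> real" and \<gamma> :: "real \<Rightarrow> real"
  assumes a: "0 < a" and b: "0 < b"
    and conc: "\<And>\<omega> x y t. \<omega> \<in> space M \<Longrightarrow> 0 \<le> x \<Longrightarrow> x \<le> a \<Longrightarrow> 0 \<le> y \<Longrightarrow> y \<le> a \<Longrightarrow> 0 \<le> t \<Longrightarrow> t \<le> 1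
      \<Longrightarrow> t * \<phi> \<omega> x + (1 - t) * \<phi> \<omega> y \<le> \<phi> \<omega> (t * x + (1 - t) * y)"
    and \<gamma>conv: "\<And>x y t. 0 \<le> x \<Longrightarrow> x \<le> a \<Longrightarrow> 0 \<le> y \<Longrightarrow> y \<le> a \<Longrightarrow> 0 \<le> t \<Longrightarrow> t \<le> 1
      \<Longrightarrow> \<gamma> (t * x + (1 - t) * y) \<le> t * \<gamma> x + (1 - t) * \<gamma> y"
    and \<gamma>0: "\<gamma> 0 = 0" and \<gamma>pos: "\<And>x. 0 \<le> x \<Longrightarrow> x \<le> a \<Longrightarrow> 0 \<le> \<gamma> x"
    and int: "\<And>x. 0 \<le> x \<Longrightarrow> x \<le> a \<Longrightarrow> integrable M (\<lambda>\<omega>. (\<phi> \<omega> x + \<gamma> x)\<^sup>2)"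
    and var: "\<And>x. 0 \<le> x \<Longrightarrow> x \<le> a \<Longrightarrow> expectation (\<lambda>\<omega>. (\<phi> \<omega> x + \<gamma> x)\<^sup>2) \<le> b\<^sup>2"
  shows "\<exists>R. integrable M R \<and> expectation R \<le> 10 * b \<and> (\<forall>\<omega>. 0 \<le> R \<omega>) \<and>
    (\<forall>\<omega>\<in>space M. \<forall>x. 0 \<le> x \<and> x \<le> a \<longrightarrow> \<phi> \<omega> x \<le> R \<omega>)"
proof -
  define X where "X k = a / 2 ^ k" for k :: nat
  have X: "0 < X k" "X k \<le> a" for k
    using a by (auto simp: X_def divide_le_eq_1 field_simps)
  have XS: "X (Suc k) = X k / 2" for k by (simp add: X_def)
  \<comment> \<open>Convexity together with \<gamma> 0 = 0 makes \<gamma> at least double whenever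
    the argument doubles. Read towards 0 it shows that some dyadic point has \<gamma> at most
    \<open>b\<close>; read outwards it gives the geometric growth in \<open>geo\<close>.\<close>
  have half: "2 * \<gamma> (X (Suc k)) \<le> \<gamma> (X k)" for k
    using \<gamma>conv[of "X k" 0 "1/2"] X[of k] a by (simp add: XS \<gamma>0)
  have "\<gamma> (X k) * 2 ^ k \<le> \<gamma> a" for k
  proof (induction k)
    case (Suc k)
    have "\<gamma> (X (Suc k)) * 2 ^ Suc k = 2 * \<gamma> (X (Suc k)) * 2 ^ k" by simp
    also have "\<dots> \<le> \<gamma> (X k) * 2 ^ k" by (intro mult_right_mono half) simp
    finally show ?case using Suc by linarith
  qed (simp add: X_def)
  moreover obtain k where "\<gamma> a / b < 2 ^ k" using real_arch_pow[of 2 "\<gamma> a / b"] by auto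
  ultimately have "\<gamma> (X k) * 2 ^ k \<le> b * 2 ^ k"
    using b by (smt (verit) divide_less_eq mult.commute)
  then have ex: "\<exists>k. \<gamma> (X k) \<le> b" by (intro exI[of _ k]) simp
  define k0 where "k0 = (LEAST k. \<gamma> (X k) \<le> b)"
  have k0: "\<gamma> (X k0) \<le> b" unfolding k0_def by (rule LeastI_ex[OF ex])
  have less: "b < \<gamma> (X k)" if "k < k0" for k
    using not_less_Least[of k "\<lambda>k. \<gamma> (X k) \<le> b"] that unfolding k0_def by auto
  \<comment> \<open>The index \<open>k0 - 1 - j\<close> counts outwards: \<open>j = 0\<close> is the
    dyadic point nearest to 0 where \<gamma> still exceeds \<open>b\<close>.\<close>
  have geo: "2 ^ j * b \<le> \<gamma> (X (k0 - 1 - j))" if "j < k0" for j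
    using that
  proof (induction j)
    case 0 then show ?case using less[of "k0 - 1"] by simp
  next
    case (Suc j)
    have "Suc (k0 - 1 - Suc j) = k0 - 1 - j" using Suc.prems by simp
    then show ?case using half[of "k0 - 1 - Suc j"] Suc by simp
  qed
  define dev where "dev \<omega> x = \<phi> \<omega> x + \<gamma> x" for \<omega> x
  define q where "q \<omega> x = ((dev \<omega> x)\<^sup>2 / b + b) / 2" for \<omega> x
  define S where "S \<omega> = (\<Sum>j<k0. (dev \<omega> (X (k0 - 1 - j)))\<^sup>2 / (4 * (2 ^ j * b)))" for \<omega>
  \<comment> \<open>One variable dominates both cases below. Each \<open>q\<close> has mean at most
    \<open>b\<close> and \<open>S\<close> has mean at most \<open>b / 2\<close>, so the weights add
    up to (3 + 2 + 3 + 1 + 1) b = 10 b.\<close>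
  define R where "R \<omega> = 3 * q \<omega> 0 + 2 * q \<omega> (X (Suc k0)) + 3 * q \<omega> (X k0) + b + 2 * S \<omega>" for \<omega>
  have q: "\<bar>dev \<omega> x\<bar> \<le> q \<omega> x" "0 \<le> q \<omega> x" for \<omega> x
    using abs_le_square_over[OF b, of "dev \<omega> x"] b by (auto simp: q_def)
  have S0: "0 \<le> S \<omega>" for \<omega> unfolding S_def using b by (intro sum_nonneg) auto
  have intdev: "integrable M (\<lambda>\<omega>. (dev \<omega> x)\<^sup>2)" "expectation (\<lambda>\<omega>. (dev \<omega> x)\<^sup>2) \<le> b\<^sup>2" if "0 \<le> x" "x \<le> a" for x
    using int[OF that] var[OF that] by (simp_all add: dev_def)
  have intq: "integrable M (\<lambda>\<omega>. q \<omega> x)" "expectation (\<lambda>\<omega>. q \<omega> x) \<le> b" if "0 \<le> x" "x \<le> a" for x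
  proof -
    show "integrable M (\<lambda>\<omega>. q \<omega> x)" unfolding q_def using intdev[OF that] by simp
    have "expectation (\<lambda>\<omega>. q \<omega> x) = (expectation (\<lambda>\<omega>. (dev \<omega> x)\<^sup>2) / b + b) / 2"
      unfolding q_def using intdev[OF that] by (simp add: prob_space)
    also have "\<dots> \<le> (b\<^sup>2 / b + b) / 2"
      using intdev(2)[OF that] b by (intro divide_right_mono add_right_mono) auto
    finally show "expectation (\<lambda>\<omega>. q \<omega> x) \<le> b" using b by (simp add: power2_eq_square)
  qed
  have intS: "integrable M S" "expectation S \<le> b / 2"
  proof -
    show "integrable M S" unfolding S_def using intdev X(1)[THEN less_imp_le] X(2) by simp
    have "expectation S = (\<Sum>j<k0. expectation (\<lambda>\<omega>. (dev \<omega> (X (k0 - 1 - j)))\<^sup>2) / (4 * (2 ^ j * b)))"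
      unfolding S_def using intdev X(1)[THEN less_imp_le] X(2) by simp
    also have "\<dots> \<le> (\<Sum>j<k0. b / 4 * (1/2) ^ j)"
    proof (rule sum_mono)
      fix j
      have "expectation (\<lambda>\<omega>. (dev \<omega> (X (k0 - 1 - j)))\<^sup>2) / (4 * (2 ^ j * b)) \<le> b\<^sup>2 / (4 * (2 ^ j * b))"
        using intdev(2)[of "X (k0 - 1 - j)"] X[of "k0 - 1 - j"] b by (intro divide_right_mono) auto
      also have "\<dots> = b / 4 * (1/2) ^ j"
        using b by (simp add: field_simps power2_eq_square)
      finally show "expectation (\<lambda>\<omega>. (dev \<omega> (X (k0 - 1 - j)))\<^sup>2) / (4 * (2 ^ j * b)) \<le> b / 4 * (1/2) ^ j" .
    qed
    also have "\<dots> = b / 4 * (\<Sum>j<k0. (1/2) ^ j)" by (simp add: sum_distrib_left)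
    also have "\<dots> \<le> b / 4 * 2"
      using b by (intro mult_left_mono) (auto simp: sum_gp_strict)
    finally show "expectation S \<le> b / 2" by simp
  qed
  note X' = X(1)[THEN less_imp_le] X(2)
  show ?thesis
  proof (intro exI[of _ R] conjI allI ballI impI)
    show "integrable M R"
      unfolding R_def using intq(1) intS(1) X' a by simp
    have "expectation R = 3 * expectation (\<lambda>\<omega>. q \<omega> 0) + 2 * expectation (\<lambda>\<omega>. q \<omega> (X (Suc k0)))
       + 3 * expectation (\<lambda>\<omega>. q \<omega> (X k0)) + b + 2 * expectation S"
      unfolding R_def using intq(1) intS(1) X' a by (simp add: prob_space)
    then show "expectation R \<le> 10 * b"
      using intq(2)[of 0] intq(2)[OF X'[of k0]] intq(2)[OF X'[of "Suc k0"]] intS(2) a by simp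
    show R0: "0 \<le> R \<omega>" for \<omega>
      unfolding R_def using q(2) S0 b by (simp add: add_nonneg_nonneg)
    fix \<omega> x assume \<omega>: "\<omega> \<in> space M" and "0 \<le> x \<and> x \<le> a"
    then have x: "0 \<le> x" "x \<le> a" by auto
    have le_dev: "\<phi> \<omega> y \<le> dev \<omega> y" if "0 \<le> y" "y \<le> a" for y
      using \<gamma>pos[OF that] by (simp add: dev_def)
    show "\<phi> \<omega> x \<le> R \<omega>"
    proof (cases "x \<le> X k0")
      case True
      define l where "l = min (\<phi> \<omega> 0) (\<phi> \<omega> (X k0))"
      have mid: "(\<phi> \<omega> x + l) / 2 \<le> \<phi> \<omega> (X (Suc k0))"
        \<comment> \<open>the midpoint of \<open>[0, X k0]\<close> is a convex combination of \<open>x\<close> and an endpoint in which \<open>x\<close> has weight at least 1/2\<close>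
      proof (cases "x \<le> X k0 / 2")
        case xl: True
        define t where "t = (X k0 / 2) / (X k0 - x)"
        have t: "1/2 \<le> t" "t \<le> 1" using xl x X(1)[of k0] by (auto simp: t_def field_simps)
        have "X k0 - x \<noteq> 0" using xl X(1)[of k0] by argo
        then have "t * (X k0 - x) = X k0 / 2" unfolding t_def by (metis nonzero_eq_divide_eq)
        then have "t * x + (1 - t) * X k0 = X (Suc k0)" by (simp add: XS algebra_simps)
        then have *: "t * \<phi> \<omega> x + (1 - t) * \<phi> \<omega> (X k0) \<le> \<phi> \<omega> (X (Suc k0))"
          using conc[OF \<omega>, of x "X k0" t] t x X'[of k0] by simp
        show ?thesis
        proof (cases "\<phi> \<omega> x \<ge> l")
          case True
          have "(\<phi> \<omega> x + l) / 2 \<le> t * \<phi> \<omega> x + (1 - t) * l"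
            using mult_nonneg_nonneg[of "t - 1/2" "\<phi> \<omega> x - l"] t True by (simp add: field_simps)
          also have "\<dots> \<le> t * \<phi> \<omega> x + (1 - t) * \<phi> \<omega> (X k0)"
            using t by (intro add_left_mono mult_left_mono) (auto simp: l_def)
          finally show ?thesis using * by argo
        next
          case False
          have "l \<le> \<phi> \<omega> (X (Suc k0))"
            using conc[OF \<omega>, of 0 "X k0" "1/2"] a X'[of k0] by (simp add: XS l_def min_def split: if_splits)
          then show ?thesis using False by argo
        qed
      next
        case xg: False
        define t where "t = (X k0 / 2) / x"
        have x0: "0 < x" using xg X(1)[of k0] by linarith
        have t: "1/2 \<le> t" "t \<le> 1" using xg x x0 True X(1)[of k0] by (auto simp: t_def field_simps)
        have "t * x + (1 - t) * 0 = X (Suc k0)" using x0 by (simp add: XS t_def)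
        then have *: "t * \<phi> \<omega> x + (1 - t) * \<phi> \<omega> 0 \<le> \<phi> \<omega> (X (Suc k0))"
          using conc[OF \<omega>, of x 0 t] t x a by simp
        show ?thesis
        proof (cases "\<phi> \<omega> x \<ge> l")
          case True
          have "(\<phi> \<omega> x + l) / 2 \<le> t * \<phi> \<omega> x + (1 - t) * l"
            using mult_nonneg_nonneg[of "t - 1/2" "\<phi> \<omega> x - l"] t True by (simp add: field_simps)
          also have "\<dots> \<le> t * \<phi> \<omega> x + (1 - t) * \<phi> \<omega> 0"
            using t by (intro add_left_mono mult_left_mono) (auto simp: l_def)
          finally show ?thesis using * by argo
        next
          case False
          have "l \<le> \<phi> \<omega> (X (Suc k0))"
            using conc[OF \<omega>, of 0 "X k0" "1/2"] a X'[of k0] by (simp add: XS l_def min_def split: if_splits)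
          then show ?thesis using False by argo
        qed
      qed
      have "- q \<omega> 0 - q \<omega> (X k0) - b \<le> l"
        using q[of \<omega> 0] q[of \<omega> "X k0"] k0 b \<gamma>0 by (auto simp: l_def dev_def min_def abs_le_iff)
      moreover have "\<phi> \<omega> (X (Suc k0)) \<le> q \<omega> (X (Suc k0))"
        using le_dev[of "X (Suc k0)"] X'[of "Suc k0"] q(1)[of \<omega> "X (Suc k0)"] by linarith
      ultimately have "\<phi> \<omega> x \<le> 2 * q \<omega> (X (Suc k0)) + q \<omega> 0 + q \<omega> (X k0) + b"
        using mid by argo
      then show ?thesis using q(2)[of \<omega> 0] q(2)[of \<omega> "X k0"] S0[of \<omega>] by (simp add: R_def)
    next
      case False
      \<comment> \<open>Every point beyond \<open>X k0\<close> lies at most a factor 2 above a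
        dyadic point. Concavity between 0 and \<open>x\<close> then transfers the bound from
        \<open>X k\<close> to \<open>x\<close> with weight \<open>X k / x\<close>, which is at least
        1/2.\<close>
      have "\<exists>k. k \<le> k0 \<and> 0 < k \<and> X k \<le> x \<and> x \<le> 2 * X k"
      proof -
        define k where "k = (LEAST k. X k \<le> x)"
        have 1: "X k \<le> x" unfolding k_def by (rule LeastI[of _ k0]) (use False in simp)
        have 2: "k \<le> k0" unfolding k_def by (rule Least_le) (use False in simp)
        show ?thesis
        proof (cases k)
          case 0
          then have xa: "x = a" using 1 x by (simp add: X_def)
          have "k0 \<noteq> 0" using False x by (intro notI) (simp add: X_def)
          then show ?thesis using a xa by (intro exI[of _ 1]) (auto simp: X_def)
        next
          case (Suc j)
          then have "x < X j" using not_less_Least[of j "\<lambda>k. X k \<le> x"] by (auto simp: k_def)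
          then show ?thesis using 1 2 Suc XS[of j] by (intro exI[of _ k]) auto
        qed
      qed
      then obtain k where k: "k \<le> k0" "0 < k" "X k \<le> x" "x \<le> 2 * X k" by blast
      have x0: "0 < x" using k(3) X(1)[of k] by linarith
      define t where "t = X k / x"
      have t: "1/2 \<le> t" "t \<le> 1" using k x0 by (auto simp: t_def field_simps)
      have "t * x + (1 - t) * 0 = X k" using x0 by (simp add: t_def)
      then have *: "t * \<phi> \<omega> x + (1 - t) * \<phi> \<omega> 0 \<le> \<phi> \<omega> (X k)"
        using conc[OF \<omega>, of x 0 t] t x a by simp
      define Q where "Q = S \<omega> + q \<omega> (X k0)"
      have Q0: "0 \<le> Q" using S0 q(2) by (simp add: Q_def)
      have Qk: "\<phi> \<omega> (X k) \<le> Q"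
      proof (cases "k = k0")
        case True
        then show ?thesis using le_dev[OF X'] q(1)[of \<omega> "X k0"] S0[of \<omega>] unfolding Q_def
          by (smt (verit))
      next
        case False
        define j where "j = k0 - 1 - k"
        have j: "j < k0" "k = k0 - 1 - j" using k False by (auto simp: j_def)
        have "\<phi> \<omega> (X k) \<le> dev \<omega> (X k) - 2 ^ j * b"
          using geo[OF j(1)] j(2) by (simp add: dev_def)
        also have "\<dots> \<le> (dev \<omega> (X k))\<^sup>2 / (4 * (2 ^ j * b))"
          using b by (intro diff_le_square_over) auto
        also have "\<dots> \<le> S \<omega>"
          unfolding S_def j(2) using j(1) b by (intro member_le_sum) auto
        finally show ?thesis using q(2)[of \<omega> "X k0"] by (simp add: Q_def)
      qed
      have p0: "\<bar>\<phi> \<omega> 0\<bar> \<le> q \<omega> 0" using q(1)[of \<omega> 0] \<gamma>0 by (simp add: dev_def)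
      have "t * \<phi> \<omega> x \<le> Q + q \<omega> 0"
      proof -
        have "\<bar>(1 - t) * \<phi> \<omega> 0\<bar> \<le> 1 * \<bar>\<phi> \<omega> 0\<bar>" unfolding abs_mult using t by (intro mult_right_mono) auto
        then show ?thesis using * Qk p0 by linarith
      qed
      then have "\<phi> \<omega> x \<le> 2 * (Q + q \<omega> 0)"
      proof (cases "\<phi> \<omega> x \<le> 0")
        case False
        then have "1/2 * \<phi> \<omega> x \<le> t * \<phi> \<omega> x" using t by (intro mult_right_mono) auto
        then show ?thesis using \<open>t * \<phi> \<omega> x \<le> Q + q \<omega> 0\<close> by argo
      qed (use Q0 q(2)[of \<omega> 0] in simp)
      then show ?thesis
        using q(2)[of \<omega> 0] q(2)[of \<omega> "X k0"] q(2)[of \<omega> "X (Suc k0)"] b by (simp add: R_def Q_def)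
    qed
  qed
qed

section \<open>The standard Gaussian measure\<close>

abbreviation stdN :: "real measure" where
  "stdN \<equiv> density lborel std_normal_density"

interpretation stdN: prob_space stdN
  by (rule prob_space_normal_density) simp

interpretation stdN_prod: product_prob_space "\<lambda>_::nat. stdN" "{..<n}" for n
  by unfold_locales

interpretation gauss: prob_space "gauss n" for n
  unfolding gauss_def by (rule prob_space_PiM) (rule stdN.prob_space_axioms)

interpretation gauss_pair: pair_prob_space "gauss n" "gauss n" for n
  by unfold_locales

lemma gauss_sets [measurable_cong]: "sets (gauss n) = sets (PiM {..<n} (\<lambda>_. borel))"
  unfolding gauss_def by (rule sets_PiM_cong) auto

lemma space_gauss: "space (gauss n) = {..<n} \<rightarrow>\<^sub>E UNIV"
  by (simp add: gauss_def space_PiM)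

text \<open>The joint density depends only on x^2 + y^2. The rotation itself is carried out as two
  one-dimensional affine substitutions with an exchange of integrals in between; the factor 1/c
  produced by the first is absorbed by the second, which is why \<open>c\<close> has to be
  positive.\<close>

lemma stdN_rotation_nn_integral:
  fixes f :: "real \<Rightarrow> real \<Rightarrow> ennreal"
  assumes [measurable]: "case_prod f \<in> borel_measurable (borel \<Otimes>\<^sub>M borel)"
    and c: "c\<^sup>2 + s\<^sup>2 = 1" "c > 0"
  shows "(\<integral>\<^sup>+x. \<integral>\<^sup>+y. f (c * x + s * y) (c * y - s * x) \<partial>stdN \<partial>stdN)
    = (\<integral>\<^sup>+x. \<integral>\<^sup>+y. f x y \<partial>stdN \<partial>stdN)"
proof -
  let ?p = "\<lambda>x y. ennreal (exp (- (x\<^sup>2 + y\<^sup>2) / 2) / (2 * pi))"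
  define g where "g x y = ?p x y * f x y" for x y
  have [measurable]: "(\<lambda>p. f (h1 p) (h2 p)) \<in> borel_measurable M"
    if "h1 \<in> borel_measurable M" "h2 \<in> borel_measurable M" for h1 h2 and M :: "'x measure"
    using measurable_compose[OF measurable_Pair[OF that] assms(1)] by simp
  have [measurable]: "(\<lambda>p. g (h1 p) (h2 p)) \<in> borel_measurable M"
    if [measurable]: "h1 \<in> borel_measurable M" "h2 \<in> borel_measurable M" for h1 h2 and M :: "'x measure"
    unfolding g_def by measurable
  have dens: "(\<integral>\<^sup>+x. \<integral>\<^sup>+y. h x y \<partial>stdN \<partial>stdN) = (\<integral>\<^sup>+x. \<integral>\<^sup>+y. ?p x y * h x y \<partial>lborel \<partial>lborel)"
    if h: "case_prod h \<in> borel_measurable (borel \<Otimes>\<^sub>M borel)" for h :: "real \<Rightarrow> real \<Rightarrow> ennreal"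
  proof -
    have [measurable]: "(\<lambda>p. h (h1 p) (h2 p)) \<in> borel_measurable M"
      if "h1 \<in> borel_measurable M" "h2 \<in> borel_measurable M" for h1 h2 and M :: "'x measure"
      using measurable_compose[OF measurable_Pair[OF that] h] by simp
    have "?p x y = ennreal (std_normal_density x) * ennreal (std_normal_density y)" for x y
      by (simp add: std_normal_density_def ennreal_mult[symmetric] real_sqrt_mult field_simps
          flip: exp_add)
    then show ?thesis
      by (simp add: nn_integral_density nn_integral_cmult[symmetric] mult.assoc)
  qed
  have rot: "(c * x + s * y)\<^sup>2 + (c * y - s * x)\<^sup>2 = x\<^sup>2 + y\<^sup>2" for x y
  proof -
    have "(c * x + s * y)\<^sup>2 + (c * y - s * x)\<^sup>2 = (c\<^sup>2 + s\<^sup>2) * (x\<^sup>2 + y\<^sup>2)"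
      by (simp add: power2_eq_square algebra_simps)
    then show ?thesis using c by simp
  qed
  have e1: "- (s * (x - s * y) / c) + c * y = y / c - s * x / c" for x y
  proof -
    have "- (s * (x - s * y) / c) + c * y = (- s * x + (c\<^sup>2 + s\<^sup>2) * y) / c"
      using c(2) by (simp add: field_simps power2_eq_square)
    then show ?thesis using c by (simp add: diff_divide_distrib)
  qed
  have "(\<integral>\<^sup>+x. \<integral>\<^sup>+y. f (c * x + s * y) (c * y - s * x) \<partial>stdN \<partial>stdN)
     = (\<integral>\<^sup>+x. \<integral>\<^sup>+y. g (c * x + s * y) (c * y - s * x) \<partial>lborel \<partial>lborel)"
    by (subst dens) (simp_all add: g_def rot)
  also have "\<dots> = (\<integral>\<^sup>+y. \<integral>\<^sup>+x. g (c * x + s * y) (c * y - s * x) \<partial>lborel \<partial>lborel)"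
    by (rule lborel_pair.Fubini') measurable
  also have "\<dots> = (\<integral>\<^sup>+y. ennreal \<bar>1/c\<bar> * (\<integral>\<^sup>+x. g x (y / c - s * x / c) \<partial>lborel) \<partial>lborel)"
  proof (rule nn_integral_cong)
    fix y
    have "(\<integral>\<^sup>+x. g (c * x + s * y) (c * y - s * x) \<partial>lborel)
       = ennreal \<bar>1/c\<bar> * (\<integral>\<^sup>+x. g (c * (- s * y / c + 1/c * x) + s * y) (c * y - s * (- s * y / c + 1/c * x)) \<partial>lborel)"
      using c(2) by (intro nn_integral_real_affine) auto
    also have "(\<lambda>x. g (c * (- s * y / c + 1/c * x) + s * y) (c * y - s * (- s * y / c + 1/c * x)))
       = (\<lambda>x. g x (y / c - s * x / c))"
    proof
      fix x
      have "c * (- s * y / c + 1/c * x) + s * y = x" using c(2) by (simp add: field_simps)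
      moreover have "c * y - s * (- s * y / c + 1/c * x) = y / c - s * x / c"
        using e1[of x y] c(2) by (simp add: field_simps)
      ultimately show "g (c * (- s * y / c + 1/c * x) + s * y) (c * y - s * (- s * y / c + 1/c * x))
        = g x (y / c - s * x / c)" by simp
    qed
    finally show "(\<integral>\<^sup>+x. g (c * x + s * y) (c * y - s * x) \<partial>lborel)
      = ennreal \<bar>1/c\<bar> * (\<integral>\<^sup>+x. g x (y / c - s * x / c) \<partial>lborel)" .
  qed
  also have "\<dots> = (\<integral>\<^sup>+y. \<integral>\<^sup>+x. ennreal \<bar>1/c\<bar> * g x (y / c - s * x / c) \<partial>lborel \<partial>lborel)"
    by (subst nn_integral_cmult) simp_all
  also have "\<dots> = (\<integral>\<^sup>+x. \<integral>\<^sup>+y. ennreal \<bar>1/c\<bar> * g x (y / c - s * x / c) \<partial>lborel \<partial>lborel)"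
    by (rule lborel_pair.Fubini') measurable
  also have "\<dots> = (\<integral>\<^sup>+x. \<integral>\<^sup>+y. g x y \<partial>lborel \<partial>lborel)"
  proof (rule nn_integral_cong)
    fix x
    have "(\<integral>\<^sup>+y. g x y \<partial>lborel) = ennreal \<bar>1/c\<bar> * (\<integral>\<^sup>+y. g x (- s * x / c + 1/c * y) \<partial>lborel)"
      using c(2) by (intro nn_integral_real_affine) auto
    then show "(\<integral>\<^sup>+y. ennreal \<bar>1/c\<bar> * g x (y / c - s * x / c) \<partial>lborel) = (\<integral>\<^sup>+y. g x y \<partial>lborel)"
      by (simp add: nn_integral_cmult algebra_simps)
  qed
  also have "\<dots> = (\<integral>\<^sup>+x. \<integral>\<^sup>+y. f x y \<partial>stdN \<partial>stdN)"
    using dens[of f, symmetric] by (simp only: g_def assms)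
  finally show ?thesis .
qed

text \<open>The rotation mixes two whole vectors, with the same angle in every coordinate.
  Restricting to \<open>{..<n}\<close> keeps the results in the space of \<open>gauss n\<close>,
  whose points are \<open>undefined\<close> outside the index set.\<close>

definition rot :: "nat \<Rightarrow> real \<Rightarrow> (nat \<Rightarrow> real) \<times> (nat \<Rightarrow> real) \<Rightarrow> (nat \<Rightarrow> real) \<times> (nat \<Rightarrow> real)" where
  "rot n \<theta> p = (\<lambda>i\<in>{..<n}. cos \<theta> * fst p i + sin \<theta> * snd p i, \<lambda>i\<in>{..<n}. cos \<theta> * snd p i - sin \<theta> * fst p i)"

lemma measurable_rot [measurable]: "rot n \<theta> \<in> gauss n \<Otimes>\<^sub>M gauss n \<rightarrow>\<^sub>M gauss n \<Otimes>\<^sub>M gauss n"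
  unfolding rot_def by measurable

text \<open>Pairing up coordinates turns the coordinatewise rotation into a product map.\<close>

lemma rot_measure_preserving:
  assumes "cos \<theta> > 0"
  shows "distr (gauss n \<Otimes>\<^sub>M gauss n) (gauss n \<Otimes>\<^sub>M gauss n) (rot n \<theta>) = gauss n \<Otimes>\<^sub>M gauss n"
proof -
  let ?P = "gauss n \<Otimes>\<^sub>M gauss n" and ?Q = "PiM {..<n} (\<lambda>_. stdN \<Otimes>\<^sub>M stdN)"
  define zip where "zip p = (\<lambda>i\<in>{..<n}. (fst p i, snd p i))" for p :: "(nat \<Rightarrow> real) \<times> (nat \<Rightarrow> real)"
  define unzip where "unzip q = (\<lambda>i\<in>{..<n}. fst (q i), \<lambda>i\<in>{..<n}. snd (q i))" for q :: "nat \<Rightarrow> real \<times> real"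
  interpret NN: pair_prob_space stdN stdN by unfold_locales
  interpret NNp: product_prob_space "\<lambda>_::nat. stdN \<Otimes>\<^sub>M stdN" "{..<n}" by unfold_locales
  have [measurable_cong]: "sets ?Q = sets (PiM {..<n} (\<lambda>_. borel \<Otimes>\<^sub>M borel))"
    by (intro sets_PiM_cong sets_pair_measure_cong) auto
  have m[measurable]: "zip \<in> ?P \<rightarrow>\<^sub>M ?Q" "unzip \<in> ?Q \<rightarrow>\<^sub>M ?P"
    unfolding zip_def unzip_def by measurable
  have uz: "unzip (zip p) = p" if "p \<in> space ?P" for p
    using that unfolding unzip_def zip_def space_pair_measure space_gauss
    by (auto simp: PiE_def extensional_def restrict_def fun_eq_iff)
  \<comment> \<open>The angle is universally quantified because angle 0 gives the law of
    \<open>zip\<close> alone; comparing the two laws lets \<open>unzip\<close> cancel at the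
    end.\<close>
  have key: "distr ?P ?Q (\<lambda>p. zip (rot n \<theta>' p)) = ?Q" if "cos \<theta>' > 0" for \<theta>'
  proof (rule NNp.PiM_eqI)
    fix A :: "nat \<Rightarrow> (real \<times> real) set" assume A: "\<And>i. i \<in> {..<n} \<Longrightarrow> A i \<in> sets (stdN \<Otimes>\<^sub>M stdN)"
    define I where "I i x y = (indicator (A i) (x, y) :: ennreal)" for i x y
    define J where "J i x y = I i (cos \<theta>' * x + sin \<theta>' * y) (cos \<theta>' * y - sin \<theta>' * x)" for i x y
    have A': "A i \<in> sets (borel \<Otimes>\<^sub>M borel)" if "i < n" for i
      using A[of i] that by (simp cong: sets_pair_measure_cong)
    have [measurable]: "(\<lambda>p. I i (h1 p) (h2 p)) \<in> borel_measurable M"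
      if "h1 \<in> borel_measurable M" "h2 \<in> borel_measurable M" "i < n" for i h1 h2 and M :: "'x measure"
    proof -
      have "(\<lambda>p. (h1 p, h2 p)) \<in> M \<rightarrow>\<^sub>M borel \<Otimes>\<^sub>M borel" using that by measurable
      then have "(\<lambda>p. indicator (A i) (h1 p, h2 p) :: ennreal) \<in> borel_measurable M"
        by (rule measurable_compose) (use A' that in simp)
      then show ?thesis by (simp add: I_def)
    qed
    have [measurable]: "(\<lambda>p. J i (h1 p) (h2 p)) \<in> borel_measurable M"
      if "h1 \<in> borel_measurable M" "h2 \<in> borel_measurable M" "i < n" for i h1 h2 and M :: "'x measure"
      unfolding J_def using that by measurable
    have "emeasure (distr ?P ?Q (\<lambda>p. zip (rot n \<theta>' p))) (Pi\<^sub>E {..<n} A)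
       = (\<integral>\<^sup>+p. indicator (Pi\<^sub>E {..<n} A) (zip (rot n \<theta>' p)) \<partial>?P)"
    proof -
      have [measurable]: "Pi\<^sub>E {..<n} A \<in> sets ?Q" using A by (intro sets_PiM_I_finite) auto
      have "emeasure (distr ?P ?Q (\<lambda>p. zip (rot n \<theta>' p))) (Pi\<^sub>E {..<n} A)
        = (\<integral>\<^sup>+q. indicator (Pi\<^sub>E {..<n} A) q \<partial>distr ?P ?Q (\<lambda>p. zip (rot n \<theta>' p)))"
        by (rule nn_integral_indicator[symmetric]) simp
      also have "\<dots> = (\<integral>\<^sup>+p. indicator (Pi\<^sub>E {..<n} A) (zip (rot n \<theta>' p)) \<partial>?P)"
        by (rule nn_integral_distr) measurable
      finally show ?thesis .
    qed
    also have "\<dots> = (\<integral>\<^sup>+p. (\<Prod>i<n. J i (fst p i) (snd p i)) \<partial>?P)"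
    proof (rule nn_integral_cong)
      fix p
      show "indicator (Pi\<^sub>E {..<n} A) (zip (rot n \<theta>' p)) = (\<Prod>i<n. J i (fst p i) (snd p i))"
      proof (cases "\<forall>i<n. (cos \<theta>' * fst p i + sin \<theta>' * snd p i, cos \<theta>' * snd p i - sin \<theta>' * fst p i) \<in> A i")
        case True
        then show ?thesis by (simp add: zip_def rot_def J_def I_def PiE_def Pi_def)
      next
        case False
        then obtain j where j: "j < n" "J j (fst p j) (snd p j) = 0" by (auto simp: J_def I_def)
        then have "(\<Prod>i<n. J i (fst p i) (snd p i)) = 0" by (intro prod_zero) auto
        moreover have "zip (rot n \<theta>' p) \<notin> Pi\<^sub>E {..<n} A"
          using False by (force simp: zip_def rot_def PiE_def Pi_def)
        ultimately show ?thesis by simp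
      qed
    qed
    also have "\<dots> = (\<integral>\<^sup>+z. \<integral>\<^sup>+w. (\<Prod>i<n. J i (z i) (w i)) \<partial>gauss n \<partial>gauss n)"
      by (subst gauss.nn_integral_fst[symmetric]) simp_all
    also have "\<dots> = (\<integral>\<^sup>+z. (\<Prod>i<n. \<integral>\<^sup>+y. J i (z i) y \<partial>stdN) \<partial>gauss n)"
      unfolding gauss_def by (intro nn_integral_cong stdN_prod.product_nn_integral_prod) auto
    also have "\<dots> = (\<Prod>i<n. \<integral>\<^sup>+x. \<integral>\<^sup>+y. J i x y \<partial>stdN \<partial>stdN)"
      unfolding gauss_def by (intro stdN_prod.product_nn_integral_prod) auto
    also have "\<dots> = (\<Prod>i<n. \<integral>\<^sup>+x. \<integral>\<^sup>+y. I i x y \<partial>stdN \<partial>stdN)"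
      unfolding J_def using that
      by (intro prod.cong refl stdN_rotation_nn_integral) (auto simp: case_prod_unfold)
    also have "\<dots> = (\<Prod>i<n. emeasure (stdN \<Otimes>\<^sub>M stdN) (A i))"
      using A by (intro prod.cong refl) (simp add: stdN.emeasure_pair_measure I_def)
    finally show "emeasure (distr ?P ?Q (\<lambda>p. zip (rot n \<theta>' p))) (Pi\<^sub>E {..<n} A)
      = (\<Prod>i<n. emeasure (stdN \<Otimes>\<^sub>M stdN) (A i))" .
  qed simp_all
  have r0: "zip (rot n 0 p) = zip p" for p
    by (auto simp: zip_def rot_def fun_eq_iff)
  have "distr ?P ?P (rot n \<theta>) = distr ?P ?P (\<lambda>p. unzip (zip (rot n \<theta> p)))"
    by (rule distr_cong) (auto intro!: uz[symmetric] measurable_space[OF measurable_rot])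
  also have "\<dots> = distr ?Q ?P unzip"
    using key[OF assms] by (subst distr_distr[symmetric, unfolded o_def, of unzip ?Q]) simp_all
  also have "\<dots> = distr ?P ?P (\<lambda>p. unzip (zip p))"
    using key[of 0] by (subst distr_distr[symmetric, unfolded o_def, of unzip ?Q]) (simp_all add: r0)
  also have "\<dots> = distr ?P ?P (\<lambda>p. p)"
    by (rule distr_cong) (auto intro: uz)
  finally show ?thesis by simp
qed

text \<open>The Lipschitz bound gives continuity in the product topology on all sequences. Composing
  with the zero extension \<open>e\<close> is harmless, since \<open>dst n\<close> does not
  distinguish \<open>z\<close> from \<open>e z\<close>.\<close>

lemma gauss_measurable_Lipschitz:
  assumes L: "\<And>x y. \<bar>\<phi> x - \<phi> y\<bar> \<le> L * dst n x y"
  shows "\<phi> \<in> borel_measurable (gauss n)"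
proof -
  define e where "e z = (\<lambda>i. if i < n then z i else 0)" for z :: "nat \<Rightarrow> real"
  have "continuous_on UNIV \<phi>"
    unfolding continuous_on_def
  proof
    fix x
    define g where "g y = \<bar>L\<bar> * (\<Sum>i<n. \<bar>y i - x i\<bar>)" for y :: "nat \<Rightarrow> real"
    have "continuous_on UNIV g"
      unfolding g_def by (intro continuous_intros continuous_on_product_coordinates)
    then have "(g \<longlongrightarrow> 0) (at x)"
      using continuous_on_tendsto_compose[of UNIV g "\<lambda>y. y" x "at x"] by (simp add: g_def[abs_def])
    moreover have "norm (\<phi> y - \<phi> x) \<le> g y" for y
    proof -
      have "\<bar>\<phi> y - \<phi> x\<bar> \<le> \<bar>L\<bar> * dst n y x"
        using L[of y x] mult_right_mono[OF abs_ge_self[of L] dst_nonneg[of n y x]] by linarith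
      also have "\<dots> \<le> g y" unfolding g_def by (intro mult_left_mono dst_le_sum) auto
      finally show ?thesis by simp
    qed
    ultimately have "((\<lambda>y. \<phi> y - \<phi> x) \<longlongrightarrow> 0) (at x)"
      using Lim_null_comparison[OF always_eventually, of "\<lambda>y. \<phi> y - \<phi> x" g "at x"] by blast
    then show "(\<phi> \<longlongrightarrow> \<phi> x) (at x within UNIV)"
      by (simp add: LIM_zero_iff)
  qed
  then have "\<phi> \<in> borel_measurable (PiM UNIV (\<lambda>_::nat. borel))"
    using borel_measurable_continuous_onI measurable_cong_sets[OF sets_PiM_equal_borel refl] by blast
  moreover have "e \<in> gauss n \<rightarrow>\<^sub>M PiM UNIV (\<lambda>_::nat. borel)"
    unfolding e_def
  proof (rule measurable_PiM_single')
    fix i show "(\<lambda>z. if i < n then z i else 0) \<in> gauss n \<rightarrow>\<^sub>M (borel :: real measure)"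
      by (cases "i < n") simp_all
  qed (simp add: space_PiM)
  ultimately have "(\<lambda>z. \<phi> (e z)) \<in> borel_measurable (gauss n)"
    by (rule measurable_compose[rotated])
  moreover have "\<phi> (e z) = \<phi> z" for z
    using L[of "e z" z] by (simp add: e_def dst_def)
  ultimately show ?thesis by simp
qed

section \<open>Moments and integrability under the standard Gaussian measure\<close>

lemma stdN_moments:
  "integrable stdN (\<lambda>x. x)" "(\<integral>x. x \<partial>stdN) = 0"
  "integrable stdN (\<lambda>x. x * x)" "(\<integral>x. x * x \<partial>stdN) = 1"
  using integrable_std_normal_moment[of 1] integral_std_normal_moment_odd[of 0]
    integrable_std_normal_moment[of 2] integral_std_normal_moment_even[of 1]
  by (simp_all add: integrable_real_density integral_real_density power2_eq_square)

lemma gauss_coord: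
  assumes "i < n"
  shows "integrable (gauss n) (\<lambda>z. z i)" "(\<integral>z. z i \<partial>gauss n) = 0"
proof -
  \<comment> \<open>The coordinate is written as a product over all indices with factor 1 elsewhere,
    so that integrals over the product measure factorise.\<close>
  define f where "f k x = (if k = i then x else (1::real))" for k :: nat and x :: real
  have eq: "(\<lambda>z. z i) = (\<lambda>z. \<Prod>k<n. f k (z k))"
    using assms by (auto simp: f_def fun_eq_iff)
  have int: "integrable stdN (f k)" for k
    by (cases "k = i") (simp_all add: f_def[abs_def] stdN_moments)
  show "integrable (gauss n) (\<lambda>z. z i)"
    unfolding eq gauss_def by (rule stdN_prod.product_integrable_prod) (use int in auto)
  have "(\<integral>z. (\<Prod>k<n. f k (z k)) \<partial>gauss n) = (\<Prod>k<n. integral\<^sup>L stdN (f k))"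
    unfolding gauss_def by (rule stdN_prod.product_integral_prod) (use int in auto)
  moreover have "integral\<^sup>L stdN (f i) = 0" by (simp add: f_def[abs_def] stdN_moments)
  ultimately show "(\<integral>z. z i \<partial>gauss n) = 0"
    unfolding eq using assms by (metis finite_lessThan lessThan_iff prod_zero)
qed

lemma gauss_coord_prod:
  assumes "i < n" "j < n"
  shows "integrable (gauss n) (\<lambda>z. z i * z j)" "(\<integral>z. z i * z j \<partial>gauss n) = (if i = j then 1 else 0)"
proof -
  define f where "f k x = (if k = i then x else (1::real)) * (if k = j then x else 1)" for k :: nat and x :: real
  have eq: "(\<lambda>z. z i * z j) = (\<lambda>z. \<Prod>k<n. f k (z k))"
    using assms by (auto simp: f_def fun_eq_iff prod.distrib)
  have int: "integrable stdN (f k)" for k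
    by (cases "k = i"; cases "k = j") (simp_all add: f_def[abs_def] stdN_moments)
  show "integrable (gauss n) (\<lambda>z. z i * z j)"
    unfolding eq gauss_def by (rule stdN_prod.product_integrable_prod) (use int in auto)
  have *: "(\<integral>z. (\<Prod>k<n. f k (z k)) \<partial>gauss n) = (\<Prod>k<n. integral\<^sup>L stdN (f k))"
    unfolding gauss_def by (rule stdN_prod.product_integral_prod) (use int in auto)
  show "(\<integral>z. z i * z j \<partial>gauss n) = (if i = j then 1 else 0)"
  proof (cases "i = j")
    case True
    then have "integral\<^sup>L stdN (f k) = 1" for k
      using stdN.prob_space by (cases "k = i") (simp_all add: f_def[abs_def] stdN_moments)
    then show ?thesis unfolding eq * using True by simp
  next
    case False
    then have "integral\<^sup>L stdN (f i) = 0" by (simp add: f_def[abs_def] stdN_moments)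
    then show ?thesis unfolding eq * using False assms by (metis finite_lessThan lessThan_iff prod_zero)
  qed
qed

lemma measurable_ip_gauss [measurable]: "(\<lambda>z. ip n z u) \<in> borel_measurable (gauss n)"
  unfolding ip_def by measurable

lemma gauss_ip:
  "integrable (gauss n) (\<lambda>z. ip n z u)" "(\<integral>z. ip n z u \<partial>gauss n) = 0"
  unfolding ip_def
  by (auto intro!: Bochner_Integration.integrable_sum
      simp: gauss_coord Bochner_Integration.integral_sum)

lemma gauss_ip_square:
  "integrable (gauss n) (\<lambda>z. (ip n z u)\<^sup>2)" "(\<integral>z. (ip n z u)\<^sup>2 \<partial>gauss n) = ip n u u"
proof -
  have eq: "(ip n z u)\<^sup>2 = (\<Sum>i<n. \<Sum>j<n. u i * u j * (z i * z j))" for z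
    by (simp add: ip_def power2_eq_square sum_product mult_ac)
  show "integrable (gauss n) (\<lambda>z. (ip n z u)\<^sup>2)"
    unfolding eq by (auto intro!: Bochner_Integration.integrable_sum integrable_mult_right simp: gauss_coord_prod)
  have "(\<integral>z. (ip n z u)\<^sup>2 \<partial>gauss n) = (\<Sum>i<n. \<Sum>j<n. u i * u j * (if i = j then 1 else 0))"
    unfolding eq
    by (subst Bochner_Integration.integral_sum)
       (auto intro!: sum.cong Bochner_Integration.integrable_sum
         simp: gauss_coord_prod Bochner_Integration.integral_sum)
  also have "\<dots> = ip n u u"
    by (simp add: ip_def if_distrib sum.delta cong: if_cong)
  finally show "(\<integral>z. (ip n z u)\<^sup>2 \<partial>gauss n) = ip n u u" .
qed

lemma gauss_norm_square:
  "integrable (gauss n) (\<lambda>z. (dst n z (\<lambda>_. 0))\<^sup>2)" "(\<integral>z. (dst n z (\<lambda>_. 0))\<^sup>2 \<partial>gauss n) = n"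
  unfolding dst_power2 ip_def
  by (auto intro!: Bochner_Integration.integrable_sum
      simp: gauss_coord_prod Bochner_Integration.integral_sum)

lemma gauss_integrable_quadratic:
  assumes "\<phi> \<in> borel_measurable (gauss n)" "\<And>z. \<bar>\<phi> z\<bar> \<le> A + B * (dst n z (\<lambda>_. 0))\<^sup>2"
  shows "integrable (gauss n) \<phi>"
proof (rule Bochner_Integration.integrable_bound)
  show "integrable (gauss n) (\<lambda>z. A + B * (dst n z (\<lambda>_. 0))\<^sup>2)"
    using gauss_norm_square(1) by simp
qed (use assms in \<open>auto intro!: AE_I2 intro: order_trans[OF _ abs_ge_self]\<close>)

lemma gauss_integrable_linear:
  assumes "\<phi> \<in> borel_measurable (gauss n)" "\<And>z. \<bar>\<phi> z\<bar> \<le> B * dst n z (\<lambda>_. 0)"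
  shows "integrable (gauss n) \<phi>"
proof (rule gauss_integrable_quadratic[OF assms(1)])
  fix z
  show "\<bar>\<phi> z\<bar> \<le> B\<^sup>2 + 1 * (dst n z (\<lambda>_. 0))\<^sup>2"
    using assms(2)[of z] sum_squares_bound[of B "dst n z (\<lambda>_. 0)"]
      mult_nonneg_nonneg[of 1 "B\<^sup>2"] zero_le_power2[of B] zero_le_power2[of "dst n z (\<lambda>_. 0)"] by linarith
qed

section \<open>Gaussian variance of support functions\<close>

text \<open>The support function of the translate of \<open>A\<close> by - \<nu>. Centring makes its
  Lipschitz constant the radius of \<open>A\<close> around \<nu> instead of the distance of
  \<open>A\<close> from the origin, and it does not change the mean, because
  \<open>ip n z \<nu>\<close> has mean 0.\<close>

definition supf :: "nat \<Rightarrow> (nat \<Rightarrow> real) set \<Rightarrow> (nat \<Rightarrow> real) \<Rightarrow> (nat \<Rightarrow> real) \<Rightarrow> real" where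
  "supf n A \<nu> z = (SUP v\<in>A. ip n z v) - ip n z \<nu>"

context
  fixes n A \<nu> R
  assumes A: "convex_body n A" and R: "\<And>v. v \<in> A \<Longrightarrow> dst n \<nu> v \<le> R"
begin

lemma radius_nonneg: "0 \<le> R"
  using A R dst_nonneg unfolding convex_body_def by (meson all_not_in_conv order_trans)

lemma ip_minus_le: "v \<in> A \<Longrightarrow> ip n z v - ip n z \<nu> \<le> dst n z (\<lambda>_. 0) * R"
  using ip_Cauchy_Schwarz[of n z v \<nu>] R[of v] mult_left_mono[of "dst n v \<nu>" R "dst n z (\<lambda>_. 0)"]
  by (simp add: ip_diff_right dst_sym)

lemma bdd_above_ip: "bdd_above (ip n z ` A)"
  using ip_minus_le[of _ z] by (intro bdd_aboveI2[of _ _ "dst n z (\<lambda>_. 0) * R + ip n z \<nu>"]) fastforce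

lemma supf_upper: "v \<in> A \<Longrightarrow> ip n z v - ip n z \<nu> \<le> supf n A \<nu> z"
  unfolding supf_def using cSUP_upper[OF _ bdd_above_ip] by fastforce

lemma supf_least:
  assumes "\<And>v. v \<in> A \<Longrightarrow> ip n z v - ip n z \<nu> \<le> B"
  shows "supf n A \<nu> z \<le> B"
proof -
  have "(SUP v\<in>A. ip n z v) \<le> B + ip n z \<nu>"
    using A assms by (intro cSUP_least) (auto simp: convex_body_def algebra_simps)
  then show ?thesis by (simp add: supf_def)
qed

lemma supf_Lipschitz: "\<bar>supf n A \<nu> x - supf n A \<nu> y\<bar> \<le> R * dst n x y"
proof -
  have "supf n A \<nu> x \<le> supf n A \<nu> y + R * dst n x y" for x y
  proof (rule supf_least)
    fix v assume v: "v \<in> A"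
    have "ip n (\<lambda>i. x i - y i) (\<lambda>i. v i - \<nu> i) \<le> dst n x y * dst n v \<nu>"
      by (rule ip_Cauchy_Schwarz_diff)
    also have "\<dots> \<le> dst n x y * R" using R[OF v] by (intro mult_left_mono) (auto simp: dst_sym)
    finally show "ip n x v - ip n x \<nu> \<le> supf n A \<nu> y + R * dst n x y"
      using supf_upper[OF v, of y] by (simp add: ip_diff_left ip_diff_right mult.commute)
  qed
  from this[of x y] this[of y x] show ?thesis by (simp add: dst_sym abs_le_iff)
qed

lemma supf_measurable [measurable]: "supf n A \<nu> \<in> borel_measurable (gauss n)"
  by (rule gauss_measurable_Lipschitz[OF supf_Lipschitz])

lemma supf_bound: "\<bar>supf n A \<nu> z\<bar> \<le> R * dst n z (\<lambda>_. 0)"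
proof -
  have "supf n A \<nu> (\<lambda>_. 0) = 0"
    using A by (simp add: supf_def ip_def convex_body_def)
  then show ?thesis using supf_Lipschitz[of z "\<lambda>_. 0"] by simp
qed

lemma supf_integrable:
  "integrable (gauss n) (supf n A \<nu>)" "integrable (gauss n) (\<lambda>z. (supf n A \<nu> z)\<^sup>2)"
proof -
  show "integrable (gauss n) (supf n A \<nu>)"
    by (rule gauss_integrable_linear[OF _ supf_bound]) simp
  show "integrable (gauss n) (\<lambda>z. (supf n A \<nu> z)\<^sup>2)"
  proof (rule gauss_integrable_quadratic)
    fix z
    show "\<bar>(supf n A \<nu> z)\<^sup>2\<bar> \<le> 0 + R\<^sup>2 * (dst n z (\<lambda>_. 0))\<^sup>2"
      using power_mono[OF supf_bound[of z], of 2] by (simp add: power_mult_distrib)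
  qed simp
qed

lemma integral_supf: "(\<integral>z. supf n A \<nu> z \<partial>gauss n) = (\<integral>z. (SUP v\<in>A. ip n z v) \<partial>gauss n)"
proof -
  have "(\<lambda>z. SUP v\<in>A. ip n z v) = (\<lambda>z. supf n A \<nu> z + ip n z \<nu>)" by (simp add: supf_def)
  then show ?thesis using supf_integrable(1) gauss_ip by simp
qed

text \<open>The witness projects \<open>\<nu> + z / \<epsilon>\<close> onto \<open>A\<close>: an exact maximiser need not be unique, whereas the
 projection is Lipschitz in \<open>z\<close> and hence a measurable selection.\<close>

lemma approx_maximizer:
  assumes "0 < \<rho>"
  shows "\<exists>q :: (nat \<Rightarrow> real) \<Rightarrow> nat \<Rightarrow> real. (\<forall>i<n. (\<lambda>z. q z i) \<in> borel_measurable (gauss n)) \<and>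
    (\<forall>z. (\<lambda>i. \<nu> i + q z i) \<in> A \<and> ip n (q z) (q z) \<le> R\<^sup>2 \<and> supf n A \<nu> z \<le> ip n z (q z) + \<rho>)"
proof -
  note A' = A[unfolded convex_body_def]
  note lse = lse_nearest(1)[of A n] lse_variational[of A n] lse_nonexpansive[of A n]
  \<comment> \<open>Testing the variational inequality at \<open>v\<close> loses \<epsilon> times an
    inner product of size at most 2 R^2; this choice makes the loss at most \<rho>, also when R =
    0.\<close>
  define \<epsilon> where "\<epsilon> = \<rho> / (2 * R\<^sup>2 + 1)"
  have "0 < 2 * R\<^sup>2 + 1" by (simp add: add_nonneg_pos)
  then have \<epsilon>: "0 < \<epsilon>" "2 * R\<^sup>2 * \<epsilon> \<le> \<rho>" using assms by (auto simp: \<epsilon>_def field_simps)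
  define Y where "Y z = (\<lambda>i. z i / \<epsilon> + \<nu> i)" for z :: "nat \<Rightarrow> real"
  define u where "u z = lse n A (Y z)" for z
  define q where "q z = (\<lambda>i. u z i - \<nu> i)" for z
  have uA: "u z \<in> A" for z unfolding u_def using lse(1) A' by blast
  have dY: "dst n (Y z) (Y w) = (1 / \<epsilon>) * dst n z w" for z w
  proof -
    have "Y z i - Y w i = (1 / \<epsilon>) * (z i - w i)" for i by (simp add: Y_def diff_divide_distrib)
    then show ?thesis using \<epsilon> L2_set_right_distrib[of "1 / \<epsilon>" "\<lambda>i. z i - w i" "{..<n}"]
      by (simp add: dst_L2_set)
  qed
  show ?thesis
  proof (intro exI[of _ q] conjI allI impI)
    fix z
    show "(\<lambda>i. \<nu> i + q z i) \<in> A" using uA by (simp add: q_def)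
    have qn: "ip n (q z) (q z) = (dst n \<nu> (u z))\<^sup>2" for z
      by (simp add: q_def dst_sym[of n \<nu>] dst_power2)
    also have "(dst n \<nu> (u z))\<^sup>2 \<le> R\<^sup>2" for z using R[OF uA] by (intro power_mono) auto
    finally show "ip n (q z) (q z) \<le> R\<^sup>2" .
    show "supf n A \<nu> z \<le> ip n z (q z) + \<rho>"
    proof (rule supf_least)
      fix v assume v: "v \<in> A"
      have "ip n (\<lambda>i. Y z i - u z i) (\<lambda>i. v i - u z i) \<le> 0"
        unfolding u_def using lse(2) A' v by blast
      moreover have "ip n (\<lambda>i. z i - \<epsilon> * q z i) (\<lambda>i. v i - u z i)
         = \<epsilon> * ip n (\<lambda>i. Y z i - u z i) (\<lambda>i. v i - u z i)"
        unfolding ip_def sum_distrib_left Y_def q_def using \<epsilon> by (intro sum.cong) (auto simp: field_simps)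
      ultimately have "ip n (\<lambda>i. z i - \<epsilon> * q z i) (\<lambda>i. v i - u z i) \<le> 0"
        using \<epsilon> by (simp add: mult_nonneg_nonpos)
      then have 1: "ip n z v - ip n z (u z) \<le> \<epsilon> * ip n (q z) (\<lambda>i. v i - u z i)"
        by (simp add: ip_diff_left ip_scale_left ip_diff_right)
      have "ip n (q z) (\<lambda>i. v i - u z i) \<le> dst n (u z) \<nu> * dst n v (u z)"
        unfolding q_def by (rule ip_Cauchy_Schwarz_diff)
      also have "\<dots> \<le> R * (2 * R)"
        using R[OF uA[of z]] R[OF v] dst_triangle[of n v "u z" \<nu>] radius_nonneg
        by (intro mult_mono) (auto simp: dst_sym)
      finally have "\<epsilon> * ip n (q z) (\<lambda>i. v i - u z i) \<le> \<epsilon> * (R * (2 * R))"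
        using \<epsilon> by (intro mult_left_mono) auto
      then have "ip n z v - ip n z (u z) \<le> \<rho>" using 1 \<epsilon>(2) by (simp add: power2_eq_square mult_ac)
      then show "ip n z v - ip n z \<nu> \<le> ip n z (q z) + \<rho>" by (simp add: q_def ip_diff_right)
    qed
  next
    fix i assume i: "i < n"
    have "\<bar>u x i - u y i\<bar> \<le> (1 / \<epsilon>) * dst n x y" for x y
      using abs_coord_le_dst[OF i, of "u x" "u y"] lse(3)[of "Y x" "Y y"] A' unfolding dY u_def
      by (meson order_trans)
    then have "(\<lambda>z. u z i) \<in> borel_measurable (gauss n)" by (rule gauss_measurable_Lipschitz)
    then show "(\<lambda>z. q z i) \<in> borel_measurable (gauss n)" by (simp add: q_def)
  qed
qed

end

section \<open>Rotations of an independent pair and the variance of the support function\<close>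

lemma gauss_pair_integrable_quadratic:
  assumes "\<phi> \<in> borel_measurable (gauss n \<Otimes>\<^sub>M gauss n)"
    "\<And>z w. \<bar>\<phi> (z, w)\<bar> \<le> B * ((dst n z (\<lambda>_. 0))\<^sup>2 + (dst n w (\<lambda>_. 0))\<^sup>2)"
  shows "integrable (gauss n \<Otimes>\<^sub>M gauss n) \<phi>"
proof -
  have 1: "integrable (gauss n \<Otimes>\<^sub>M gauss n) (\<lambda>p. (dst n (fst p) (\<lambda>_. 0))\<^sup>2)"
    using gauss_norm_square(1)[of n]
    by (subst (asm) gauss.distr_pair_fst[of "gauss n" n, symmetric]) (subst (asm) integrable_distr_eq; simp add: dst_def)
  have 2: "integrable (gauss n \<Otimes>\<^sub>M gauss n) (\<lambda>p. (dst n (snd p) (\<lambda>_. 0))\<^sup>2)"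
    using gauss_pair.integrable_product_swap[OF 1] by (simp add: case_prod_unfold)
  show ?thesis
  proof (rule Bochner_Integration.integrable_bound)
    show "integrable (gauss n \<Otimes>\<^sub>M gauss n) (\<lambda>p. B * ((dst n (fst p) (\<lambda>_. 0))\<^sup>2 + (dst n (snd p) (\<lambda>_. 0))\<^sup>2))"
      using 1 2 by simp
  qed (use assms in \<open>auto intro!: AE_I2 intro: order_trans[OF _ abs_ge_self]\<close>)
qed

text \<open>Iteration serves two ends: the one-step result requires a positive cosine whereas the
  total angle will be a right angle, and the telescoping sum needs the law of every intermediate
  pair.\<close>

lemma rot_pow_measure_preserving:
  assumes "cos \<theta> > 0"
  shows "distr (gauss n \<Otimes>\<^sub>M gauss n) (gauss n \<Otimes>\<^sub>M gauss n) (rot n \<theta> ^^ k) = gauss n \<Otimes>\<^sub>M gauss n"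
    and "rot n \<theta> ^^ k \<in> gauss n \<Otimes>\<^sub>M gauss n \<rightarrow>\<^sub>M gauss n \<Otimes>\<^sub>M gauss n"
proof (induction k)
  case 0
  { case 1 show ?case by (simp add: id_def) }
  { case 2 show ?case by (simp add: id_def) }
next
  case (Suc k)
  { case 1
    let ?P = "gauss n \<Otimes>\<^sub>M gauss n"
    have "distr ?P ?P (rot n \<theta> ^^ Suc k) = distr (distr ?P ?P (rot n \<theta> ^^ k)) ?P (rot n \<theta>)"
      unfolding funpow.simps by (rule distr_distr[OF measurable_rot Suc(2), symmetric])
    also have "\<dots> = ?P" unfolding Suc(1) by (rule rot_measure_preserving[OF assms])
    finally show ?case . }
  { case 2 show ?case using Suc(2) by (auto intro!: measurable_comp) }
qed

lemma rot_pow_coords: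
  assumes "i < n"
  shows "fst ((rot n \<theta> ^^ k) p) i = cos (real k * \<theta>) * fst p i + sin (real k * \<theta>) * snd p i"
    and "snd ((rot n \<theta> ^^ k) p) i = cos (real k * \<theta>) * snd p i - sin (real k * \<theta>) * fst p i"
proof (induction k)
  case (Suc k)
  { case 1 show ?case using assms Suc
      by (simp add: rot_def distrib_right cos_add sin_add) (simp add: algebra_simps) }
  { case 2 show ?case using assms Suc
      by (simp add: rot_def distrib_right cos_add sin_add) (simp add: algebra_simps) }
qed simp_all

text \<open>Whatever the sign of \<open>d\<close>, one of the two one-sided bounds controls its
  absolute value.\<close>

lemma square_diff_le:
  fixes d :: real
  assumes "x1 - \<rho> \<le> d" "x2 - \<rho> \<le> - d"
  shows "d\<^sup>2 \<le> 2 * x1\<^sup>2 + 2 * x2\<^sup>2 + 4 * \<rho>\<^sup>2"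
proof -
  have *: "d\<^sup>2 \<le> 2 * x\<^sup>2 + 2 * \<rho>\<^sup>2" if "\<bar>d\<bar> \<le> \<bar>x\<bar> + \<bar>\<rho>\<bar>" for x
  proof -
    have "d\<^sup>2 \<le> (\<bar>x\<bar> + \<bar>\<rho>\<bar>)\<^sup>2" using that by (metis abs_ge_zero abs_le_square_iff abs_of_nonneg add_nonneg_nonneg)
    also have "\<dots> \<le> 2 * x\<^sup>2 + 2 * \<rho>\<^sup>2"
      using zero_le_power2[of "\<bar>x\<bar> - \<bar>\<rho>\<bar>"] by (simp add: power2_eq_square algebra_simps)
    finally show ?thesis .
  qed
  have "\<bar>d\<bar> \<le> \<bar>x1\<bar> + \<bar>\<rho>\<bar> \<or> \<bar>d\<bar> \<le> \<bar>x2\<bar> + \<bar>\<rho>\<bar>" using assms by linarith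
  then have "d\<^sup>2 \<le> 2 * x1\<^sup>2 + 2 * \<rho>\<^sup>2 \<or> d\<^sup>2 \<le> 2 * x2\<^sup>2 + 2 * \<rho>\<^sup>2" using * by blast
  then show ?thesis
    using zero_le_power2[of x1] zero_le_power2[of x2] zero_le_power2[of \<rho>] by linarith
qed

lemma ip_cong: "(\<And>i. i < n \<Longrightarrow> x i = x' i) \<Longrightarrow> ip n x y = ip n x' y"
  by (auto simp: ip_def)

lemma ip_square_le: "(ip n z q)\<^sup>2 \<le> (dst n z (\<lambda>_. 0))\<^sup>2 * ip n q q"
proof -
  have "\<bar>ip n z q\<bar> \<le> dst n z (\<lambda>_. 0) * dst n q (\<lambda>_. 0)"
    using ip_Cauchy_Schwarz[of n z q "\<lambda>_. 0"] by simp
  then have "\<bar>ip n z q\<bar>\<^sup>2 \<le> (dst n z (\<lambda>_. 0) * dst n q (\<lambda>_. 0))\<^sup>2" by (intro power_mono) auto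
  then show ?thesis by (simp add: power_mult_distrib dst_power2)
qed

lemma square_sum_le: "(x + y)\<^sup>2 \<le> 2 * x\<^sup>2 + 2 * y\<^sup>2" for x y :: real
  using zero_le_power2[of "x - y"] by (simp add: power2_eq_square algebra_simps)

text \<open>Testing the rotated vector against the almost maximiser \<open>q z\<close> of the old
  one bounds the increment from below by the inner product of z' - z with \<open>q z\<close>, up to
  \<rho>; exchanging the roles bounds it from above. Since z' - z = (cos \<theta> - 1) z + sin
  \<theta> w, the term with \<open>w\<close> is dimension-free by independence, while the term with
  \<open>z\<close> carries a factor \<open>n\<close> but only the small coefficient (1 - cos
  \<theta>)^2.\<close>

lemma supf_rotation_step:
  assumes A: "convex_body n A" and R: "\<And>v. v \<in> A \<Longrightarrow> dst n \<nu> v \<le> R" and cos: "cos \<theta> > 0"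
  shows "(\<integral>p. (supf n A \<nu> (fst p) - supf n A \<nu> (fst (rot n \<theta> p)))\<^sup>2 \<partial>(gauss n \<Otimes>\<^sub>M gauss n))
    \<le> 8 * R\<^sup>2 * ((1 - cos \<theta>)\<^sup>2 * n + (sin \<theta>)\<^sup>2)" (is "?I \<le> ?B")
proof -
  let ?P = "gauss n \<Otimes>\<^sub>M gauss n" and ?h = "supf n A \<nu>"
  let ?c = "cos \<theta>" and ?s = "sin \<theta>"
  note [measurable] = supf_measurable[OF A R]
  have bound: "?I \<le> ?B + 4 * \<rho>\<^sup>2" if \<rho>: "0 < \<rho>" for \<rho>
  proof -
    obtain q :: "(nat \<Rightarrow> real) \<Rightarrow> nat \<Rightarrow> real" where qm: "\<And>i. i < n \<Longrightarrow> (\<lambda>z. q z i) \<in> borel_measurable (gauss n)"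
      and qA: "\<And>z. (\<lambda>i. \<nu> i + q z i) \<in> A" and qR: "\<And>z. ip n (q z) (q z) \<le> R\<^sup>2"
      and qmax: "\<And>z. ?h z \<le> ip n z (q z) + \<rho>"
      using approx_maximizer[OF A R \<rho>] by auto
    define T1 where "T1 p = (ip n (fst p) (q (fst p)))\<^sup>2" for p :: "(nat \<Rightarrow> real) \<times> (nat \<Rightarrow> real)"
    define T2 where "T2 p = (ip n (snd p) (q (fst p)))\<^sup>2" for p :: "(nat \<Rightarrow> real) \<times> (nat \<Rightarrow> real)"
    define \<Psi> where "\<Psi> p = 2 * ((1 - ?c)\<^sup>2 * T1 p) + 2 * (?s\<^sup>2 * T2 p)" for p
    have mq: "(\<lambda>p. q (fst p) i) \<in> borel_measurable ?P" if "i < n" for i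
      using measurable_compose[OF measurable_fst qm[OF that]] .
    have mT[measurable]: "T1 \<in> borel_measurable ?P" "T2 \<in> borel_measurable ?P"
      unfolding T1_def[abs_def] T2_def[abs_def] ip_def using mq by measurable
    have hq: "ip n x (q z) \<le> ?h x" for x z
      using supf_upper[OF A R qA, of x z] by (simp add: ip_comm[of n x] ip_add_left)
    have T1b: "T1 (z, w) \<le> R\<^sup>2 * (dst n z (\<lambda>_. 0))\<^sup>2" for z w
      using ip_square_le[of n z "q z"] mult_left_mono[OF qR[of z], of "(dst n z (\<lambda>_. 0))\<^sup>2"]
      by (simp add: T1_def mult.commute)
    have T2b: "T2 (z, w) \<le> R\<^sup>2 * (dst n w (\<lambda>_. 0))\<^sup>2" for z w
      using ip_square_le[of n w "q z"] mult_left_mono[OF qR[of z], of "(dst n w (\<lambda>_. 0))\<^sup>2"]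
      by (simp add: T2_def mult.commute)
    have T0: "0 \<le> T1 p" "0 \<le> T2 p" for p by (simp_all add: T1_def T2_def)
    have iT1: "integrable ?P T1"
    proof (rule gauss_pair_integrable_quadratic)
      fix z w show "\<bar>T1 (z, w)\<bar> \<le> R\<^sup>2 * ((dst n z (\<lambda>_. 0))\<^sup>2 + (dst n w (\<lambda>_. 0))\<^sup>2)"
        using T1b[of z w] T0[of "(z,w)"] by (simp add: distrib_left add_increasing2)
    qed simp
    have iT2: "integrable ?P T2"
    proof (rule gauss_pair_integrable_quadratic)
      fix z w show "\<bar>T2 (z, w)\<bar> \<le> R\<^sup>2 * ((dst n z (\<lambda>_. 0))\<^sup>2 + (dst n w (\<lambda>_. 0))\<^sup>2)"
        using T2b[of z w] T0[of "(z,w)"] by (simp add: distrib_left add_increasing)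
    qed simp
    \<comment> \<open>Here \<open>q z\<close> depends on \<open>z\<close>, so only the
      Cauchy-Schwarz inequality is available and the dimension appears.\<close>
    have ET1: "(\<integral>p. T1 p \<partial>?P) \<le> R\<^sup>2 * n"
    proof -
      have eq: "(\<integral>w. T1 (z, w) \<partial>gauss n) = T1 (z, undefined)" for z
        by (simp add: T1_def gauss.prob_space)
      have "(\<integral>p. T1 p \<partial>?P) = (\<integral>z. T1 (z, undefined) \<partial>gauss n)"
        using gauss_pair.integral_fst'[OF iT1] by (simp add: eq)
      also have "\<dots> \<le> (\<integral>z. R\<^sup>2 * (dst n z (\<lambda>_. 0))\<^sup>2 \<partial>gauss n)"
      proof (rule integral_mono)
        show "integrable (gauss n) (\<lambda>z. T1 (z, undefined))"
          using gauss_pair.integrable_fst'[OF iT1] by (simp add: eq)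
      qed (use gauss_norm_square T1b in auto)
      finally show ?thesis by (simp add: gauss_norm_square)
    qed
    \<comment> \<open>Given \<open>z\<close>, the inner product of \<open>w\<close> with
      \<open>q z\<close> is a centred variable of variance |q z|^2, hence no dimension.\<close>
    have ET2: "(\<integral>p. T2 p \<partial>?P) \<le> R\<^sup>2"
    proof -
      have eq: "(\<integral>w. T2 (z, w) \<partial>gauss n) = ip n (q z) (q z)" for z
        by (simp add: T2_def gauss_ip_square)
      have "(\<integral>p. T2 p \<partial>?P) = (\<integral>z. ip n (q z) (q z) \<partial>gauss n)"
        using gauss_pair.integral_fst'[OF iT2] by (simp add: eq)
      also have "\<dots> \<le> (\<integral>z. R\<^sup>2 \<partial>gauss n)"
        using gauss_pair.integrable_fst'[OF iT2] qR by (intro integral_mono) (auto simp: eq)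
      finally show ?thesis by (simp add: gauss.prob_space)
    qed
    have i\<Psi>: "integrable ?P \<Psi>" unfolding \<Psi>_def using iT1 iT2 by simp
    have E\<Psi>: "(\<integral>p. \<Psi> p \<partial>?P) \<le> 2 * R\<^sup>2 * ((1 - ?c)\<^sup>2 * n + ?s\<^sup>2)"
    proof -
      have "(\<integral>p. \<Psi> p \<partial>?P) = 2 * ((1 - ?c)\<^sup>2 * (\<integral>p. T1 p \<partial>?P)) + 2 * (?s\<^sup>2 * (\<integral>p. T2 p \<partial>?P))"
        unfolding \<Psi>_def using iT1 iT2 by simp
      also have "\<dots> \<le> 2 * ((1 - ?c)\<^sup>2 * (R\<^sup>2 * n)) + 2 * (?s\<^sup>2 * R\<^sup>2)"
        using ET1 ET2 by (intro add_mono mult_left_mono) auto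
      finally show ?thesis by (simp add: algebra_simps)
    qed
    have i\<Psi>r: "integrable ?P (\<lambda>p. \<Psi> (rot n \<theta> p))" and E\<Psi>r: "(\<integral>p. \<Psi> (rot n \<theta> p) \<partial>?P) = (\<integral>p. \<Psi> p \<partial>?P)"
      using integrable_distr[OF measurable_rot[where n = n and \<theta> = \<theta>], of \<Psi>] integral_distr[OF measurable_rot[where n = n and \<theta> = \<theta>], of \<Psi>] i\<Psi>
      unfolding rot_measure_preserving[OF cos] by auto
    have pw: "(?h (fst p) - ?h (fst (rot n \<theta> p)))\<^sup>2 \<le> 2 * \<Psi> p + 2 * \<Psi> (rot n \<theta> p) + 4 * \<rho>\<^sup>2" for p
    proof -
      obtain z w where p: "p = (z, w)" by (cases p)
      define z' where "z' = fst (rot n \<theta> p)"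
      define w' where "w' = snd (rot n \<theta> p)"
      have z': "ip n z' x = ?c * ip n z x + ?s * ip n w x" for x
        unfolding z'_def p by (subst ip_cong[of n _ "\<lambda>i. ?c * z i + ?s * w i"]) (auto simp: rot_def ip_add_left ip_scale_left)
      have w': "ip n w' x = ?c * ip n w x - ?s * ip n z x" for x
        unfolding w'_def p by (subst ip_cong[of n _ "\<lambda>i. ?c * w i - ?s * z i"]) (auto simp: rot_def ip_diff_left ip_scale_left)
      \<comment> \<open>The inverse rotation puts the reversed comparison into the same form with
        the sine negated. As the rotated pair has the law of the original pair, its contribution has
        the same mean.\<close>
      have z: "ip n z x = ?c * ip n z' x - ?s * ip n w' x" for x
        unfolding z' w' using sin_cos_squared_add[of \<theta>] by algebra
      define x1 where "x1 = (?c - 1) * ip n z (q z) + ?s * ip n w (q z)"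
      define x2 where "x2 = (?c - 1) * ip n z' (q z') + - ?s * ip n w' (q z')"
      have "x1 - \<rho> \<le> ?h z' - ?h z"
        using hq[of z' z] qmax[of z] unfolding x1_def z' by (simp add: algebra_simps)
      moreover have "x2 - \<rho> \<le> - (?h z' - ?h z)"
        using hq[of z z'] qmax[of z'] unfolding x2_def z[of "q z'"] by (simp add: algebra_simps)
      ultimately have "(?h z' - ?h z)\<^sup>2 \<le> 2 * x1\<^sup>2 + 2 * x2\<^sup>2 + 4 * \<rho>\<^sup>2" by (rule square_diff_le)
      moreover have "x1\<^sup>2 \<le> \<Psi> p"
        using square_sum_le[of "(?c - 1) * ip n z (q z)" "?s * ip n w (q z)"]
        by (simp add: x1_def \<Psi>_def T1_def T2_def p power_mult_distrib power2_commute[of ?c])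
      moreover have "x2\<^sup>2 \<le> \<Psi> (rot n \<theta> p)"
        using square_sum_le[of "(?c - 1) * ip n z' (q z')" "- ?s * ip n w' (q z')"]
        by (simp add: x2_def \<Psi>_def T1_def T2_def z'_def w'_def power_mult_distrib power2_commute[of ?c])
      ultimately have "(?h z - ?h z')\<^sup>2 \<le> 2 * \<Psi> p + 2 * \<Psi> (rot n \<theta> p) + 4 * \<rho>\<^sup>2"
        unfolding power2_commute[of "?h z"] by linarith
      then show ?thesis by (simp add: z'_def p)
    qed
    have "?I \<le> (\<integral>p. 2 * \<Psi> p + 2 * \<Psi> (rot n \<theta> p) + 4 * \<rho>\<^sup>2 \<partial>?P)"
    proof (rule integral_mono)
      show "integrable ?P (\<lambda>p. 2 * \<Psi> p + 2 * \<Psi> (rot n \<theta> p) + 4 * \<rho>\<^sup>2)" using i\<Psi> i\<Psi>r by simp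
      then show "integrable ?P (\<lambda>p. (?h (fst p) - ?h (fst (rot n \<theta> p)))\<^sup>2)"
        by (rule Bochner_Integration.integrable_bound)
           (auto intro!: AE_I2 intro: order_trans[OF pw abs_ge_self])
    qed (rule pw)
    also have "\<dots> = 4 * (\<integral>p. \<Psi> p \<partial>?P) + 4 * \<rho>\<^sup>2"
      using i\<Psi> i\<Psi>r E\<Psi>r gauss_pair.P.prob_space by simp
    also have "\<dots> \<le> 4 * (2 * R\<^sup>2 * ((1 - ?c)\<^sup>2 * n + ?s\<^sup>2)) + 4 * \<rho>\<^sup>2"
      using E\<Psi> by simp
    finally show ?thesis by simp
  qed
  show ?thesis
  proof (rule field_le_epsilon)
    fix e :: real assume "0 < e"
    then show "?I \<le> ?B + e" using bound[of "sqrt e / 2"] by (simp add: power_divide)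
  qed
qed

text \<open>A pair of independent vectors is rotated by a right angle in \<open>N\<close> steps. Each step moves \<open>supf\<close> by
 the inner product of an almost maximiser with a nearly independent increment, so the bound per step
 is \<open>O(R\<^sup>2 / N\<^sup>2)\<close>; the part proportional to the dimension has order \<open>n / N\<^sup>4\<close>.\<close>

lemma supf_variance:
  assumes A: "convex_body n A" and R: "\<And>v. v \<in> A \<Longrightarrow> dst n \<nu> v \<le> R"
  shows "(\<integral>z. (supf n A \<nu> z - (\<integral>z. supf n A \<nu> z \<partial>gauss n))\<^sup>2 \<partial>gauss n) \<le> (6 * R)\<^sup>2"
proof -
  let ?P = "gauss n \<Otimes>\<^sub>M gauss n"
  define h where "h = supf n A \<nu>"
  define m where "m = (\<integral>z. h z \<partial>gauss n)"
  have [measurable]: "h \<in> borel_measurable (gauss n)"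
    unfolding h_def by (rule supf_measurable[OF A R])
  have ih: "integrable (gauss n) h" "integrable (gauss n) (\<lambda>z. (h z)\<^sup>2)"
    unfolding h_def by (rule supf_integrable[OF A R]; assumption)+
  have hcong: "h x = h y" if "\<And>i. i < n \<Longrightarrow> x i = y i" for x y
    using supf_Lipschitz[OF A R, of x y] that by (simp add: h_def dst_def)
  have hb: "(h z)\<^sup>2 \<le> R\<^sup>2 * (dst n z (\<lambda>_. 0))\<^sup>2" for z
    using power_mono[OF supf_bound[OF A R, of z], of 2] by (simp add: h_def power_mult_distrib)
  have iP: "integrable ?P (\<lambda>p. (h (f p) - h (g p))\<^sup>2)"
    if [measurable]: "f \<in> ?P \<rightarrow>\<^sub>M gauss n" "g \<in> ?P \<rightarrow>\<^sub>M gauss n"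
      and fg: "\<And>z w. (dst n (f (z, w)) (\<lambda>_. 0))\<^sup>2 \<le> 2 * ((dst n z (\<lambda>_. 0))\<^sup>2 + (dst n w (\<lambda>_. 0))\<^sup>2)"
       "\<And>z w. (dst n (g (z, w)) (\<lambda>_. 0))\<^sup>2 \<le> 2 * ((dst n z (\<lambda>_. 0))\<^sup>2 + (dst n w (\<lambda>_. 0))\<^sup>2)" for f g
  proof (rule gauss_pair_integrable_quadratic)
    fix z w
    let ?X = "(dst n z (\<lambda>_. 0))\<^sup>2 + (dst n w (\<lambda>_. 0))\<^sup>2"
    have "(h (f (z,w)) + - h (g (z,w)))\<^sup>2 \<le> 2 * (h (f (z,w)))\<^sup>2 + 2 * (h (g (z,w)))\<^sup>2"
      using square_sum_le[of "h (f (z,w))" "- h (g (z,w))"] by simp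
    also have "\<dots> \<le> 2 * (R\<^sup>2 * (2 * ?X)) + 2 * (R\<^sup>2 * (2 * ?X))"
      using order_trans[OF hb mult_left_mono[OF fg(1)]] order_trans[OF hb mult_left_mono[OF fg(2)]]
      by (intro add_mono mult_left_mono) auto
    finally show "\<bar>(h (f (z, w)) - h (g (z, w)))\<^sup>2\<bar> \<le> (8 * R\<^sup>2) * ?X" by (simp add: algebra_simps)
  qed simp
  \<comment> \<open>N is at least 2, so the step angle has positive cosine, and N^2 is at least n,
    so the term proportional to the dimension is bounded by (2/N^2)^2 N^2 = 4/N^2.\<close>
  define N where "N = n + 2"
  define \<theta> where "\<theta> = pi / 2 / N"
  have \<theta>: "0 < \<theta>" "\<theta> < pi / 2" "\<theta> \<le> 2 / N" "real N * \<theta> = pi / 2"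
  proof -
    show "0 < \<theta>" by (simp add: \<theta>_def N_def)
    have "pi / 2 / real N \<le> pi / 2 / 2" by (intro divide_left_mono) (auto simp: N_def)
    also have "\<dots> < pi / 2" by simp
    finally show "\<theta> < pi / 2" by (simp add: \<theta>_def)
    show "\<theta> \<le> 2 / N" unfolding \<theta>_def using pi_less_4 by (intro divide_right_mono) auto
    show "real N * \<theta> = pi / 2" 
    proof -
      have "real N \<noteq> 0" by (simp add: N_def)
      then show ?thesis by (simp add: \<theta>_def)
    qed
  qed
  have c: "cos \<theta> > 0" using \<theta> by (intro cos_gt_zero_pi) auto
  define d where "d p = (h (fst p) - h (fst (rot n \<theta> p)))\<^sup>2" for p
  have rotn: "(dst n (fst (rot n \<theta> (z, w))) (\<lambda>_. 0))\<^sup>2 \<le> 2 * ((dst n z (\<lambda>_. 0))\<^sup>2 + (dst n w (\<lambda>_. 0))\<^sup>2)" for z w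
  proof -
    have "(cos \<theta> * x + sin \<theta> * y)\<^sup>2 \<le> 2 * (x\<^sup>2 + y\<^sup>2)" for x y
    proof -
      have "(cos \<theta>)\<^sup>2 * x\<^sup>2 \<le> 1 * x\<^sup>2" "(sin \<theta>)\<^sup>2 * y\<^sup>2 \<le> 1 * y\<^sup>2"
        by (intro mult_right_mono; simp add: abs_square_le_1)+
      then show ?thesis using square_sum_le[of "cos \<theta> * x" "sin \<theta> * y"]
        by (simp add: power_mult_distrib)
    qed
    then show ?thesis
      unfolding dst_power2 ip_def by (auto simp: rot_def sum_distrib_left simp flip: sum.distrib power2_eq_square intro!: sum_mono)
  qed
  have d_int: "integrable ?P d"
    unfolding d_def by (rule iP) (use rotn in auto)
  have Ed: "(\<integral>p. d p \<partial>?P) \<le> 64 * R\<^sup>2 / N\<^sup>2"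
  proof -
    have s: "(sin \<theta>)\<^sup>2 \<le> (2 / N)\<^sup>2"
      using \<theta> sin_x_le_x[of \<theta>] sin_gt_zero[of \<theta>] by (intro power_mono) auto
    have "1 - cos \<theta> = 2 * (sin (\<theta> / 2))\<^sup>2" using cos_double_sin[of "\<theta> / 2"] by simp
    also have "\<dots> \<le> 2 * (1 / N)\<^sup>2"
      using \<theta> sin_x_le_x[of "\<theta> / 2"] sin_gt_zero[of "\<theta> / 2"] by (intro mult_left_mono power_mono) (auto simp: field_simps)
    finally have "(1 - cos \<theta>)\<^sup>2 \<le> (2 * (1 / N)\<^sup>2)\<^sup>2" by (intro power_mono) auto
    then have "(1 - cos \<theta>)\<^sup>2 * n \<le> (2 * (1 / N)\<^sup>2)\<^sup>2 * N\<^sup>2"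
      by (intro mult_mono) (auto simp: N_def power2_eq_square algebra_simps)
    also have "\<dots> = (2 / N)\<^sup>2"
    proof -
      have "real N \<noteq> 0" by (simp add: N_def)
      then show ?thesis by (simp add: field_simps power2_eq_square)
    qed
    finally have "(1 - cos \<theta>)\<^sup>2 * n + (sin \<theta>)\<^sup>2 \<le> 8 / N\<^sup>2" using s by (simp add: power_divide)
    then have "8 * R\<^sup>2 * ((1 - cos \<theta>)\<^sup>2 * n + (sin \<theta>)\<^sup>2) \<le> 8 * R\<^sup>2 * (8 / N\<^sup>2)"
      by (intro mult_left_mono) auto
    then show ?thesis using supf_rotation_step[OF A R c] unfolding d_def h_def by fastforce
  qed
  let ?r = "\<lambda>k. rot n \<theta> ^^ k"
  note rk = rot_pow_measure_preserving[OF c, where n = n]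
  have dk: "integrable ?P (\<lambda>p. d (?r k p))" "(\<integral>p. d (?r k p) \<partial>?P) = (\<integral>p. d p \<partial>?P)" for k
    using integrable_distr[OF rk(2)[of k], of d] integral_distr[OF rk(2)[of k], of d] d_int
    unfolding rk(1) by auto
  \<comment> \<open>After N steps the first vector has become the second. The Cauchy-Schwarz
    inequality costs one factor N and the number of summands another, which cancels the 1/N^2 of a
    single step.\<close>
  have pw: "(h (fst p) - h (snd p))\<^sup>2 \<le> N * (\<Sum>k<N. d (?r k p))" for p
  proof -
    have "fst (?r N p) i = snd p i" if "i < n" for i
      using rot_pow_coords(1)[OF that, where \<theta> = \<theta> and k = N and p = p] \<theta>(4) by simp
    then have "h (fst (?r N p)) = h (snd p)" by (rule hcong)
    then have "h (fst p) - h (snd p) = (\<Sum>k<N. h (fst (?r k p)) - h (fst (?r (Suc k) p)))"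
      by (subst sum_lessThan_telescope') simp
    also have "(\<dots>)\<^sup>2 \<le> (\<Sum>k<N. (h (fst (?r k p)) - h (fst (?r (Suc k) p)))\<^sup>2) * card {..<N}"
      by (rule sum_squared_le_sum_of_squares)
    finally show ?thesis by (simp add: d_def mult.commute)
  qed
  have intD: "integrable ?P (\<lambda>p. (h (fst p) - h (snd p))\<^sup>2)"
    by (rule iP) auto
  have "(\<integral>p. (h (fst p) - h (snd p))\<^sup>2 \<partial>?P) \<le> (\<integral>p. N * (\<Sum>k<N. d (?r k p)) \<partial>?P)"
    using intD pw dk(1) by (intro integral_mono) auto
  also have "\<dots> = real N * (real N * (\<integral>p. d p \<partial>?P))"
    using dk by simp
  also have "\<dots> \<le> real N * (real N * (64 * R\<^sup>2 / N\<^sup>2))"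
    using Ed by (intro mult_left_mono) auto
  also have "\<dots> = 64 * R\<^sup>2"
  proof -
    have "real N \<noteq> 0" by (simp add: N_def)
    then show ?thesis by (simp add: power2_eq_square)
  qed
  finally have 1: "(\<integral>p. (h (fst p) - h (snd p))\<^sup>2 \<partial>?P) \<le> 64 * R\<^sup>2" .
  \<comment> \<open>For independent copies the mean squared difference is twice the variance. The
    variance is therefore at most 32 R^2, which is rounded up to the square 36 R^2.\<close>
  have E2: "(\<integral>w. (h z - h w)\<^sup>2 \<partial>gauss n) = (h z)\<^sup>2 - 2 * h z * m + (\<integral>w. (h w)\<^sup>2 \<partial>gauss n)" for z
    using ih by (simp add: power2_diff m_def gauss.prob_space)
  have "(\<integral>p. (h (fst p) - h (snd p))\<^sup>2 \<partial>?P) = (\<integral>z. (h z)\<^sup>2 - 2 * h z * m + (\<integral>w. (h w)\<^sup>2 \<partial>gauss n) \<partial>gauss n)"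
    using gauss_pair.integral_fst'[OF intD] by (simp add: E2)
  also have "\<dots> = 2 * ((\<integral>w. (h w)\<^sup>2 \<partial>gauss n) - m\<^sup>2)"
    using ih by (simp add: gauss.prob_space m_def[symmetric] power2_eq_square)
  finally have "(\<integral>w. (h w)\<^sup>2 \<partial>gauss n) - m\<^sup>2 \<le> 32 * R\<^sup>2" using 1 by simp
  moreover have "(\<integral>z. (h z - m)\<^sup>2 \<partial>gauss n) = (\<integral>w. (h w)\<^sup>2 \<partial>gauss n) - m\<^sup>2"
    using ih by (simp add: power2_diff gauss.prob_space m_def[symmetric]) (simp add: power2_eq_square)
  ultimately have *: "(\<integral>z. (h z - m)\<^sup>2 \<partial>gauss n) \<le> 32 * R\<^sup>2" by simp
  have "(\<integral>z. (h z - m)\<^sup>2 \<partial>gauss n) \<le> (6 * R)\<^sup>2"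
  proof -
    have "32 * R\<^sup>2 \<le> (6 * R)\<^sup>2" by (simp add: power_mult_distrib)
    then show ?thesis using * by linarith
  qed
  then show ?thesis by (simp add: h_def m_def)
qed

section \<open>The local width\<close>

text \<open>\<open>loc n K \<nu> z t\<close> is the local supremum inside \<open>lwidth\<close>, recentred at \<open>\<nu>\<close> so that it is
 \<open>t\<close>-Lipschitz in the noise.\<close>

definition loc :: "nat \<Rightarrow> (nat \<Rightarrow> real) set \<Rightarrow> (nat \<Rightarrow> real) \<Rightarrow> (nat \<Rightarrow> real) \<Rightarrow> real \<Rightarrow> real" where
  "loc n K \<nu> z t = supf n (cb n \<nu> t \<inter> K) \<nu> z"

lemma cb_dst: "v \<in> cb n \<nu> t \<inter> K \<Longrightarrow> dst n \<nu> v \<le> t"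
  by (simp add: cb_def)

context
  fixes n K \<nu>
  assumes K: "convex_body n K" and \<nu>: "\<nu> \<in> K"
begin

lemma center_in_cb: "0 \<le> t \<Longrightarrow> \<nu> \<in> cb n \<nu> t \<inter> K"
  using K \<nu> by (auto simp: cb_def convex_body_def)

lemma loc_upper: "0 \<le> t \<Longrightarrow> v \<in> K \<Longrightarrow> dst n \<nu> v \<le> t \<Longrightarrow> ip n z v - ip n z \<nu> \<le> loc n K \<nu> z t"
  unfolding loc_def using K
  by (intro supf_upper[OF convex_body_cb[OF K \<nu>] cb_dst]) (auto simp: cb_def convex_body_def)

lemma loc_least:
  assumes "0 \<le> t" "\<And>v. v \<in> K \<Longrightarrow> dst n \<nu> v \<le> t \<Longrightarrow> ip n z v - ip n z \<nu> \<le> B"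
  shows "loc n K \<nu> z t \<le> B"
  unfolding loc_def
  by (intro supf_least[OF convex_body_cb[OF K \<nu> assms(1)] cb_dst] assms(2)) (auto simp: cb_def)

lemma loc_mono: "0 \<le> s \<Longrightarrow> s \<le> t \<Longrightarrow> loc n K \<nu> z s \<le> loc n K \<nu> z t"
  by (rule loc_least) (auto intro: loc_upper)

text \<open>By convexity of \<open>K\<close>, the convex combination of a point within radius
  \<open>x\<close> and a point within radius \<open>y\<close> is a competitor for the combined
  radius. The two suprema are released one at a time by dividing by the weight, so the weights 0 and
  1 are separate cases.\<close>

lemma loc_concave:
  assumes "0 \<le> x" "0 \<le> y" "0 \<le> t" "t \<le> 1"
  shows "t * loc n K \<nu> z x + (1 - t) * loc n K \<nu> z y \<le> loc n K \<nu> z (t * x + (1 - t) * y)"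
    (is "_ \<le> ?F")
proof -
  have xy: "0 \<le> t * x + (1 - t) * y" using assms by simp
  have 1: "t * (ip n z v - ip n z \<nu>) + (1 - t) * (ip n z v' - ip n z \<nu>) \<le> ?F"
    if v: "v \<in> K" "dst n \<nu> v \<le> x" "v' \<in> K" "dst n \<nu> v' \<le> y" for v v'
  proof -
    have "(\<lambda>i. t * v i + (1 - t) * v' i) \<in> K"
      using K v assms by (intro econvexD) (auto simp: convex_body_def)
    moreover have "dst n \<nu> (\<lambda>i. t * v i + (1 - t) * v' i) \<le> t * x + (1 - t) * y"
      using dst_convex_comb[of t n \<nu> v v'] v assms
        mult_left_mono[of "dst n \<nu> v" x t] mult_left_mono[of "dst n \<nu> v'" y "1 - t"] by linarith
    moreover have "ip n z (\<lambda>i. t * v i + (1 - t) * v' i) = t * ip n z v + (1 - t) * ip n z v'"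
      by (simp add: ip_comm[of n z] ip_add_left ip_scale_left)
    ultimately show ?thesis using loc_upper[OF xy, of "\<lambda>i. t * v i + (1 - t) * v' i" z]
      by (simp add: algebra_simps)
  qed
  have 2: "t * loc n K \<nu> z x + (1 - t) * (ip n z v' - ip n z \<nu>) \<le> ?F"
    if v': "v' \<in> K" "dst n \<nu> v' \<le> y" for v'
  proof (cases "t = 0")
    case True
    then show ?thesis using loc_upper[OF assms(2) v'] by simp
  next
    case False
    then have "0 < t" using assms by simp
    have "loc n K \<nu> z x \<le> (?F - (1 - t) * (ip n z v' - ip n z \<nu>)) / t"
      by (rule loc_least[OF assms(1)]) (use 1[OF _ _ v'] \<open>0 < t\<close> in \<open>simp add: pos_le_divide_eq mult.commute le_diff_eq\<close>)
    then show ?thesis using \<open>0 < t\<close> by (simp add: pos_le_divide_eq mult.commute le_diff_eq)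
  qed
  show ?thesis
  proof (cases "t = 1")
    case False
    then have "0 < 1 - t" using assms by simp
    have "loc n K \<nu> z y \<le> (?F - t * loc n K \<nu> z x) / (1 - t)"
      by (rule loc_least[OF assms(2)])
        (use 2 \<open>0 < 1 - t\<close> in \<open>simp add: pos_le_divide_eq mult.commute le_diff_eq add.commute\<close>)
    then have "loc n K \<nu> z y * (1 - t) \<le> ?F - t * loc n K \<nu> z x"
      using \<open>0 < 1 - t\<close> by (simp add: pos_le_divide_eq)
    then show ?thesis by (simp add: mult.commute[of "loc n K \<nu> z y"])
  qed simp
qed

lemma loc_measurable [measurable]: "0 \<le> t \<Longrightarrow> (\<lambda>z. loc n K \<nu> z t) \<in> borel_measurable (gauss n)"
  unfolding loc_def by (rule supf_measurable[OF convex_body_cb[OF K \<nu>] cb_dst])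

lemma loc_integrable:
  assumes "0 \<le> t"
  shows "integrable (gauss n) (\<lambda>z. loc n K \<nu> z t)" "integrable (gauss n) (\<lambda>z. (loc n K \<nu> z t)\<^sup>2)"
  unfolding loc_def by (rule supf_integrable[OF convex_body_cb[OF K \<nu> assms] cb_dst]; assumption)+

lemma integral_loc: "0 \<le> t \<Longrightarrow> (\<integral>z. loc n K \<nu> z t \<partial>gauss n) = lwidth n K \<nu> t"
  unfolding loc_def lwidth_def by (rule integral_supf[OF convex_body_cb[OF K \<nu>] cb_dst])

lemma loc_deviation:
  assumes "0 \<le> t"
  shows "integrable (gauss n) (\<lambda>z. (loc n K \<nu> z t - lwidth n K \<nu> t)\<^sup>2)"
    "(\<integral>z. (loc n K \<nu> z t - lwidth n K \<nu> t)\<^sup>2 \<partial>gauss n) \<le> (6 * t)\<^sup>2"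
proof -
  show "integrable (gauss n) (\<lambda>z. (loc n K \<nu> z t - lwidth n K \<nu> t)\<^sup>2)"
    using loc_integrable[OF assms] by (simp add: power2_diff)
  show "(\<integral>z. (loc n K \<nu> z t - lwidth n K \<nu> t)\<^sup>2 \<partial>gauss n) \<le> (6 * t)\<^sup>2"
    using supf_variance[OF convex_body_cb[OF K \<nu> assms], of \<nu> t] cb_dst[of _ n \<nu> t K]
    unfolding integral_loc[OF assms, unfolded loc_def] loc_def by blast
qed

lemma lwidth_mono: "0 \<le> s \<Longrightarrow> s \<le> t \<Longrightarrow> lwidth n K \<nu> s \<le> lwidth n K \<nu> t"
  by (simp flip: integral_loc add: integral_mono loc_integrable loc_mono)

lemma lwidth_nonneg: "0 \<le> t \<Longrightarrow> 0 \<le> lwidth n K \<nu> t"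
  using loc_upper[OF _ \<nu>] by (simp flip: integral_loc)

lemma lwidth_concave:
  assumes "0 \<le> x" "0 \<le> y" "0 \<le> t" "t \<le> 1"
  shows "t * lwidth n K \<nu> x + (1 - t) * lwidth n K \<nu> y \<le> lwidth n K \<nu> (t * x + (1 - t) * y)"
proof -
  have xy: "0 \<le> t * x + (1 - t) * y" using assms by simp
  have "t * lwidth n K \<nu> x + (1 - t) * lwidth n K \<nu> y
    = (\<integral>z. t * loc n K \<nu> z x + (1 - t) * loc n K \<nu> z y \<partial>gauss n)"
    using loc_integrable assms integral_loc by simp
  also have "\<dots> \<le> (\<integral>z. loc n K \<nu> z (t * x + (1 - t) * y) \<partial>gauss n)"
    using loc_integrable assms xy by (intro integral_mono loc_concave) auto
  finally show ?thesis using integral_loc[OF xy] by simp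
qed

text \<open>The radius \<open>a\<close> is interior, so a concave function has a supporting line
  there; comparison with the value at \<open>2 * a\<close> and monotonicity make its slope
  nonnegative.\<close>

lemma lwidth_supergradient:
  assumes "0 < a"
  obtains s where "0 \<le> s" "\<And>t. 0 \<le> t \<Longrightarrow> lwidth n K \<nu> t \<le> lwidth n K \<nu> a + s * (t - a)"
proof -
  have "concave_on {0..} (lwidth n K \<nu>)"
    unfolding concave_on_iff
  proof (intro conjI ballI allI impI)
    fix x y u v :: real assume "x \<in> {0..}" "y \<in> {0..}" "0 \<le> u" "0 \<le> v" "u + v = 1"
    then have "0 \<le> x" "0 \<le> y" "u \<le> 1" "v = 1 - u" "0 \<le> u" by auto
    then show "u * lwidth n K \<nu> x + v * lwidth n K \<nu> y \<le> lwidth n K \<nu> (u *\<^sub>R x + v *\<^sub>R y)"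
      using lwidth_concave[of x y u] by simp
  qed simp
  then have cv: "convex_on {0..} (\<lambda>t. - lwidth n K \<nu> t)" by (simp add: concave_on_def)
  have "a \<in> interior {0..}" using assms by (simp add: interior_real_atLeast)
  from convex_le_Inf_differential[OF cv this] obtain l
    where l: "\<And>t. 0 \<le> t \<Longrightarrow> - lwidth n K \<nu> a + l * (t - a) \<le> - lwidth n K \<nu> t" by auto
  show thesis
  proof (rule that[of "- l"])
    have "l * a \<le> 0" using l[of "2 * a"] lwidth_mono[of a "2 * a"] assms by simp
    then show "0 \<le> - l" using assms by (simp add: mult_le_0_iff)
    show "lwidth n K \<nu> t \<le> lwidth n K \<nu> a + - l * (t - a)" if "0 \<le> t" for t using l[OF that] by simp
  qed
qed

text \<open>The excess of \<open>loc\<close> over a supporting line of \<open>lwidth\<close> at \<open>a\<close> is a concave process, so it is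
 controlled on both sides of \<open>a\<close> by \<open>concave_process_bound\<close>; beyond \<open>2 * a\<close> it is extrapolated
 from \<open>a\<close> and \<open>2 * a\<close>, and the second moment of the radius suffices.\<close>

theorem random_radius_width:
  assumes a: "0 < a"
    and T: "\<And>z. 0 \<le> T z" "integrable (gauss n) T" "integrable (gauss n) (\<lambda>z. (T z)\<^sup>2)" "(\<integral>z. (T z)\<^sup>2 \<partial>gauss n) \<le> a\<^sup>2"
    and g: "integrable (gauss n) g" "\<And>z. g z \<le> loc n K \<nu> z (T z)"
  shows "(\<integral>z. g z \<partial>gauss n) \<le> lwidth n K \<nu> a + 300 * a"
proof -
  let ?f = "loc n K \<nu>" and ?w = "lwidth n K \<nu>"
  obtain s where s: "0 \<le> s" "\<And>t. 0 \<le> t \<Longrightarrow> ?w t \<le> ?w a + s * (t - a)"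
    using lwidth_supergradient[OF a] by blast
  define \<phi> where "\<phi> z t = ?f z t - ?w a - s * (t - a)" for z t
  define \<gamma> where "\<gamma> t = ?w a + s * (t - a) - ?w t" for t
  define dev where "dev z t = ?f z t - ?w t" for z t
  have dev: "\<phi> z t + \<gamma> t = dev z t" for z t by (simp add: \<phi>_def \<gamma>_def dev_def)
  have \<gamma>a: "\<gamma> a = 0" by (simp add: \<gamma>_def)
  have \<gamma>0: "0 \<le> \<gamma> t" if "0 \<le> t" for t using s(2)[OF that] by (simp add: \<gamma>_def)
  have conc: "t * \<phi> z x + (1 - t) * \<phi> z y \<le> \<phi> z (t * x + (1 - t) * y)"
    if "0 \<le> x" "0 \<le> y" "0 \<le> t" "t \<le> 1" for z x y t
    using loc_concave[OF that, of z] by (simp add: \<phi>_def algebra_simps)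
  have conv: "\<gamma> (t * x + (1 - t) * y) \<le> t * \<gamma> x + (1 - t) * \<gamma> y"
    if "0 \<le> x" "0 \<le> y" "0 \<le> t" "t \<le> 1" for x y t
    using lwidth_concave[OF that] by (simp add: \<gamma>_def algebra_simps)
  \<comment> \<open>The standard deviation at radius \<open>t\<close> is at most
    \<open>6 * t\<close>, and radii up to \<open>2 * a\<close> are used.\<close>
  define b where "b = 12 * a"
  have b: "0 < b" using a by (simp add: b_def)
  have devi: "integrable (gauss n) (\<lambda>z. (dev z t)\<^sup>2)" if "0 \<le> t" for t
    using loc_deviation(1)[OF that] by (simp add: dev_def)
  have devE: "(\<integral>z. (dev z t)\<^sup>2 \<partial>gauss n) \<le> b\<^sup>2" if "0 \<le> t" "t \<le> 2 * a" for t
  proof -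
    have "(6 * t)\<^sup>2 \<le> b\<^sup>2" using that by (intro power_mono) (auto simp: b_def)
    then show ?thesis using loc_deviation(2)[OF that(1)] unfolding dev_def by linarith
  qed
  have "\<exists>R. integrable (gauss n) R \<and> (\<integral>z. R z \<partial>gauss n) \<le> 10 * b \<and> (\<forall>z. 0 \<le> R z) \<and>
    (\<forall>z\<in>space (gauss n). \<forall>x. 0 \<le> x \<and> x \<le> a \<longrightarrow> \<phi> z (a + x) \<le> R z)"
  proof (rule gauss.concave_process_bound[where \<gamma> = "\<lambda>x. \<gamma> (a + x)"])
    fix z x y t :: real assume *: "0 \<le> x" "0 \<le> y" "0 \<le> t" "t \<le> 1"
    have e: "a + (t * x + (1 - t) * y) = t * (a + x) + (1 - t) * (a + y)" by (simp add: algebra_simps)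
    show "t * \<phi> \<omega> (a + x) + (1 - t) * \<phi> \<omega> (a + y) \<le> \<phi> \<omega> (a + (t * x + (1 - t) * y))" for \<omega>
      unfolding e using * a by (intro conc) auto
    show "\<gamma> (a + (t * x + (1 - t) * y)) \<le> t * \<gamma> (a + x) + (1 - t) * \<gamma> (a + y)"
      unfolding e using * a by (intro conv) auto
  qed (use a b \<gamma>a \<gamma>0 devi devE in \<open>auto simp: dev\<close>)
  then obtain R1 where R1: "integrable (gauss n) R1" "(\<integral>z. R1 z \<partial>gauss n) \<le> 10 * b" "\<And>z. 0 \<le> R1 z"
    "\<And>z x. z \<in> space (gauss n) \<Longrightarrow> 0 \<le> x \<Longrightarrow> x \<le> a \<Longrightarrow> \<phi> z (a + x) \<le> R1 z" by blast
  have "\<exists>R. integrable (gauss n) R \<and> (\<integral>z. R z \<partial>gauss n) \<le> 10 * b \<and> (\<forall>z. 0 \<le> R z) \<and>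
    (\<forall>z\<in>space (gauss n). \<forall>x. 0 \<le> x \<and> x \<le> a \<longrightarrow> \<phi> z (a - x) \<le> R z)"
  proof (rule gauss.concave_process_bound[where \<gamma> = "\<lambda>x. \<gamma> (a - x)"])
    fix z x y t :: real assume *: "0 \<le> x" "x \<le> a" "0 \<le> y" "y \<le> a" "0 \<le> t" "t \<le> 1"
    have e: "a - (t * x + (1 - t) * y) = t * (a - x) + (1 - t) * (a - y)" by (simp add: algebra_simps)
    show "t * \<phi> \<omega> (a - x) + (1 - t) * \<phi> \<omega> (a - y) \<le> \<phi> \<omega> (a - (t * x + (1 - t) * y))" for \<omega>
      unfolding e using * a by (intro conc) auto
    show "\<gamma> (a - (t * x + (1 - t) * y)) \<le> t * \<gamma> (a - x) + (1 - t) * \<gamma> (a - y)"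
      unfolding e using * a by (intro conv) auto
  qed (use a b \<gamma>a \<gamma>0 devi devE in \<open>auto simp: dev\<close>)
  then obtain R2 where R2: "integrable (gauss n) R2" "(\<integral>z. R2 z \<partial>gauss n) \<le> 10 * b" "\<And>z. 0 \<le> R2 z"
    "\<And>z x. z \<in> space (gauss n) \<Longrightarrow> 0 \<le> x \<Longrightarrow> x \<le> a \<Longrightarrow> \<phi> z (a - x) \<le> R2 z" by blast
  \<comment> \<open>Covers radii beyond \<open>2 * a\<close>. There the excess is at most T/a times
    a sum of two deviations; Young's inequality with weight \<open>b\<close> splits the product into
    second moments, and each of the four summands has mean at most \<open>b\<close>.\<close>
  define H where "H z = (dev z a)\<^sup>2 / b + b + b * ((T z)\<^sup>2 / a\<^sup>2) + (dev z (2 * a))\<^sup>2 / b" for z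
  have H0: "0 \<le> H z" for z using b by (simp add: H_def)
  have \<phi>le: "\<phi> z (T z) \<le> R1 z + R2 z + H z" if z: "z \<in> space (gauss n)" for z
  proof -
    consider "T z \<le> a" | "a < T z" "T z \<le> 2 * a" | "2 * a < T z" by linarith
    then show ?thesis
    proof cases
      case 1 then show ?thesis using R2(4)[OF z, of "a - T z"] T(1)[of z] R1(3)[of z] H0[of z] by simp
    next
      case 2 then show ?thesis using R1(4)[OF z, of "T z - a"] R2(3)[of z] H0[of z] by simp
    next
      case 3
      \<comment> \<open>With this weight \<open>2 * a\<close> is the convex combination of
        \<open>T z\<close> and \<open>a\<close>, so concavity bounds the value at the far point
        \<open>T z\<close> by the values at \<open>a\<close> and \<open>2 * a\<close>, at the price
        of the factor 1/t.\<close>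
      define t where "t = a / (T z - a)"
      have pos: "0 < T z - a" using 3 a by linarith
      have t: "0 < t" "t \<le> 1" using 3 a by (auto simp: t_def field_simps)
      have "t * T z + (1 - t) * a = 2 * a"
      proof -
        have "t * (T z - a) = a" using pos by (simp add: t_def)
        then show ?thesis by (simp add: algebra_simps)
      qed
      then have "t * \<phi> z (T z) + (1 - t) * \<phi> z a \<le> \<phi> z (2 * a)"
        using conc[of "T z" a t z] T(1)[of z] a t by simp
      also have "\<phi> z (2 * a) \<le> \<bar>dev z (2 * a)\<bar>"
        using \<gamma>0[of "2 * a"] dev[of z "2 * a"] a by linarith
      finally have "t * \<phi> z (T z) \<le> \<bar>dev z (2 * a)\<bar> + \<bar>dev z a\<bar>"
      proof -
        assume *: "t * \<phi> z (T z) + (1 - t) * \<phi> z a \<le> \<bar>dev z (2 * a)\<bar>"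
        have "\<bar>(1 - t) * \<phi> z a\<bar> \<le> 1 * \<bar>dev z a\<bar>"
          unfolding abs_mult using t dev[of z a] \<gamma>a by (intro mult_mono) auto
        then show ?thesis using * by linarith
      qed
      then have "\<phi> z (T z) \<le> (\<bar>dev z (2 * a)\<bar> + \<bar>dev z a\<bar>) / t"
        using t by (simp add: pos_le_divide_eq mult.commute)
      also have "\<dots> = (T z - a) / a * (\<bar>dev z (2 * a)\<bar> + \<bar>dev z a\<bar>)" using a pos by (simp add: t_def)
      also have "\<dots> \<le> T z / a * (\<bar>dev z (2 * a)\<bar> + \<bar>dev z a\<bar>)"
        using a by (intro mult_right_mono divide_right_mono) auto
      also have "\<dots> \<le> H z"
      proof -
        define r where "r = T z / a"
        have "r * y \<le> (b * r\<^sup>2 + y\<^sup>2 / b) / 2" for y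
        proof -
          have "2 * b * (r * y) \<le> b * (b * r\<^sup>2) + y\<^sup>2"
            using zero_le_power2[of "b * r - y"] by (simp add: power2_eq_square algebra_simps)
          then show ?thesis using b by (simp add: field_simps)
        qed
        from add_mono[OF this[of "\<bar>dev z (2 * a)\<bar>"] this[of "\<bar>dev z a\<bar>"]]
        have "r * (\<bar>dev z (2 * a)\<bar> + \<bar>dev z a\<bar>)
          \<le> b * r\<^sup>2 + (dev z (2 * a))\<^sup>2 / b / 2 + (dev z a)\<^sup>2 / b / 2"
          by (simp add: field_simps)
        moreover have "0 \<le> (dev z (2 * a))\<^sup>2 / b" "0 \<le> (dev z a)\<^sup>2 / b" using b by auto
        moreover have "L \<le> B + p / 2 + q / 2 \<Longrightarrow> 0 \<le> p \<Longrightarrow> 0 \<le> q \<Longrightarrow> L \<le> q + b + B + p" for L B p q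
          using b by linarith
        ultimately show ?thesis unfolding H_def r_def power_divide by blast
      qed
      finally show ?thesis using R1(3)[of z] R2(3)[of z] by linarith
    qed
  qed
  have iH: "integrable (gauss n) H" unfolding H_def using devi a T(3) by simp
  have EH: "(\<integral>z. H z \<partial>gauss n) \<le> 4 * b"
  proof -
    have "(\<integral>z. H z \<partial>gauss n) = (\<integral>z. (dev z a)\<^sup>2 \<partial>gauss n) / b + b + b * ((\<integral>z. (T z)\<^sup>2 \<partial>gauss n) / a\<^sup>2)
       + (\<integral>z. (dev z (2 * a))\<^sup>2 \<partial>gauss n) / b"
      unfolding H_def using devi a T(3) by (simp add: gauss.prob_space)
    also have "\<dots> \<le> b\<^sup>2 / b + b + b * (a\<^sup>2 / a\<^sup>2) + b\<^sup>2 / b"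
      using devE a b T(4) by (intro add_mono divide_right_mono mult_left_mono) auto
    also have "\<dots> = 4 * b" using a b by (simp add: power2_eq_square)
    finally show ?thesis .
  qed
  have ET: "(\<integral>z. T z \<partial>gauss n) \<le> a"
  proof -
    have "(\<integral>z. T z \<partial>gauss n) \<le> (\<integral>z. ((T z)\<^sup>2 / a + a) / 2 \<partial>gauss n)"
    proof (rule integral_mono)
      show "T z \<le> ((T z)\<^sup>2 / a + a) / 2" for z
        using abs_le_square_over[OF a, of "T z"] T(1)[of z] by simp
    qed (use T in auto)
    also have "\<dots> = ((\<integral>z. (T z)\<^sup>2 \<partial>gauss n) / a + a) / 2" using T by (simp add: gauss.prob_space)
    also have "\<dots> \<le> (a\<^sup>2 / a + a) / 2" using a T(4) by (intro divide_right_mono add_right_mono) auto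
    also have "\<dots> = a" using a by (simp add: power2_eq_square)
    finally show ?thesis .
  qed
  have "(\<integral>z. g z \<partial>gauss n) \<le> (\<integral>z. (?w a + s * (T z - a)) + (R1 z + R2 z + H z) \<partial>gauss n)"
  proof (rule integral_mono)
    fix z assume z: "z \<in> space (gauss n)"
    have "g z \<le> (?w a + s * (T z - a)) + \<phi> z (T z)" using g(2)[of z] by (simp add: \<phi>_def)
    then show "g z \<le> (?w a + s * (T z - a)) + (R1 z + R2 z + H z)" using \<phi>le[OF z] by linarith
  qed (use g T R1 R2 iH in auto)
  also have "\<dots> = ?w a + s * ((\<integral>z. T z \<partial>gauss n) - a)
     + ((\<integral>z. R1 z \<partial>gauss n) + (\<integral>z. R2 z \<partial>gauss n) + (\<integral>z. H z \<partial>gauss n))"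
    using T R1 R2 iH by (simp add: gauss.prob_space)
  \<comment> \<open>The slope \<open>s\<close>, for which no upper bound is known, disappears
    because the mean radius is at most \<open>a\<close>. What remains is 24 b = 288 a.\<close>
  also have "\<dots> \<le> ?w a + 0 + (10 * b + 10 * b + 4 * b)"
    using R1 R2 EH ET s(1) by (intro add_mono) (auto simp: mult_le_0_iff)
  also have "\<dots> \<le> ?w a + 300 * a" using a by (simp add: b_def)
  finally show ?thesis .
qed

end

section \<open>Shifted Gaussians\<close>

lemma stdN_shift:
  "distr stdN borel (\<lambda>x. x + h) = density stdN (\<lambda>x. ennreal (exp (h * x - h\<^sup>2 / 2)))"
proof (rule measure_eqI)
  fix A assume "A \<in> sets (distr stdN borel (\<lambda>x. x + h))"
  then have [measurable]: "A \<in> sets borel" by simp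
  have "emeasure (distr stdN borel (\<lambda>x. x + h)) A = (\<integral>\<^sup>+x. indicator A x \<partial>distr stdN borel (\<lambda>x. x + h))"
    by (rule nn_integral_indicator[symmetric]) simp
  also have "\<dots> = (\<integral>\<^sup>+x. indicator A (x + h) \<partial>stdN)"
    by (rule nn_integral_distr) measurable
  finally have "emeasure (distr stdN borel (\<lambda>x. x + h)) A = (\<integral>\<^sup>+x. indicator A (x + h) \<partial>stdN)" .
  also have "\<dots> = (\<integral>\<^sup>+x. ennreal (std_normal_density x) * indicator A (x + h) \<partial>lborel)"
    by (simp add: nn_integral_density)
  also have "\<dots> = (\<integral>\<^sup>+x. ennreal (std_normal_density (x - h)) * indicator A x \<partial>lborel)"
    by (subst nn_integral_real_affine[where c = 1 and t = "- h"]) simp_all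
  also have "\<dots> = (\<integral>\<^sup>+x. ennreal (std_normal_density x) * (ennreal (exp (h * x - h\<^sup>2 / 2)) * indicator A x) \<partial>lborel)"
  proof (rule nn_integral_cong)
    fix x
    have "std_normal_density (x - h) = std_normal_density x * exp (h * x - h\<^sup>2 / 2)"
      by (simp add: std_normal_density_def power2_eq_square field_simps flip: exp_add)
    then show "ennreal (std_normal_density (x - h)) * indicator A x
      = ennreal (std_normal_density x) * (ennreal (exp (h * x - h\<^sup>2 / 2)) * indicator A x)"
      by (simp add: ennreal_mult mult.assoc)
  qed
  also have "\<dots> = (\<integral>\<^sup>+x. ennreal (exp (h * x - h\<^sup>2 / 2)) * indicator A x \<partial>stdN)"
    by (simp add: nn_integral_density)
  also have "\<dots> = emeasure (density stdN (\<lambda>x. ennreal (exp (h * x - h\<^sup>2 / 2)))) A"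
    by (simp add: emeasure_density)
  finally show "emeasure (distr stdN borel (\<lambda>x. x + h)) A
    = emeasure (density stdN (\<lambda>x. ennreal (exp (h * x - h\<^sup>2 / 2)))) A" .
qed simp

text \<open>The exponential factorises over the coordinates, so both sides agree on boxes with the
  product of the shifted one-dimensional laws.\<close>

lemma Cameron_Martin:
  "distr (gauss n) (gauss n) (\<lambda>z. \<lambda>i\<in>{..<n}. z i + h i)
    = density (gauss n) (\<lambda>z. ennreal (exp (ip n z h - ip n h h / 2)))"
proof -
  let ?N = "\<lambda>i. distr stdN borel (\<lambda>x. x + h i)"
  interpret Nh: product_prob_space "?N" "{..<n}"
    by (intro product_prob_spaceI stdN.prob_space_distr) simp
  have sets: "sets (gauss n) = sets (PiM {..<n} ?N)"
    unfolding gauss_sets by (rule sets_PiM_cong) auto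
  have "distr (gauss n) (gauss n) (\<lambda>z. \<lambda>i\<in>{..<n}. z i + h i) = PiM {..<n} ?N"
  proof (rule Nh.PiM_eqI)
    fix A assume "\<And>i. i \<in> {..<n} \<Longrightarrow> A i \<in> sets (?N i)"
    then have A[measurable]: "A i \<in> sets borel" if "i < n" for i using that by simp
    define B where "B i = (\<lambda>x. x + h i) -` A i" for i
    have B: "B i \<in> sets stdN" if "i < n" for i
      using measurable_sets[of "\<lambda>x. x + h i" borel borel "A i"] A[OF that] by (simp add: B_def)
    have "Pi\<^sub>E {..<n} A \<in> sets (gauss n)"
      unfolding gauss_sets by (intro sets_PiM_I_finite) (use A in auto)
    then have "emeasure (distr (gauss n) (gauss n) (\<lambda>z. \<lambda>i\<in>{..<n}. z i + h i)) (Pi\<^sub>E {..<n} A)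
      = emeasure (gauss n) ((\<lambda>z. \<lambda>i\<in>{..<n}. z i + h i) -` Pi\<^sub>E {..<n} A \<inter> space (gauss n))"
      by (intro emeasure_distr) measurable
    also have "(\<lambda>z. \<lambda>i\<in>{..<n}. z i + h i) -` Pi\<^sub>E {..<n} A \<inter> space (gauss n) = Pi\<^sub>E {..<n} B"
      by (auto simp: space_gauss B_def PiE_def Pi_def)
    also have "emeasure (gauss n) (Pi\<^sub>E {..<n} B) = (\<Prod>i<n. emeasure stdN (B i))"
      unfolding gauss_def using B by (intro stdN_prod.emeasure_PiM) auto
    also have "\<dots> = (\<Prod>i<n. emeasure (?N i) (A i))"
      using A by (intro prod.cong refl) (simp add: emeasure_distr B_def)
    finally show "emeasure (distr (gauss n) (gauss n) (\<lambda>z. \<lambda>i\<in>{..<n}. z i + h i)) (Pi\<^sub>E {..<n} A)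
      = (\<Prod>i<n. emeasure (?N i) (A i))" .
  qed (simp_all add: sets)
  also have "PiM {..<n} ?N = density (gauss n) (\<lambda>z. ennreal (exp (ip n z h - ip n h h / 2)))"
  proof (rule Nh.PiM_eqI[symmetric])
    fix A assume "\<And>i. i \<in> {..<n} \<Longrightarrow> A i \<in> sets (?N i)"
    then have A[measurable]: "A i \<in> sets borel" if "i < n" for i using that by simp
    define f where "f i x = ennreal (exp (h i * x - (h i)\<^sup>2 / 2)) * indicator (A i) x" for i x
    have [measurable]: "Pi\<^sub>E {..<n} A \<in> sets (gauss n)"
      unfolding gauss_sets by (intro sets_PiM_I_finite) (use A in auto)
    have "emeasure (density (gauss n) (\<lambda>z. ennreal (exp (ip n z h - ip n h h / 2)))) (Pi\<^sub>E {..<n} A)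
      = (\<integral>\<^sup>+z. ennreal (exp (ip n z h - ip n h h / 2)) * indicator (Pi\<^sub>E {..<n} A) z \<partial>gauss n)"
      by (simp add: emeasure_density)
    also have "\<dots> = (\<integral>\<^sup>+z. (\<Prod>i<n. f i (z i)) \<partial>gauss n)"
    proof (rule nn_integral_cong)
      fix z assume z: "z \<in> space (gauss n)"
      have "ip n z h - ip n h h / 2 = (\<Sum>i<n. h i * z i - (h i)\<^sup>2 / 2)"
        by (simp add: ip_def sum_subtractf sum_divide_distrib power2_eq_square mult.commute)
      then have "ennreal (exp (ip n z h - ip n h h / 2)) = (\<Prod>i<n. ennreal (exp (h i * z i - (h i)\<^sup>2 / 2)))"
        by (simp add: exp_sum prod_ennreal)
      moreover have "indicator (Pi\<^sub>E {..<n} A) z = (\<Prod>i<n. indicator (A i) (z i) :: ennreal)"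
        using z by (auto simp: space_gauss PiE_def Pi_def prod_zero_iff indicator_def split: if_splits)
      ultimately show "ennreal (exp (ip n z h - ip n h h / 2)) * indicator (Pi\<^sub>E {..<n} A) z = (\<Prod>i<n. f i (z i))"
        by (simp add: f_def prod.distrib)
    qed
    also have "\<dots> = (\<Prod>i<n. \<integral>\<^sup>+x. f i x \<partial>stdN)"
      unfolding gauss_def by (rule stdN_prod.product_nn_integral_prod) (auto simp: f_def)
    also have "\<dots> = (\<Prod>i<n. emeasure (?N i) (A i))"
      by (intro prod.cong refl) (simp add: stdN_shift f_def emeasure_density)
    finally show "emeasure (density (gauss n) (\<lambda>z. ennreal (exp (ip n z h - ip n h h / 2)))) (Pi\<^sub>E {..<n} A)
      = (\<Prod>i<n. emeasure (?N i) (A i))" .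
  qed (simp_all add: sets)
  finally show ?thesis .
qed

section \<open>The least squares estimator\<close>

lemma dst_abs_diff: "\<bar>dst n x z - dst n y z\<bar> \<le> dst n x y"
  using dst_triangle[of n x z y] dst_triangle[of n y z x] by (simp add: dst_sym abs_le_iff)

lemma dst_scale: "0 \<le> c \<Longrightarrow> dst n (\<lambda>i. c * x i) (\<lambda>i. c * y i) = c * dst n x y"
  using L2_set_right_distrib[of c "\<lambda>i. x i - y i" "{..<n}"]
  by (simp add: dst_L2_set right_diff_distrib)

definition obs :: "nat \<Rightarrow> (nat \<Rightarrow> real) \<Rightarrow> real \<Rightarrow> (nat \<Rightarrow> real) \<Rightarrow> nat \<Rightarrow> real" where
  "obs n \<mu> \<sigma> z = (\<lambda>i. if i < n then \<mu> i + \<sigma> * z i else 0)"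

definition sq_risk :: "nat \<Rightarrow> (nat \<Rightarrow> real) set \<Rightarrow> real \<Rightarrow> (nat \<Rightarrow> real) \<Rightarrow> real" where
  "sq_risk n K \<sigma> \<mu> = (\<integral>z. (dst n (lse n K (obs n \<mu> \<sigma> z)) \<mu>)\<^sup>2 \<partial>gauss n)"

lemma lse_risk_eq: "lse_risk n K \<sigma> = sqrt (SUP \<mu>\<in>K. sq_risk n K \<sigma> \<mu>)"
  by (simp add: lse_risk_def sq_risk_def obs_def)

locale sequence_model =
  fixes n :: nat and K :: "(nat \<Rightarrow> real) set" and \<sigma> :: real
  assumes K: "convex_body n K" and \<sigma>: "0 < \<sigma>"
begin

lemma K_ne: "K \<noteq> {}" and K_vecs: "K \<subseteq> vecs n" and K_closed: "eclosed n K" and K_convex: "econvex K"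
  and K_bounded: "ebounded n K"
  using K by (simp_all add: convex_body_def)

lemmas proj_mem = lse_nearest(1)[OF K_ne K_closed K_convex]
  and proj_variational = lse_variational[OF K_ne K_closed K_convex]
  and proj_nonexpansive = lse_nonexpansive[OF K_ne K_closed K_convex]

lemma bdd_dst: "bdd_above ((\<lambda>p. dst n (fst p) (snd p)) ` (K \<times> K))"
proof -
  obtain B where "\<And>x y. x \<in> K \<Longrightarrow> y \<in> K \<Longrightarrow> dst n x y \<le> B"
    using K_bounded unfolding ebounded_def by blast
  then show ?thesis by (intro bdd_aboveI2[of _ _ B]) auto
qed

lemma dst_le_diam: "x \<in> K \<Longrightarrow> y \<in> K \<Longrightarrow> dst n x y \<le> ediam n K"
  unfolding ediam_def using cSUP_upper[OF _ bdd_dst, of "(x, y)"] by simp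

lemma diam_nonneg: "0 \<le> ediam n K"
  using K_ne dst_le_diam dst_nonneg by (meson all_not_in_conv order_trans)

lemma dst_obs: "dst n (obs n \<mu> \<sigma> x) (obs n \<mu> \<sigma> y) = \<sigma> * dst n x y"
proof -
  have "dst n (obs n \<mu> \<sigma> x) (obs n \<mu> \<sigma> y) = dst n (\<lambda>i. \<sigma> * x i) (\<lambda>i. \<sigma> * y i)"
    unfolding dst_def by (intro arg_cong[where f = sqrt] sum.cong) (auto simp: obs_def)
  then show ?thesis using \<sigma> by (simp add: dst_scale)
qed

lemma proj_obs_Lipschitz:
  "dst n (lse n K (obs n \<mu> \<sigma> x)) (lse n K (obs n \<mu> \<sigma> y)) \<le> \<sigma> * dst n x y"
  using proj_nonexpansive[of "obs n \<mu> \<sigma> x" "obs n \<mu> \<sigma> y"] by (simp add: dst_obs)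

lemma err_measurable [measurable]:
  "(\<lambda>z. dst n (lse n K (obs n \<mu> \<sigma> z)) v) \<in> borel_measurable (gauss n)"
proof (rule gauss_measurable_Lipschitz)
  fix x y
  show "\<bar>dst n (lse n K (obs n \<mu> \<sigma> x)) v - dst n (lse n K (obs n \<mu> \<sigma> y)) v\<bar> \<le> \<sigma> * dst n x y"
    using dst_abs_diff proj_obs_Lipschitz by (rule order_trans)
qed

lemma err_integrable:
  assumes "v \<in> K"
  shows "integrable (gauss n) (\<lambda>z. dst n (lse n K (obs n \<mu> \<sigma> z)) v)"
    "integrable (gauss n) (\<lambda>z. (dst n (lse n K (obs n \<mu> \<sigma> z)) v)\<^sup>2)"
proof -
  have "dst n (lse n K (obs n \<mu> \<sigma> z)) v \<le> ediam n K" for z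
    using dst_le_diam[OF proj_mem assms] .
  then show "integrable (gauss n) (\<lambda>z. dst n (lse n K (obs n \<mu> \<sigma> z)) v)"
    "integrable (gauss n) (\<lambda>z. (dst n (lse n K (obs n \<mu> \<sigma> z)) v)\<^sup>2)"
    by - (rule gauss.integrable_const_bound[where B = "ediam n K"], simp, measurable,
       rule gauss.integrable_const_bound[where B = "(ediam n K)\<^sup>2"], simp add: power_mono, measurable)
qed

lemma gain_integrable:
  assumes \<mu>: "\<mu> \<in> K"
  shows "integrable (gauss n) (\<lambda>z. ip n z (lse n K (obs n \<mu> \<sigma> z)) - ip n z \<mu>)"
proof (rule gauss_integrable_linear)
  have [measurable]: "(\<lambda>z. lse n K (obs n \<mu> \<sigma> z) i) \<in> borel_measurable (gauss n)" if "i < n" for i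
    by (rule gauss_measurable_Lipschitz[of _ \<sigma>])
       (rule order_trans[OF abs_coord_le_dst[OF that] proj_obs_Lipschitz])
  show "(\<lambda>z. ip n z (lse n K (obs n \<mu> \<sigma> z)) - ip n z \<mu>) \<in> borel_measurable (gauss n)"
    unfolding ip_def by measurable
  fix z
  have "\<bar>ip n z (\<lambda>i. lse n K (obs n \<mu> \<sigma> z) i - \<mu> i)\<bar> \<le> dst n z (\<lambda>_. 0) * dst n (lse n K (obs n \<mu> \<sigma> z)) \<mu>"
    by (rule ip_Cauchy_Schwarz)
  also have "\<dots> \<le> dst n z (\<lambda>_. 0) * ediam n K"
    using dst_le_diam[OF proj_mem \<mu>] by (intro mult_left_mono) auto
  finally show "\<bar>ip n z (lse n K (obs n \<mu> \<sigma> z)) - ip n z \<mu>\<bar> \<le> ediam n K * dst n z (\<lambda>_. 0)"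
    by (simp add: ip_diff_right mult.commute)
qed

text \<open>The residual of the projection is the noise minus the error. Cauchy-Schwarz on the cross
  term between error and \<open>v\<close> leaves a bound that depends on \<open>v\<close> only
  through its distance, so the supremum can be taken.\<close>

lemma first_order_condition:
  assumes \<mu>: "\<mu> \<in> K" and t: "0 \<le> t"
  defines "p \<equiv> \<lambda>z. lse n K (obs n \<mu> \<sigma> z)"
  shows "loc n K \<mu> z t \<le> (ip n z (p z) - ip n z \<mu>) + (t * dst n (p z) \<mu> - (dst n (p z) \<mu>)\<^sup>2) / \<sigma>"
proof (rule loc_least[OF K \<mu> t])
  fix v assume v: "v \<in> K" "dst n \<mu> v \<le> t"
  let ?p = "p z"
  have "ip n (\<lambda>i. obs n \<mu> \<sigma> z i - ?p i) (\<lambda>i. v i - ?p i) \<le> 0"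
    unfolding p_def by (rule proj_variational[OF v(1)])
  also have "ip n (\<lambda>i. obs n \<mu> \<sigma> z i - ?p i) (\<lambda>i. v i - ?p i)
     = \<sigma> * (ip n z v - ip n z ?p) - (ip n (\<lambda>i. ?p i - \<mu> i) (\<lambda>i. v i - \<mu> i) - (dst n ?p \<mu>)\<^sup>2)"
    unfolding dst_power2 ip_def
    by (simp add: sum_distrib_left flip: sum.distrib sum_subtractf)
       (auto intro!: sum.cong simp: obs_def algebra_simps)
  finally have "\<sigma> * (ip n z v - ip n z ?p) \<le> ip n (\<lambda>i. ?p i - \<mu> i) (\<lambda>i. v i - \<mu> i) - (dst n ?p \<mu>)\<^sup>2"
    by simp
  also have "ip n (\<lambda>i. ?p i - \<mu> i) (\<lambda>i. v i - \<mu> i) \<le> dst n ?p \<mu> * dst n v \<mu>"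
    by (rule ip_Cauchy_Schwarz_diff)
  also have "\<dots> \<le> dst n ?p \<mu> * t" using v(2) by (intro mult_left_mono) (auto simp: dst_sym)
  finally have "ip n z v - ip n z ?p \<le> (t * dst n ?p \<mu> - (dst n ?p \<mu>)\<^sup>2) / \<sigma>"
    using \<sigma> by (simp add: pos_le_divide_eq mult.commute)
  then show "ip n z v - ip n z \<mu> \<le> (ip n z ?p - ip n z \<mu>) + (t * dst n ?p \<mu> - (dst n ?p \<mu>)\<^sup>2) / \<sigma>"
    by linarith
qed

lemma sq_risk_nonneg: "0 \<le> sq_risk n K \<sigma> \<mu>"
  unfolding sq_risk_def by (intro Bochner_Integration.integral_nonneg) simp

text \<open>The radius \<open>r\<close> may be any upper bound on the root risk, not only its value:
  the lower bound on the risk applies this with r = \<epsilon>/c, the upper bound with the exact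
  root. The exact risk is kept with its negative sign because the upper bound lives on that
  term.\<close>

lemma width_le_via_risk:
  assumes \<mu>: "\<mu> \<in> K" and r: "0 < r" "sq_risk n K \<sigma> \<mu> \<le> r\<^sup>2" and t: "0 \<le> t"
  shows "lwidth n K \<mu> t \<le> lwidth n K \<mu> r + 300 * r + (t * r - sq_risk n K \<sigma> \<mu>) / \<sigma>"
proof -
  define p where "p z = lse n K (obs n \<mu> \<sigma> z)" for z
  define D where "D z = dst n (p z) \<mu>" for z
  define g where "g z = ip n z (p z) - ip n z \<mu>" for z
  have iD: "integrable (gauss n) D" "integrable (gauss n) (\<lambda>z. (D z)\<^sup>2)"
    using err_integrable[OF \<mu>] by (simp_all add: D_def[abs_def] p_def)
  have ig: "integrable (gauss n) g" using gain_integrable[OF \<mu>] by (simp add: g_def[abs_def] p_def)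
  have ED2: "(\<integral>z. (D z)\<^sup>2 \<partial>gauss n) = sq_risk n K \<sigma> \<mu>" by (simp add: D_def p_def sq_risk_def)
  have ED: "(\<integral>z. D z \<partial>gauss n) \<le> r"
  proof -
    have "(\<integral>z. D z \<partial>gauss n) \<le> (\<integral>z. ((D z)\<^sup>2 / r + r) / 2 \<partial>gauss n)"
    proof (rule integral_mono)
      show "D z \<le> ((D z)\<^sup>2 / r + r) / 2" for z
        using abs_le_square_over[OF r(1), of "D z"] by (simp add: D_def)
    qed (use iD in auto)
    also have "\<dots> = (sq_risk n K \<sigma> \<mu> / r + r) / 2" using iD by (simp add: gauss.prob_space ED2)
    also have "\<dots> \<le> (r\<^sup>2 / r + r) / 2" using r by (intro divide_right_mono add_right_mono) auto
    also have "\<dots> = r" using r by (simp add: power2_eq_square)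
    finally show ?thesis .
  qed
  have "lwidth n K \<mu> t \<le> (\<integral>z. g z + (t * D z - (D z)\<^sup>2) / \<sigma> \<partial>gauss n)"
    unfolding integral_loc[OF K \<mu> t, symmetric]
  proof (rule integral_mono)
    show "loc n K \<mu> z t \<le> g z + (t * D z - (D z)\<^sup>2) / \<sigma>" for z
      using first_order_condition[OF \<mu> t] by (simp add: g_def D_def p_def)
  qed (use ig iD loc_integrable[OF K \<mu> t] in auto)
  also have "\<dots> = (\<integral>z. g z \<partial>gauss n) + (t * (\<integral>z. D z \<partial>gauss n) - sq_risk n K \<sigma> \<mu>) / \<sigma>"
    using ig iD by (simp add: ED2)
  also have "\<dots> \<le> (lwidth n K \<mu> r + 300 * r) + (t * r - sq_risk n K \<sigma> \<mu>) / \<sigma>"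
  proof (intro add_mono divide_right_mono diff_right_mono mult_left_mono ED t)
    show "(\<integral>z. g z \<partial>gauss n) \<le> lwidth n K \<mu> r + 300 * r"
    proof (rule random_radius_width[OF K \<mu> r(1)])
      show "g z \<le> loc n K \<mu> z (D z)" for z
        unfolding g_def D_def p_def
        using proj_mem by (intro loc_upper[OF K \<mu>]) (auto simp: dst_sym)
      show "0 \<le> D z" for z by (simp add: D_def)
    qed (use iD ig r(2) in \<open>simp_all add: ED2\<close>)
  qed (use \<sigma> in auto)
  finally show ?thesis .
qed

lemma sq_risk_le_diam: "\<mu> \<in> K \<Longrightarrow> sq_risk n K \<sigma> \<mu> \<le> (ediam n K)\<^sup>2"
proof -
  assume \<mu>: "\<mu> \<in> K"
  have "sq_risk n K \<sigma> \<mu> \<le> (\<integral>z. (ediam n K)\<^sup>2 \<partial>gauss n)"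
    unfolding sq_risk_def using err_integrable[OF \<mu>] dst_le_diam[OF proj_mem \<mu>]
    by (intro integral_mono power_mono) auto
  then show ?thesis by (simp add: gauss.prob_space)
qed

lemma sq_risk_le_lse_risk: "\<mu> \<in> K \<Longrightarrow> sq_risk n K \<sigma> \<mu> \<le> (lse_risk n K \<sigma>)\<^sup>2"
  and lse_risk_nonneg: "0 \<le> lse_risk n K \<sigma>"
proof -
  have bdd: "bdd_above (sq_risk n K \<sigma> ` K)" using sq_risk_le_diam by (rule bdd_aboveI2)
  have le: "sq_risk n K \<sigma> \<mu> \<le> (SUP \<mu>\<in>K. sq_risk n K \<sigma> \<mu>)" if "\<mu> \<in> K" for \<mu>
    by (rule cSUP_upper[OF that bdd])
  then have 0: "0 \<le> (SUP \<mu>\<in>K. sq_risk n K \<sigma> \<mu>)"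
    using K_ne sq_risk_nonneg by (meson all_not_in_conv order_trans)
  show "0 \<le> lse_risk n K \<sigma>" unfolding lse_risk_eq using 0 by simp
  show "sq_risk n K \<sigma> \<mu> \<le> (lse_risk n K \<sigma>)\<^sup>2" if "\<mu> \<in> K"
    unfolding lse_risk_eq using 0 le[OF that] by simp
qed

lemma lse_risk_le:
  assumes "0 \<le> r" "\<And>\<mu>. \<mu> \<in> K \<Longrightarrow> sq_risk n K \<sigma> \<mu> \<le> r\<^sup>2"
  shows "lse_risk n K \<sigma> \<le> r"
proof -
  have "(SUP \<mu>\<in>K. sq_risk n K \<sigma> \<mu>) \<le> r\<^sup>2" using K_ne assms(2) by (rule cSUP_least)
  then show ?thesis unfolding lse_risk_eq using assms(1) by (simp add: real_le_lsqrt)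
qed

lemma lse_risk_le_diam: "lse_risk n K \<sigma> \<le> ediam n K"
  using diam_nonneg sq_risk_le_diam by (rule lse_risk_le)

end

section \<open>The critical radius\<close>

context sequence_model
begin

text \<open>Le Cam's two-point argument: no single estimate is close to both means, and means within
  \<sigma>/2 of each other give data whose laws overlap. The overlap is measured by min(1, e^s),
  with s the log-likelihood ratio, and is at least 1 - |s|.\<close>

lemma two_point_lower_bound:
  assumes \<mu>: "\<mu>0 \<in> K" "\<mu>1 \<in> K" and close: "dst n \<mu>0 \<mu>1 \<le> \<sigma> / 2"
  shows "dst n \<mu>0 \<mu>1 / 4 \<le> lse_risk n K \<sigma>"
proof -
  \<comment> \<open>The shift of the noise that turns data with mean \<open>\<mu>0\<close> into data
    with mean \<open>\<mu>1\<close>.\<close>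
  define h where "h i = (\<mu>1 i - \<mu>0 i) / \<sigma>" for i
  define q where "q = dst n \<mu>0 \<mu>1"
  define a where "a = q / \<sigma>"
  have q0: "0 \<le> q" by (simp add: q_def)
  have a: "0 \<le> a" "a \<le> 1/2" using close \<sigma> by (auto simp: a_def q_def field_simps)
  have hh: "ip n h h = a\<^sup>2"
  proof -
    have "a\<^sup>2 = (dst n \<mu>1 \<mu>0)\<^sup>2 / \<sigma>\<^sup>2" by (simp add: a_def q_def power_divide dst_sym)
    also have "\<dots> = ip n h h"
      unfolding dst_power2 ip_def sum_divide_distrib h_def by (simp add: power2_eq_square)
    finally show ?thesis ..
  qed
  define s where "s z = ip n z h - a\<^sup>2 / 2" for z
  define p where "p z = lse n K (obs n \<mu>0 \<sigma> z)" for z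
  define \<psi>0 where "\<psi>0 z = (dst n (p z) \<mu>0)\<^sup>2" for z
  define \<psi>1 where "\<psi>1 z = (dst n (p z) \<mu>1)\<^sup>2" for z
  define shift where "shift z = (\<lambda>i\<in>{..<n}. z i + h i)" for z
  have [measurable]: "\<psi>1 \<in> borel_measurable (gauss n)" "shift \<in> gauss n \<rightarrow>\<^sub>M gauss n"
    unfolding \<psi>1_def[abs_def] p_def shift_def[abs_def] by measurable
  have [measurable]: "s \<in> borel_measurable (gauss n)" unfolding s_def[abs_def] by measurable
  have CM: "distr (gauss n) (gauss n) shift = density (gauss n) (\<lambda>z. ennreal (exp (s z)))"
    using Cameron_Martin[of n h] by (simp add: shift_def[abs_def] s_def hh)
  have obs_shift: "obs n \<mu>0 \<sigma> (shift z) = obs n \<mu>1 \<sigma> z" for z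
    using \<sigma> by (auto simp: obs_def shift_def h_def fun_eq_iff field_simps)
  have \<psi>1s: "\<psi>1 (shift z) = (dst n (lse n K (obs n \<mu>1 \<sigma> z)) \<mu>1)\<^sup>2" for z
    by (simp add: \<psi>1_def p_def obs_shift)
  have risk1: "sq_risk n K \<sigma> \<mu>1 = (\<integral>z. exp (s z) * \<psi>1 z \<partial>gauss n)"
  proof -
    have "sq_risk n K \<sigma> \<mu>1 = (\<integral>z. \<psi>1 z \<partial>distr (gauss n) (gauss n) shift)"
      by (subst integral_distr) (simp_all add: \<psi>1s sq_risk_def)
    then show ?thesis unfolding CM by (subst (asm) integral_density) auto
  qed
  have int1: "integrable (gauss n) (\<lambda>z. exp (s z) * \<psi>1 z)"
  proof -
    have "integrable (distr (gauss n) (gauss n) shift) \<psi>1"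
      using err_integrable(2)[OF \<mu>(2), of \<mu>1] by (subst integrable_distr_eq) (simp_all add: \<psi>1s)
    then show ?thesis unfolding CM by (subst (asm) integrable_density) auto
  qed
  have int0: "integrable (gauss n) \<psi>0" "integrable (gauss n) \<psi>1"
    using err_integrable(2) \<mu> by (simp_all add: \<psi>0_def[abs_def] \<psi>1_def[abs_def] p_def)
  have risk0: "sq_risk n K \<sigma> \<mu>0 = (\<integral>z. \<psi>0 z \<partial>gauss n)"
    by (simp add: sq_risk_def \<psi>0_def p_def)
  have pw: "q\<^sup>2 / 2 * (1 - \<bar>s z\<bar>) \<le> \<psi>0 z + exp (s z) * \<psi>1 z" for z
  proof -
    define m where "m = min 1 (exp (s z))"
    have m: "0 \<le> m" "m \<le> 1" "m \<le> exp (s z)" "1 - \<bar>s z\<bar> \<le> m"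
    proof -
      have "1 - \<bar>s z\<bar> \<le> exp (s z)" using exp_ge_add_one_self[of "s z"] by linarith
      then show "1 - \<bar>s z\<bar> \<le> m" by (simp add: m_def)
    qed (simp_all add: m_def)
    have nn: "0 \<le> \<psi>0 z" "0 \<le> \<psi>1 z" by (simp_all add: \<psi>0_def \<psi>1_def)
    have "q\<^sup>2 \<le> (dst n (p z) \<mu>0 + dst n (p z) \<mu>1)\<^sup>2"
      using dst_triangle[of n \<mu>0 \<mu>1 "p z"] q0 by (intro power_mono) (auto simp: q_def dst_sym)
    also have "\<dots> \<le> 2 * \<psi>0 z + 2 * \<psi>1 z" unfolding \<psi>0_def \<psi>1_def by (rule square_sum_le)
    finally have q: "q\<^sup>2 / 2 \<le> \<psi>0 z + \<psi>1 z" by simp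
    have "q\<^sup>2 / 2 * (1 - \<bar>s z\<bar>) \<le> q\<^sup>2 / 2 * m" using m by (intro mult_left_mono) auto
    also have "\<dots> \<le> (\<psi>0 z + \<psi>1 z) * m" using m q by (intro mult_right_mono) auto
    also have "\<dots> = m * \<psi>0 z + m * \<psi>1 z" by (simp add: algebra_simps)
    also have "\<dots> \<le> 1 * \<psi>0 z + exp (s z) * \<psi>1 z" using m nn by (intro add_mono mult_right_mono) auto
    finally show ?thesis by simp
  qed
  have s_int: "integrable (gauss n) s" unfolding s_def[abs_def] using gauss_ip by simp
  \<comment> \<open>With a at most 1/2 the bound a^2 + 1/4 + a^2/2 is at most 5/8, so at least a
    quarter of q^2/2 survives in the sum of the two risks.\<close>
  have Es: "(\<integral>z. \<bar>s z\<bar> \<partial>gauss n) \<le> 3/4"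
  proof -
    have "(\<integral>z. \<bar>s z\<bar> \<partial>gauss n) \<le> (\<integral>z. (ip n z h)\<^sup>2 + 1/4 + a\<^sup>2 / 2 \<partial>gauss n)"
    proof (rule integral_mono)
      fix z
      have "\<bar>ip n z h\<bar> \<le> (ip n z h)\<^sup>2 + 1/4"
        using zero_le_power2[of "\<bar>ip n z h\<bar> - 1/2"] by (simp add: power2_eq_square algebra_simps)
      moreover have "\<bar>s z\<bar> \<le> \<bar>ip n z h\<bar> + a\<^sup>2 / 2"
        unfolding s_def using abs_triangle_ineq4[of "ip n z h" "a\<^sup>2 / 2"] by simp
      ultimately show "\<bar>s z\<bar> \<le> (ip n z h)\<^sup>2 + 1/4 + a\<^sup>2 / 2" by linarith
    qed (use s_int gauss_ip_square in auto)
    also have "\<dots> = a\<^sup>2 + 1/4 + a\<^sup>2 / 2" by (simp add: gauss_ip_square gauss.prob_space hh)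
    also have "\<dots> \<le> 3/4"
      using power_mono[of a "1/2" 2] a by (simp add: power2_eq_square)
    finally show ?thesis .
  qed
  have "q\<^sup>2 / 8 \<le> q\<^sup>2 / 2 * (1 - (\<integral>z. \<bar>s z\<bar> \<partial>gauss n))"
  proof -
    have "q\<^sup>2 / 2 * (1/4) \<le> q\<^sup>2 / 2 * (1 - (\<integral>z. \<bar>s z\<bar> \<partial>gauss n))"
      using Es by (intro mult_left_mono) auto
    then show ?thesis by simp
  qed
  also have "\<dots> = (\<integral>z. q\<^sup>2 / 2 * (1 - \<bar>s z\<bar>) \<partial>gauss n)" using s_int by (simp add: gauss.prob_space)
  also have "\<dots> \<le> (\<integral>z. \<psi>0 z + exp (s z) * \<psi>1 z \<partial>gauss n)"
    using s_int int0 int1 pw by (intro integral_mono) auto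
  also have "\<dots> = sq_risk n K \<sigma> \<mu>0 + sq_risk n K \<sigma> \<mu>1" using int0 int1 by (simp add: risk0 risk1)
  also have "\<dots> \<le> 2 * (lse_risk n K \<sigma>)\<^sup>2"
    using sq_risk_le_lse_risk[OF \<mu>(1)] sq_risk_le_lse_risk[OF \<mu>(2)] by linarith
  finally have "(q / 4)\<^sup>2 \<le> (lse_risk n K \<sigma>)\<^sup>2" by (simp add: power_divide)
  then show ?thesis unfolding q_def using lse_risk_nonneg by (rule power2_le_imp_le)
qed

text \<open>Half of min \<sigma> d is strictly below the diameter, so some segment in
  \<open>K\<close> is longer, and by convexity it contains a point at exactly that distance from its
  end. The factor 1/8 is this half times the 1/4 of the two-point bound.\<close>

lemma lse_risk_lower: "min \<sigma> (ediam n K) / 8 \<le> lse_risk n K \<sigma>"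
proof (cases "ediam n K = 0")
  case True
  then show ?thesis using lse_risk_nonneg \<sigma> by (simp add: min_def)
next
  case False
  define m where "m = min \<sigma> (ediam n K) / 2"
  have d: "0 < ediam n K" using diam_nonneg False by simp
  have m: "0 < m" "m \<le> \<sigma> / 2" using d \<sigma> by (auto simp: m_def)
  have "m < ediam n K" using d by (simp add: m_def min_def)
  then have "\<exists>p\<in>K \<times> K. m < dst n (fst p) (snd p)"
    unfolding ediam_def using K_ne bdd_dst by (subst less_cSUP_iff[symmetric]) auto
  then obtain x y where xy: "x \<in> K" "y \<in> K" "m < dst n x y" by auto
  define t where "t = m / dst n x y"
  have t: "0 \<le> t" "t \<le> 1" using xy m by (auto simp: t_def divide_le_eq_1)
  define v where "v = (\<lambda>i. t * y i + (1 - t) * x i)"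
  have v: "v \<in> K" unfolding v_def by (rule econvexD[OF K_convex xy(2,1) t])
  have "dst n x v = dst n (\<lambda>i. t * x i) (\<lambda>i. t * y i)"
    by (simp add: dst_def v_def algebra_simps)
  also have "\<dots> = m" using t xy m by (simp add: dst_scale) (simp add: t_def)
  finally have "dst n x v = m" .
  then show ?thesis using two_point_lower_bound[OF xy(1) v] m by (simp add: m_def)
qed

text \<open>Serves finiteness only: the right-hand side depends on the dimension, but it makes the
  suprema over \<open>K\<close> and over the radii bounded, and it never enters a constant.\<close>

lemma lwidth_le_diam: "\<mu> \<in> K \<Longrightarrow> 0 \<le> t \<Longrightarrow> lwidth n K \<mu> t \<le> (\<integral>z. ediam n K * dst n z (\<lambda>_. 0) \<partial>gauss n)"
proof -
  assume \<mu>: "\<mu> \<in> K" and t: "0 \<le> t"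
  have "dst n x (\<lambda>_. 0) - dst n y (\<lambda>_. 0) \<le> 1 * dst n x y" for x y
    using dst_abs_diff[of n x "\<lambda>_. 0" y] by simp
  then have "(\<lambda>z. dst n z (\<lambda>_. 0)) \<in> borel_measurable (gauss n)"
    by (intro gauss_measurable_Lipschitz[of _ 1]) (simp add: dst_abs_diff)
  then have i: "integrable (gauss n) (\<lambda>z. ediam n K * dst n z (\<lambda>_. 0))"
    by (intro integrable_mult_right gauss_integrable_linear[of _ _ 1]) auto
  have "loc n K \<mu> z t \<le> ediam n K * dst n z (\<lambda>_. 0)" for z
  proof (rule loc_least[OF K \<mu> t])
    fix v assume v: "v \<in> K"
    have "ip n z v - ip n z \<mu> \<le> dst n z (\<lambda>_. 0) * dst n v \<mu>"
      using ip_Cauchy_Schwarz[of n z v \<mu>] by (simp add: ip_diff_right)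
    also have "\<dots> \<le> dst n z (\<lambda>_. 0) * ediam n K" using dst_le_diam[OF v \<mu>] by (intro mult_left_mono) auto
    finally show "ip n z v - ip n z \<mu> \<le> ediam n K * dst n z (\<lambda>_. 0)" by (simp add: mult.commute)
  qed
  then show ?thesis
    unfolding integral_loc[OF K \<mu> t, symmetric] using i loc_integrable[OF K \<mu> t] by (intro integral_mono) auto
qed

text \<open>The ball around \<mu> lies in the ball of twice the radius around \<nu>, and the linear
  term from the change of centre has mean 0. It brings both widths of the gap to the same
  centre.\<close>

lemma lwidth_recenter:
  assumes "\<mu> \<in> K" "\<nu> \<in> K" "dst n \<mu> \<nu> \<le> \<epsilon>"
  shows "lwidth n K \<mu> \<epsilon> \<le> lwidth n K \<nu> (2 * \<epsilon>)"
proof -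
  have \<epsilon>: "0 \<le> \<epsilon>" using assms(3) dst_nonneg order_trans by blast
  have le: "loc n K \<mu> z \<epsilon> \<le> loc n K \<nu> z (2 * \<epsilon>) + ip n z \<nu> - ip n z \<mu>" for z
  proof (rule loc_least[OF K assms(1) \<epsilon>])
    fix v assume v: "v \<in> K" "dst n \<mu> v \<le> \<epsilon>"
    have "dst n \<nu> v \<le> 2 * \<epsilon>"
      using dst_triangle[of n \<nu> v \<mu>] v(2) assms(3) by (simp add: dst_sym)
    then show "ip n z v - ip n z \<mu> \<le> loc n K \<nu> z (2 * \<epsilon>) + ip n z \<nu> - ip n z \<mu>"
      using loc_upper[OF K assms(2) _ v(1), of "2 * \<epsilon>" z] \<epsilon> by simp
  qed
  have "lwidth n K \<mu> \<epsilon> \<le> (\<integral>z. loc n K \<nu> z (2 * \<epsilon>) + ip n z \<nu> - ip n z \<mu> \<partial>gauss n)"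
    unfolding integral_loc[OF K assms(1) \<epsilon>, symmetric]
    using le \<epsilon> loc_integrable[OF K assms(1)] loc_integrable[OF K assms(2)] gauss_ip
    by (intro integral_mono) auto
  also have "\<dots> = lwidth n K \<nu> (2 * \<epsilon>)"
    using \<epsilon> loc_integrable[OF K assms(2)] gauss_ip integral_loc[OF K assms(2)] by simp
  finally show ?thesis .
qed

end

section \<open>Comparison of the critical radius with the risk\<close>

definition width_gap :: "nat \<Rightarrow> (nat \<Rightarrow> real) set \<Rightarrow> real \<Rightarrow> real \<Rightarrow> (nat \<Rightarrow> real) \<Rightarrow> real" where
  "width_gap n K c \<epsilon> \<mu> = lwidth n K \<mu> \<epsilon> - (INF \<nu> \<in> cb n \<mu> \<epsilon> \<inter> K. lwidth n K \<nu> (\<epsilon> / c))"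

definition eps_set :: "nat \<Rightarrow> (nat \<Rightarrow> real) set \<Rightarrow> real \<Rightarrow> real \<Rightarrow> real set" where
  "eps_set n K c \<sigma> = {\<epsilon>. 0 \<le> \<epsilon> \<and> (4 + 4 / c) * \<epsilon>\<^sup>2 / (2 * \<sigma>) \<le> (SUP \<mu>\<in>K. width_gap n K c \<epsilon> \<mu>)}"

lemma eps_bar_eq: "eps_bar n K c \<sigma> = Sup (eps_set n K c \<sigma>)"
  by (simp add: eps_bar_def eps_set_def width_gap_def)

locale sequence_model_c = sequence_model +
  fixes c :: real
  assumes c: "1 < c"
begin

lemma c_pos: "0 < c" using c by simp

lemma bdd_below_lwidth: "0 \<le> t \<Longrightarrow> bdd_below ((\<lambda>\<nu>. lwidth n K \<nu> t) ` (cb n \<mu> \<epsilon> \<inter> K))"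
  using lwidth_nonneg[OF K] by (intro bdd_belowI2[of _ 0]) auto

lemma width_gap_ge:
  assumes "\<mu> \<in> K" "0 \<le> \<epsilon>" "\<nu> \<in> K" "dst n \<mu> \<nu> \<le> \<epsilon>"
  shows "lwidth n K \<mu> \<epsilon> - lwidth n K \<nu> (\<epsilon> / c) \<le> width_gap n K c \<epsilon> \<mu>"
proof -
  have "\<nu> \<in> cb n \<mu> \<epsilon> \<inter> K" using assms K_vecs by (auto simp: cb_def)
  then show ?thesis
    unfolding width_gap_def using assms c_pos
    by (intro diff_left_mono cINF_lower bdd_below_lwidth) auto
qed

lemma width_gap_le:
  assumes "\<mu> \<in> K" "0 \<le> \<epsilon>"
  shows "width_gap n K c \<epsilon> \<mu> \<le> (\<integral>z. ediam n K * dst n z (\<lambda>_. 0) \<partial>gauss n)"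
proof -
  have "0 \<le> (INF \<nu> \<in> cb n \<mu> \<epsilon> \<inter> K. lwidth n K \<nu> (\<epsilon> / c))"
    using center_in_cb[OF K assms] lwidth_nonneg[OF K] assms(2) c_pos by (intro cINF_greatest) auto
  then show ?thesis using lwidth_le_diam[OF assms] by (simp add: width_gap_def)
qed

lemma bdd_above_width_gap: "0 \<le> \<epsilon> \<Longrightarrow> bdd_above (width_gap n K c \<epsilon> ` K)"
  using width_gap_le by (intro bdd_aboveI2) auto

lemma width_gap_le_SUP: "\<mu> \<in> K \<Longrightarrow> 0 \<le> \<epsilon> \<Longrightarrow> width_gap n K c \<epsilon> \<mu> \<le> (SUP \<mu>\<in>K. width_gap n K c \<epsilon> \<mu>)"
  by (intro cSUP_upper bdd_above_width_gap)

text \<open>Nonemptiness gives \<open>Sup\<close> a definite meaning; at radius 0 both widths of the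
  gap, taken at the same centre, coincide.\<close>

lemma zero_in_eps_set: "0 \<in> eps_set n K c s"
proof -
  obtain \<mu> where \<mu>: "\<mu> \<in> K" using K_ne by blast
  have "0 \<le> width_gap n K c 0 \<mu>" using width_gap_ge[OF \<mu> _ \<mu>, of 0] by simp
  then show ?thesis using width_gap_le_SUP[OF \<mu>, of 0] by (simp add: eps_set_def)
qed

lemma bdd_above_eps_set:
  assumes "0 < s"
  shows "bdd_above (eps_set n K c s)"
proof (rule bdd_aboveI)
  let ?M = "\<integral>z. ediam n K * dst n z (\<lambda>_. 0) \<partial>gauss n"
  fix \<epsilon> assume "\<epsilon> \<in> eps_set n K c s"
  then have \<epsilon>: "0 \<le> \<epsilon>" "(4 + 4 / c) * \<epsilon>\<^sup>2 / (2 * s) \<le> (SUP \<mu>\<in>K. width_gap n K c \<epsilon> \<mu>)"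
    by (auto simp: eps_set_def)
  have "(SUP \<mu>\<in>K. width_gap n K c \<epsilon> \<mu>) \<le> ?M"
    using K_ne width_gap_le \<epsilon>(1) by (intro cSUP_least) auto
  with \<epsilon>(2) have "(4 + 4 / c) * \<epsilon>\<^sup>2 / (2 * s) \<le> ?M" by (rule order_trans)
  then have "(4 + 4 / c) * \<epsilon>\<^sup>2 \<le> ?M * (2 * s)" using assms by (simp add: pos_divide_le_eq)
  moreover have "1 * \<epsilon>\<^sup>2 \<le> (4 + 4 / c) * \<epsilon>\<^sup>2" using c_pos by (intro mult_right_mono) auto
  ultimately have "\<epsilon>\<^sup>2 \<le> ?M * (2 * s)" by linarith
  then show "\<epsilon> \<le> sqrt (?M * (2 * s))" by (rule real_le_rsqrt)
qed

text \<open>More noise lowers the threshold. This carries the assumption that the radius at \<sigma>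
  is large over to \<sigma>', where the upper bound is stated.\<close>

lemma eps_bar_mono:
  assumes "0 < s" "s \<le> s'"
  shows "eps_bar n K c s \<le> eps_bar n K c s'"
  unfolding eps_bar_eq
proof (rule cSup_subset_mono)
  show "eps_set n K c s \<noteq> {}" using zero_in_eps_set by blast
  show "bdd_above (eps_set n K c s')" using assms by (intro bdd_above_eps_set) simp
  show "eps_set n K c s \<subseteq> eps_set n K c s'"
  proof
    fix \<epsilon> assume *: "\<epsilon> \<in> eps_set n K c s"
    have "(4 + 4 / c) * \<epsilon>\<^sup>2 / (2 * s') \<le> (4 + 4 / c) * \<epsilon>\<^sup>2 / (2 * s)"
      using assms c_pos by (intro divide_left_mono) auto
    then show "\<epsilon> \<in> eps_set n K c s'" using * by (auto simp: eps_set_def)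
  qed
qed

text \<open>If the risk were smaller, some \<epsilon> in the defining set would satisfy risk <
  \<epsilon>/c. At a nearly minimising \<nu> the large gap then forces the width to grow
  substantially between \<epsilon>/c and 2\<epsilon>, more than a risk this small allows.\<close>

theorem eps_bar_le_lse_risk:
  assumes big: "302 * \<sigma> \<le> eps_bar n K c \<sigma>"
  shows "eps_bar n K c \<sigma> / c \<le> lse_risk n K \<sigma>"
proof (rule ccontr)
  assume "\<not> ?thesis"
  then have "c * lse_risk n K \<sigma> < Sup (eps_set n K c \<sigma>)"
    using c_pos by (simp add: eps_bar_eq not_le pos_less_divide_eq mult.commute)
  moreover have "151 * \<sigma> < Sup (eps_set n K c \<sigma>)" using big \<sigma> by (simp add: eps_bar_eq)
  ultimately have "max (c * lse_risk n K \<sigma>) (151 * \<sigma>) < Sup (eps_set n K c \<sigma>)" by simp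
  then obtain \<epsilon> where \<epsilon>S: "\<epsilon> \<in> eps_set n K c \<sigma>" and "max (c * lse_risk n K \<sigma>) (151 * \<sigma>) < \<epsilon>"
    using less_cSup_iff[OF _ bdd_above_eps_set[OF \<sigma>]] zero_in_eps_set by blast
  then have \<epsilon>: "c * lse_risk n K \<sigma> < \<epsilon>" "151 * \<sigma> < \<epsilon>" by auto
  have \<epsilon>0: "0 < \<epsilon>" using \<epsilon>(2) \<sigma> by linarith
  define a where "a = \<epsilon> / c"
  have a: "0 < a" "lse_risk n K \<sigma> < a" "\<epsilon> = c * a"
    using \<epsilon> \<epsilon>0 c_pos by (auto simp: a_def pos_less_divide_eq mult.commute)
  let ?R = "(4 + 4 / c) * \<epsilon>\<^sup>2 / (2 * \<sigma>)"
  \<comment> \<open>Supremum and infimum are approximated rather than attained, each within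
    \<open>a\<close>. These two slacks raise the 300 to 302.\<close>
  have "?R - a < (SUP \<mu>\<in>K. width_gap n K c \<epsilon> \<mu>)" using \<epsilon>S a by (simp add: eps_set_def)
  then obtain \<mu> where \<mu>: "\<mu> \<in> K" "?R - a < width_gap n K c \<epsilon> \<mu>"
    using less_cSUP_iff[OF K_ne bdd_above_width_gap] \<epsilon>0 by (meson less_imp_le)
  have "(INF \<nu> \<in> cb n \<mu> \<epsilon> \<inter> K. lwidth n K \<nu> a) < (INF \<nu> \<in> cb n \<mu> \<epsilon> \<inter> K. lwidth n K \<nu> a) + a" using a by simp
  then obtain \<nu> where \<nu>: "\<nu> \<in> cb n \<mu> \<epsilon> \<inter> K"
    "lwidth n K \<nu> a < (INF \<nu> \<in> cb n \<mu> \<epsilon> \<inter> K. lwidth n K \<nu> a) + a"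
    using cINF_less_iff[OF _ bdd_below_lwidth] center_in_cb[OF K \<mu>(1)] \<epsilon>0 a
    by (metis empty_iff less_imp_le)
  have \<nu>K: "\<nu> \<in> K" "dst n \<mu> \<nu> \<le> \<epsilon>" using \<nu>(1) by (auto simp: cb_def)
  have gap: "?R - 2 * a < lwidth n K \<nu> (2 * \<epsilon>) - lwidth n K \<nu> a"
    using \<mu>(2) \<nu>(2) lwidth_recenter[OF \<mu>(1) \<nu>K] by (simp add: width_gap_def a_def)
  have "(lse_risk n K \<sigma>)\<^sup>2 \<le> a\<^sup>2" using a lse_risk_nonneg by (intro power_mono) auto
  then have "sq_risk n K \<sigma> \<nu> \<le> a\<^sup>2" using sq_risk_le_lse_risk[OF \<nu>K(1)] by linarith
  from width_le_via_risk[OF \<nu>K(1) a(1) this, of "2 * \<epsilon>"]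
  have "lwidth n K \<nu> (2 * \<epsilon>) \<le> lwidth n K \<nu> a + 300 * a + (2 * \<epsilon> * a - sq_risk n K \<sigma> \<nu>) / \<sigma>"
    using \<epsilon>0 by simp
  also have "(2 * \<epsilon> * a - sq_risk n K \<sigma> \<nu>) / \<sigma> \<le> 2 * \<epsilon> * a / \<sigma>"
    using \<sigma> sq_risk_nonneg by (intro divide_right_mono) auto
  finally have "?R - 2 * \<epsilon> * a / \<sigma> < 302 * a" using gap by linarith
  \<comment> \<open>The summand \<open>4 / c\<close> of the threshold cancels the cross term
    exactly; the rest is quadratic in \<epsilon> against the linear error 302 \<epsilon>, whence the
    cutoff 151 \<sigma>.\<close>
  moreover have "?R - 2 * \<epsilon> * a / \<sigma> = 2 * \<epsilon>\<^sup>2 / \<sigma>"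
    using c_pos \<sigma> by (simp add: a_def field_simps power2_eq_square)
  moreover have "302 * a \<le> 302 * \<epsilon>" using c a by simp
  ultimately have "2 * \<epsilon>\<^sup>2 / \<sigma> < 302 * \<epsilon>" by linarith
  then have "\<epsilon> < 151 * \<sigma>" using \<epsilon>0 \<sigma> by (simp add: pos_divide_less_eq power2_eq_square)
  then show False using \<epsilon>(2) by simp
qed

text \<open>Stated as a maximum, free of any assumption on the size of the critical radius, so that
  it serves both regimes. A root risk above the critical radius lies outside the defining set, so
  the width at the truth grows little between r/c and r, which contradicts the first-order
  inequality unless r is of order \<sigma>.\<close>

theorem lse_risk_le_eps_bar:
  "lse_risk n K \<sigma> \<le> max (eps_bar n K c (4 * c * \<sigma> / (c - 1))) (600 / (1 - 1 / c)\<^sup>2 * \<sigma>)"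
proof (rule dense_ge)
  let ?s = "4 * c * \<sigma> / (c - 1)" and ?C = "600 / (1 - 1 / c)\<^sup>2"
  fix b assume "max (eps_bar n K c ?s) (?C * \<sigma>) < b"
  then have b: "eps_bar n K c ?s < b" "?C * \<sigma> < b" by auto
  have s: "0 < ?s" using c \<sigma> by simp
  have d: "0 < 1 - 1 / c" using c by simp
  have "0 < ?C * \<sigma>" by (intro mult_pos_pos divide_pos_pos zero_less_power d \<sigma>) simp
  then have b0: "0 < b" using b(2) by linarith
  show "lse_risk n K \<sigma> \<le> b"
  proof (rule lse_risk_le)
    fix \<mu> assume \<mu>: "\<mu> \<in> K"
    show "sq_risk n K \<sigma> \<mu> \<le> b\<^sup>2"
    proof (rule ccontr)
      assume "\<not> ?thesis"
      define r where "r = sqrt (sq_risk n K \<sigma> \<mu>)"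
      have r2: "r\<^sup>2 = sq_risk n K \<sigma> \<mu>" by (simp add: r_def sq_risk_nonneg)
      have br: "b < r" using \<open>\<not> sq_risk n K \<sigma> \<mu> \<le> b\<^sup>2\<close> unfolding r_def by (intro real_less_rsqrt) simp
      have r0: "0 < r" using br b0 by linarith
      have "r \<notin> eps_set n K c ?s"
        using b(1) br cSup_upper[OF _ bdd_above_eps_set[OF s], of r] unfolding eps_bar_eq by linarith
      then have "(SUP \<mu>\<in>K. width_gap n K c r \<mu>) < (4 + 4 / c) * r\<^sup>2 / (2 * ?s)"
        using r0 by (simp add: eps_set_def)
      \<comment> \<open>This is where the value of \<sigma>' matters: the threshold acquires the
        factor 1 - 1/c, the one that the risk term gains for t = r/c.\<close>
      moreover have "(4 + 4 / c) * r\<^sup>2 / (2 * ?s) = (1 - 1 / c) * (1 + 1 / c) * r\<^sup>2 / (2 * \<sigma>)"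
        using c \<sigma> by (simp add: field_simps)
      ultimately have 1: "lwidth n K \<mu> r - lwidth n K \<mu> (r / c) < (1 - 1 / c) * (1 + 1 / c) * r\<^sup>2 / (2 * \<sigma>)"
        using width_gap_le_SUP[OF \<mu>, of r] width_gap_ge[OF \<mu> _ \<mu>, of r] r0 by simp
      have 2: "lwidth n K \<mu> (r / c) \<le> lwidth n K \<mu> r + 300 * r + (r / c * r - r\<^sup>2) / \<sigma>"
        using width_le_via_risk[OF \<mu> r0, of "r / c"] r0 c_pos by (simp add: r2)
      have "(1 - 1 / c) * (1 + 1 / c) * r\<^sup>2 / (2 * \<sigma>) + (r / c * r - r\<^sup>2) / \<sigma>
         = - ((1 - 1 / c)\<^sup>2 * r / (2 * \<sigma>) * r)"
        using c_pos \<sigma> by (simp add: field_simps power2_eq_square)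
      then have "(1 - 1 / c)\<^sup>2 * r / (2 * \<sigma>) * r < 300 * r" using 1 2 by linarith
      then have "(1 - 1 / c)\<^sup>2 * r / (2 * \<sigma>) < 300" using r0 by (simp only: mult_less_cancel_right)
      then have "r * (1 - 1 / c)\<^sup>2 < 600 * \<sigma>" using \<sigma> by (simp add: pos_divide_less_eq mult.commute)
      moreover have "0 < (1 - 1 / c)\<^sup>2" by (intro zero_less_power d)
      ultimately have "r < ?C * \<sigma>" by (simp add: pos_less_divide_eq)
      then show False using b(2) br by linarith
    qed
  qed (use b0 in simp)
qed

end

theorem mainTheorem7:
  shows "\<forall>c::real. c > 1 \<longrightarrow> (\<exists>C>0. \<forall>C'>0. \<exists>L>0. \<exists>U>0.
    \<forall>(n::nat) (K::(nat \<Rightarrow> real) set) (\<sigma>::real).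
      n \<ge> 1 \<and> K \<subseteq> vecs n \<and> K \<noteq> {} \<and> eclosed n K \<and> econvex K \<and> ebounded n K \<and> \<sigma> > 0 \<longrightarrow>
      (eps_bar n K c \<sigma> \<ge> C * \<sigma> \<longrightarrow>
         eps_bar n K c \<sigma> / c \<le> lse_risk n K \<sigma> \<and>
         lse_risk n K \<sigma> \<le> eps_bar n K c (4 * c * \<sigma> / (c - 1))) \<and>
      (eps_bar n K c (4 * c * \<sigma> / (c - 1)) \<le> C' * \<sigma> \<longrightarrow>
         L * min \<sigma> (ediam n K) \<le> lse_risk n K \<sigma> \<and>
         lse_risk n K \<sigma> \<le> U * min \<sigma> (ediam n K)))"
proof (intro allI impI)
  fix c :: real assume c: "c > 1"
  define C1 where "C1 = 600 / (1 - 1 / c)\<^sup>2"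
  have C1: "0 < C1" using c by (simp add: C1_def)
  show "\<exists>C>0. \<forall>C'>0. \<exists>L>0. \<exists>U>0.
    \<forall>(n::nat) (K::(nat \<Rightarrow> real) set) (\<sigma>::real).
      n \<ge> 1 \<and> K \<subseteq> vecs n \<and> K \<noteq> {} \<and> eclosed n K \<and> econvex K \<and> ebounded n K \<and> \<sigma> > 0 \<longrightarrow>
      (eps_bar n K c \<sigma> \<ge> C * \<sigma> \<longrightarrow>
         eps_bar n K c \<sigma> / c \<le> lse_risk n K \<sigma> \<and>
         lse_risk n K \<sigma> \<le> eps_bar n K c (4 * c * \<sigma> / (c - 1))) \<and>
      (eps_bar n K c (4 * c * \<sigma> / (c - 1)) \<le> C' * \<sigma> \<longrightarrow>
         L * min \<sigma> (ediam n K) \<le> lse_risk n K \<sigma> \<and>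
         lse_risk n K \<sigma> \<le> U * min \<sigma> (ediam n K))"
  \<comment> \<open>302 serves the lower bound; \<open>C1\<close> makes the second entry of the
    maximum in the upper bound irrelevant.\<close>
  proof (rule exI[of _ "max 302 C1"], intro conjI allI impI)
    show "0 < max 302 C1" by simp
    fix C' :: real assume C': "0 < C'"
    show "\<exists>L>0. \<exists>U>0.
    \<forall>(n::nat) (K::(nat \<Rightarrow> real) set) (\<sigma>::real).
      n \<ge> 1 \<and> K \<subseteq> vecs n \<and> K \<noteq> {} \<and> eclosed n K \<and> econvex K \<and> ebounded n K \<and> \<sigma> > 0 \<longrightarrow>
      (eps_bar n K c \<sigma> \<ge> max 302 C1 * \<sigma> \<longrightarrow>
         eps_bar n K c \<sigma> / c \<le> lse_risk n K \<sigma> \<and>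
         lse_risk n K \<sigma> \<le> eps_bar n K c (4 * c * \<sigma> / (c - 1))) \<and>
      (eps_bar n K c (4 * c * \<sigma> / (c - 1)) \<le> C' * \<sigma> \<longrightarrow>
         L * min \<sigma> (ediam n K) \<le> lse_risk n K \<sigma> \<and>
         lse_risk n K \<sigma> \<le> U * min \<sigma> (ediam n K))"
    \<comment> \<open>1/8 is the two-point constant. In the upper constant, 1 handles the diameter,
      \<open>C'\<close> the assumed bound on the critical radius, and \<open>C1\<close> the
      remaining term of the upper bound.\<close>
    proof (rule exI[of _ "1/8"], rule conjI, simp, rule exI[of _ "max 1 (max C' C1)"],
        rule conjI, simp, intro allI impI)
      fix n :: nat and K :: "(nat \<Rightarrow> real) set" and \<sigma> :: real
      assume A: "n \<ge> 1 \<and> K \<subseteq> vecs n \<and> K \<noteq> {} \<and> eclosed n K \<and> econvex K \<and> ebounded n K \<and> \<sigma> > 0"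
      then interpret sequence_model_c n K \<sigma> c
        using c by unfold_locales (auto simp: convex_body_def)
      let ?s = "4 * c * \<sigma> / (c - 1)"
      have ss: "\<sigma> \<le> ?s"
        using c \<sigma> mult_left_mono[of c "4 * c" \<sigma>] by (simp add: pos_le_divide_eq algebra_simps)
      note up = lse_risk_le_eps_bar[folded C1_def]
      show "(eps_bar n K c \<sigma> \<ge> max 302 C1 * \<sigma> \<longrightarrow>
         eps_bar n K c \<sigma> / c \<le> lse_risk n K \<sigma> \<and> lse_risk n K \<sigma> \<le> eps_bar n K c ?s) \<and>
      (eps_bar n K c ?s \<le> C' * \<sigma> \<longrightarrow>
         1/8 * min \<sigma> (ediam n K) \<le> lse_risk n K \<sigma> \<and>
         lse_risk n K \<sigma> \<le> max 1 (max C' C1) * min \<sigma> (ediam n K))"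
      proof (intro conjI impI)
        assume big: "max 302 C1 * \<sigma> \<le> eps_bar n K c \<sigma>"
        have "302 * \<sigma> \<le> max 302 C1 * \<sigma>" "C1 * \<sigma> \<le> max 302 C1 * \<sigma>"
          using \<sigma> by (intro mult_right_mono; simp)+
        then have b: "302 * \<sigma> \<le> eps_bar n K c \<sigma>" "C1 * \<sigma> \<le> eps_bar n K c \<sigma>" using big by linarith+
        show "eps_bar n K c \<sigma> / c \<le> lse_risk n K \<sigma>" by (rule eps_bar_le_lse_risk[OF b(1)])
        show "lse_risk n K \<sigma> \<le> eps_bar n K c ?s"
          using up b(2) eps_bar_mono[OF \<sigma> ss] by linarith
      next
        assume small: "eps_bar n K c ?s \<le> C' * \<sigma>"
        show "1/8 * min \<sigma> (ediam n K) \<le> lse_risk n K \<sigma>" using lse_risk_lower by simp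
        have "C' * \<sigma> \<le> max 1 (max C' C1) * \<sigma>" "C1 * \<sigma> \<le> max 1 (max C' C1) * \<sigma>"
          using \<sigma> by (intro mult_right_mono; simp)+
        then have 1: "lse_risk n K \<sigma> \<le> max 1 (max C' C1) * \<sigma>" using up small by linarith
        have "1 * ediam n K \<le> max 1 (max C' C1) * ediam n K"
          using diam_nonneg by (intro mult_right_mono) auto
        then have 2: "lse_risk n K \<sigma> \<le> max 1 (max C' C1) * ediam n K" using lse_risk_le_diam by linarith
        show "lse_risk n K \<sigma> \<le> max 1 (max C' C1) * min \<sigma> (ediam n K)"
          using 1 2 by (simp add: min_def)
      qed
    qed
  qed
qed

end
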